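(* Let $(\mathcal A,\mathfrak H,D)$ be the tensor product of an even spectral triple $(\mathcal A_1,\mathfrak H_1,D_1)$ and a spectral triple $(\mathcal A_2,\mathfrak H_2,D_2)$. Suppose that for $i=1,2$, $\mathrm{Tr}(e^{-tD_i^2})\stackrel{t\to0}{\sim}f_i(-\log t)\,t^{\alpha_i}$, where $\alpha_i<0$ and $f_i:\mathbb R^{\ge0}\to\mathbb R$ is bounded and locally integrable with $\lim_{s\to0^+}s\mathcal L[f_i](s)$ existing and non-zero, and suppose that $\lim_{s\to0^+}s\mathcal L[f_1f_2](s)$ exists and is non-zero. Let $A_1\in\mathcal B(\mathfrak H_1)$ and $A_2\in\mathcal B(\mathfrak H_2)$ be weakly regular with functions $f_{A_1}$ and $f_{A_2}$. Then $$\mathcal T(A_1\otimes A_2)=\lim_{s\to0^+}\frac{\mathcal L[f_{A_1}f_{A_2}](s)}{\mathcal L[f_1f_2](s)}.$$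
   Context: Spectral triples: all Dirac operators are self-adjoint, invertible with compact inverse, and $e^{-tD_i^2}$ is trace class for $t>0$. Tensor product: $\mathcal A=\mathcal A_1\otimes\mathcal A_2$, $\mathfrak H=\mathfrak H_1\otimes\mathfrak H_2$, $D=D_1\otimes1+\chi\otimes D_2$, where $\chi$ is the $\mathbb Z/2$-grading of the first triple (commuting with the representation and anticommuting with $D_1$). $\mathcal L[f](s)=\int_0^\infty f(x)e^{-sx}dx$. $g_1\stackrel{t\to0}{\sim}g_2$ means $|g_1-g_2|=o(|g_2|)$ as $t\to0^+$. $A_i\in\mathcal B(\mathfrak H_i)$ is weakly regular with function $f_{A_i}$ if $\mathrm{Tr}(e^{-tD_i^2}A_i)\stackrel{t\to0}{\sim}f_{A_i}(-\log t)t^{\alpha_i}$ where $f_{A_i}:\mathbb R^{\ge0}\to\mathbb C$ is bounded, non-zero, locally integrable and $\lim_{s\to0^+}s\mathcal L[f_{A_i}](s)$ exists. $\mathcal T(B)=\lim_{s\to s_0^+}\mathrm{Tr}(|D|^{-s}B)/\zeta(s)$ for $B\in\mathcal B(\mathfrak H)$ is the spectral state of the tensor product triple, where $\zeta(s)=\mathrm{Tr}(|D|^{-s})$ and $s_0$ is its abscissa of convergence. *)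

theory Defs
  imports "HOL-Analysis.Analysis" "HOL-Library.Landau_Symbols"
begin

section \<open>Complex Hilbert spaces and complex *-algebras\<close>

class complex_vector = real_vector +
  fixes scaleC :: "complex \<Rightarrow> 'a \<Rightarrow> 'a" (infixr "*\<^sub>C" 75)
  assumes scaleC_add_right: "c *\<^sub>C (x + y) = c *\<^sub>C x + c *\<^sub>C y"
    and scaleC_add_left: "(c + d) *\<^sub>C x = c *\<^sub>C x + d *\<^sub>C x"
    and scaleC_scaleC: "c *\<^sub>C (d *\<^sub>C x) = (c * d) *\<^sub>C x"
    and scaleR_scaleC: "r *\<^sub>R x = complex_of_real r *\<^sub>C x"

text \<open>The complex inner product is linear in the second argument. Its real part is the inner
  product of the underlying real Hilbert space, so that norm, topology and completeness are the
  library's.\<close>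

class complex_hilbert = complex_vector + real_inner + complete_space +
  fixes cinner :: "'a \<Rightarrow> 'a \<Rightarrow> complex"
  assumes cinner_commute: "cinner x y = cnj (cinner y x)"
    and cinner_add_right: "cinner x (y + z) = cinner x y + cinner x z"
    and cinner_scaleC_right: "cinner x (c *\<^sub>C y) = c * cinner x y"
    and Re_cinner: "Re (cinner x y) = inner x y"

class complex_star_algebra = complex_vector + real_algebra +
  fixes star :: "'a \<Rightarrow> 'a"
  assumes scaleC_mult_left: "(c *\<^sub>C a) * b = c *\<^sub>C (a * b)"
    and scaleC_mult_right: "a * (c *\<^sub>C b) = c *\<^sub>C (a * b)"
    and star_add: "star (a + b) = star a + star b"
    and star_scaleC: "star (c *\<^sub>C a) = cnj c *\<^sub>C star a"
    and star_mult: "star (a * b) = star b * star a"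
    and star_star: "star (star a) = a"

instantiation complex :: complex_hilbert
begin
definition scaleC_complex :: "complex \<Rightarrow> complex \<Rightarrow> complex" where
  "scaleC_complex c z = c * z"
definition cinner_complex :: "complex \<Rightarrow> complex \<Rightarrow> complex" where
  "cinner_complex w z = cnj w * z"
instance
  by standard
    (auto simp: scaleC_complex_def cinner_complex_def inner_complex_def scaleR_conv_of_real
      algebra_simps)
end

instantiation complex :: complex_star_algebra
begin
definition star_complex :: "complex \<Rightarrow> complex" where
  "star_complex = cnj"
instance
  by standard (auto simp: scaleC_complex_def star_complex_def algebra_simps)
end

definition clinear_map :: "('a::complex_vector \<Rightarrow> 'b::complex_vector) \<Rightarrow> bool" where
  "clinear_map f \<longleftrightarrow> (\<forall>x y. f (x + y) = f x + f y) \<and> (\<forall>c x. f (c *\<^sub>C x) = c *\<^sub>C f x)"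

definition cbilinear_map ::
  "('a::complex_vector \<Rightarrow> 'b::complex_vector \<Rightarrow> 'c::complex_vector) \<Rightarrow> bool" where
  "cbilinear_map f \<longleftrightarrow> (\<forall>x. clinear_map (f x)) \<and> (\<forall>y. clinear_map (\<lambda>x. f x y))"


section \<open>Bounded operators and the trace\<close>

definition bounded_op :: "('h::complex_hilbert \<Rightarrow> 'h) \<Rightarrow> bool" where
  "bounded_op T \<longleftrightarrow> bounded_linear T \<and> clinear_map T"

definition positive_op :: "('h::complex_hilbert \<Rightarrow> 'h) \<Rightarrow> bool" where
  "positive_op T \<longleftrightarrow> bounded_op T \<and> (\<forall>x. cinner x (T x) \<in> \<real>\<^sub>\<ge>\<^sub>0)"

definition compact_op :: "('h::complex_hilbert \<Rightarrow> 'h) \<Rightarrow> bool" where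
  "compact_op T \<longleftrightarrow> bounded_op T \<and> compact (closure (T ` cball 0 1))"

definition orthonormal_basis :: "'h::complex_hilbert set \<Rightarrow> bool" where
  "orthonormal_basis E \<longleftrightarrow>
     (\<forall>e\<in>E. \<forall>e'\<in>E. cinner e e' = (if e = e' then 1 else 0)) \<and>
     (\<forall>x. (\<forall>e\<in>E. cinner e x = 0) \<longrightarrow> x = 0)"

text \<open>\<open>P\<close> is the absolute value \<open>(T* T)\<^sup>1\<^sup>/\<^sup>2\<close>: as \<open>P\<close> is positive, hence
  self-adjoint, the second conjunct says \<open>P\<^sup>2 = T* T\<close>.\<close>

definition is_abs_op :: "('h::complex_hilbert \<Rightarrow> 'h) \<Rightarrow> ('h \<Rightarrow> 'h) \<Rightarrow> bool" where
  "is_abs_op P T \<longleftrightarrow> positive_op P \<and> (\<forall>x y. cinner (P x) (P y) = cinner (T x) (T y))"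

definition trace_class :: "('h::complex_hilbert \<Rightarrow> 'h) \<Rightarrow> bool" where
  "trace_class T \<longleftrightarrow> bounded_op T \<and>
     (\<exists>P E. is_abs_op P T \<and> orthonormal_basis E \<and> (\<lambda>e. cinner e (P e)) summable_on E)"

definition op_trace :: "('h::complex_hilbert \<Rightarrow> 'h) \<Rightarrow> complex" where
  "op_trace T = (THE \<tau>. \<forall>E. orthonormal_basis E \<longrightarrow> ((\<lambda>e. cinner e (T e)) has_sum \<tau>) E)"


section \<open>Unbounded operators\<close>

text \<open>An unbounded operator is represented by its graph.\<close>

type_synonym 'h graph = "('h \<times> 'h) set"

definition adjoint_graph :: "'h::complex_hilbert graph \<Rightarrow> 'h graph" where
  "adjoint_graph D = {(y, z). \<forall>(x, w)\<in>D. cinner y w = cinner z x}"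

text \<open>Density of the domain makes the adjoint single-valued and linear; a self-adjoint graph
  therefore inherits both properties.\<close>

definition self_adjoint :: "'h::complex_hilbert graph \<Rightarrow> bool" where
  "self_adjoint D \<longleftrightarrow> closure (Domain D) = UNIV \<and> adjoint_graph D = D"

definition has_compact_inverse :: "'h::complex_hilbert graph \<Rightarrow> bool" where
  "has_compact_inverse D \<longleftrightarrow> (\<exists>K. compact_op K \<and> D\<inverse> = {(y, K y) | y. True})"

definition eigenspace :: "'h::complex_hilbert graph \<Rightarrow> real \<Rightarrow> 'h set" where
  "eigenspace D l = {x. (x, l *\<^sub>R x) \<in> D}"

definition eigenvalues :: "'h::complex_hilbert graph \<Rightarrow> real set" where
  "eigenvalues D = {l. \<exists>x\<in>eigenspace D l. x \<noteq> 0}"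

definition orth_proj :: "'h::complex_hilbert set \<Rightarrow> 'h \<Rightarrow> 'h" where
  "orth_proj S x = (THE y. y \<in> S \<and> (\<forall>z\<in>S. cinner z (x - y) = 0))"

text \<open>Functional calculus of a self-adjoint operator with compact inverse. The spectral measure
  of such an operator is concentrated on its (real) eigenvalues, so
  \<open>g(D) = \<Sum>\<^sub>l g(l) P\<^sub>l\<close> with \<open>P\<^sub>l\<close> the orthogonal projection onto the eigenspace
  of \<open>l\<close>. If \<open>g\<close> is unbounded on the eigenvalues, the sum does not define a bounded
  operator, in particular not a trace class operator.\<close>

definition fun_calc :: "'h::complex_hilbert graph \<Rightarrow> (real \<Rightarrow> real) \<Rightarrow> 'h \<Rightarrow> 'h" where
  "fun_calc D g x = (\<Sum>\<^sub>\<infinity>l\<in>eigenvalues D. g l *\<^sub>R orth_proj (eigenspace D l) x)"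

definition heat_op :: "'h::complex_hilbert graph \<Rightarrow> real \<Rightarrow> 'h \<Rightarrow> 'h" where
  "heat_op D t = fun_calc D (\<lambda>l. exp (- t * l\<^sup>2))"

definition abs_power :: "'h::complex_hilbert graph \<Rightarrow> real \<Rightarrow> 'h \<Rightarrow> 'h" where
  "abs_power D s = fun_calc D (\<lambda>l. \<bar>l\<bar> powr (- s))"


section \<open>Spectral triples\<close>

definition star_representation ::
  "('a::complex_star_algebra \<Rightarrow> 'h::complex_hilbert \<Rightarrow> 'h) \<Rightarrow> bool" where
  "star_representation \<pi> \<longleftrightarrow>
     (\<forall>a. bounded_op (\<pi> a)) \<and>
     (\<forall>a b x. \<pi> (a + b) x = \<pi> a x + \<pi> b x) \<and>
     (\<forall>c a x. \<pi> (c *\<^sub>C a) x = c *\<^sub>C \<pi> a x) \<and>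
     (\<forall>a b x. \<pi> (a * b) x = \<pi> a (\<pi> b x)) \<and>
     (\<forall>a x y. cinner (\<pi> (star a) x) y = cinner x (\<pi> a y))"

definition bounded_commutator :: "'h::complex_hilbert graph \<Rightarrow> ('h \<Rightarrow> 'h) \<Rightarrow> bool" where
  "bounded_commutator D B \<longleftrightarrow>
     (\<forall>x\<in>Domain D. B x \<in> Domain D) \<and>
     (\<exists>C. \<forall>x u v. (x, u) \<in> D \<longrightarrow> (B x, v) \<in> D \<longrightarrow> norm (v - B u) \<le> C * norm x)"

text \<open>The algebra of the triple is the argument type of the representation.\<close>

definition spectral_triple ::
  "('a::complex_star_algebra \<Rightarrow> 'h::complex_hilbert \<Rightarrow> 'h) \<Rightarrow> 'h graph \<Rightarrow> bool" where
  "spectral_triple \<pi> D \<longleftrightarrow>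
     star_representation \<pi> \<and> self_adjoint D \<and> has_compact_inverse D \<and>
     (\<forall>a. bounded_commutator D (\<pi> a)) \<and>
     (\<forall>t>0. trace_class (heat_op D t))"

text \<open>\<open>\<gamma>\<close> is the grading usually written as chi, which is a binder in HOL-Analysis.\<close>

definition even_spectral_triple ::
  "('a::complex_star_algebra \<Rightarrow> 'h::complex_hilbert \<Rightarrow> 'h) \<Rightarrow> 'h graph \<Rightarrow> ('h \<Rightarrow> 'h) \<Rightarrow> bool" where
  "even_spectral_triple \<pi> D \<gamma> \<longleftrightarrow>
     spectral_triple \<pi> D \<and> bounded_op \<gamma> \<and>
     (\<forall>x. \<gamma> (\<gamma> x) = x) \<and> (\<forall>x y. cinner (\<gamma> x) y = cinner x (\<gamma> y)) \<and>
     (\<forall>a x. \<gamma> (\<pi> a x) = \<pi> a (\<gamma> x)) \<and>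
     (\<forall>x u. (x, u) \<in> D \<longrightarrow> (\<gamma> x, - \<gamma> u) \<in> D)"


section \<open>Tensor products\<close>

text \<open>\<open>ten\<close> exhibits \<open>'h\<close> as Hilbert space tensor product of \<open>'h1\<close> and \<open>'h2\<close>.
  The set of elementary tensors is stable under complex scalars, so its real span is its complex
  span.\<close>

definition hilbert_tensor ::
  "('h1::complex_hilbert \<Rightarrow> 'h2::complex_hilbert \<Rightarrow> 'h::complex_hilbert) \<Rightarrow> bool" where
  "hilbert_tensor ten \<longleftrightarrow> cbilinear_map ten \<and>
     (\<forall>x y x' y'. cinner (ten x y) (ten x' y') = cinner x x' * cinner y y') \<and>
     closure (span {ten x y | x y. True}) = UNIV"

text \<open>\<open>ta\<close> exhibits \<open>'a\<close> as algebraic tensor product of the *-algebras \<open>'a1\<close> and \<open>'a2\<close>.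
  The canonical map from the algebraic tensor product to \<open>'a\<close> is onto by the spanning condition.
  It is injective because every bilinear form factors through \<open>ta\<close>, and bilinear forms separate
  the points of the algebraic tensor product.\<close>

definition algebra_tensor ::
  "('a1::complex_star_algebra \<Rightarrow> 'a2::complex_star_algebra \<Rightarrow> 'a::complex_star_algebra) \<Rightarrow> bool" where
  "algebra_tensor ta \<longleftrightarrow> cbilinear_map ta \<and>
     (\<forall>a b a' b'. ta a b * ta a' b' = ta (a * a') (b * b')) \<and>
     (\<forall>a b. star (ta a b) = ta (star a) (star b)) \<and>
     span {ta a b | a b. True} = UNIV \<and>
     (\<forall>\<phi> :: 'a1 \<Rightarrow> 'a2 \<Rightarrow> complex. cbilinear_map \<phi> \<longrightarrow>
        (\<exists>\<Phi>. clinear_map \<Phi> \<and> (\<forall>a b. \<Phi> (ta a b) = \<phi> a b)))"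

definition tensor_op ::
  "('h1::complex_hilbert \<Rightarrow> 'h2::complex_hilbert \<Rightarrow> 'h::complex_hilbert) \<Rightarrow>
   ('h1 \<Rightarrow> 'h1) \<Rightarrow> ('h2 \<Rightarrow> 'h2) \<Rightarrow> 'h \<Rightarrow> 'h" where
  "tensor_op ten A B = (THE T. bounded_op T \<and> (\<forall>x y. T (ten x y) = ten (A x) (B y)))"

text \<open>\<open>D\<^sub>1 \<otimes> 1 + \<gamma> \<otimes> D\<^sub>2\<close> is the closure of the operator with this
  expression on the algebraic tensor product of the two domains. The generating set is again
  stable under complex scalars.\<close>

definition tensor_dirac ::
  "('h1::complex_hilbert \<Rightarrow> 'h2::complex_hilbert \<Rightarrow> 'h::complex_hilbert) \<Rightarrow>
   'h1 graph \<Rightarrow> ('h1 \<Rightarrow> 'h1) \<Rightarrow> 'h2 graph \<Rightarrow> 'h graph" where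
  "tensor_dirac ten D1 \<gamma> D2 = closure (span
     {(ten x y, ten u y + ten (\<gamma> x) v) | x u y v. (x, u) \<in> D1 \<and> (y, v) \<in> D2})"

definition is_tensor_triple ::
  "('h1::complex_hilbert \<Rightarrow> 'h2::complex_hilbert \<Rightarrow> 'h::complex_hilbert) \<Rightarrow>
   ('a1::complex_star_algebra \<Rightarrow> 'a2::complex_star_algebra \<Rightarrow> 'a::complex_star_algebra) \<Rightarrow>
   ('a1 \<Rightarrow> 'h1 \<Rightarrow> 'h1) \<Rightarrow> 'h1 graph \<Rightarrow> ('h1 \<Rightarrow> 'h1) \<Rightarrow>
   ('a2 \<Rightarrow> 'h2 \<Rightarrow> 'h2) \<Rightarrow> 'h2 graph \<Rightarrow>
   ('a \<Rightarrow> 'h \<Rightarrow> 'h) \<Rightarrow> 'h graph \<Rightarrow> bool" where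
  "is_tensor_triple ten ta \<pi>1 D1 \<gamma> \<pi>2 D2 \<pi> D \<longleftrightarrow>
     hilbert_tensor ten \<and> algebra_tensor ta \<and> star_representation \<pi> \<and>
     (\<forall>a b. \<pi> (ta a b) = tensor_op ten (\<pi>1 a) (\<pi>2 b)) \<and>
     D = tensor_dirac ten D1 \<gamma> D2"


section \<open>Asymptotics, weak regularity and the spectral state\<close>

definition laplace :: "(real \<Rightarrow> 'v::{banach, second_countable_topology}) \<Rightarrow> real \<Rightarrow> 'v" where
  "laplace f s = (LINT x:{0..}|lebesgue. exp (- s * x) *\<^sub>R f x)"

definition locally_integrable :: "(real \<Rightarrow> 'v::euclidean_space) \<Rightarrow> bool" where
  "locally_integrable f \<longleftrightarrow> (\<forall>b. f absolutely_integrable_on {0..b})"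

definition asymptotic_at_0 :: "(real \<Rightarrow> complex) \<Rightarrow> (real \<Rightarrow> complex) \<Rightarrow> bool" where
  "asymptotic_at_0 g1 g2 \<longleftrightarrow> (\<lambda>t. g1 t - g2 t) \<in> o[at_right 0](g2)"

definition weakly_regular ::
  "'h::complex_hilbert graph \<Rightarrow> real \<Rightarrow> ('h \<Rightarrow> 'h) \<Rightarrow> (real \<Rightarrow> complex) \<Rightarrow> bool" where
  "weakly_regular D \<alpha> A f \<longleftrightarrow>
     asymptotic_at_0 (\<lambda>t. op_trace (heat_op D t \<circ> A)) (\<lambda>t. f (- ln t) * of_real (t powr \<alpha>)) \<and>
     bounded (f ` {0..}) \<and> (\<exists>x\<ge>0. f x \<noteq> 0) \<and> locally_integrable f \<and>
     (\<exists>l. ((\<lambda>s. s *\<^sub>R laplace f s) \<longlongrightarrow> l) (at_right 0))"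

text \<open>The series \<open>\<zeta>(s) = Tr |D|\<^sup>-\<^sup>s\<close> has positive terms, so it converges exactly
  when \<open>|D|\<^sup>-\<^sup>s\<close> is trace class. The infimum is infinite if this happens for no \<open>s\<close>.\<close>

definition zeta_abscissa :: "'h::complex_hilbert graph \<Rightarrow> ereal" where
  "zeta_abscissa D = Inf (ereal ` {s. trace_class (abs_power D s)})"

text \<open>The limit defining the spectral state need not exist for every bounded operator \<open>B\<close>;
  \<open>has_spectral_state D B \<tau>\<close> says that it exists and equals \<open>\<tau>\<close>.\<close>

definition has_spectral_state ::
  "'h::complex_hilbert graph \<Rightarrow> ('h \<Rightarrow> 'h) \<Rightarrow> complex \<Rightarrow> bool" where
  "has_spectral_state D B \<tau> \<longleftrightarrow>
     (\<exists>s0. zeta_abscissa D = ereal s0 \<and>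
        ((\<lambda>s. op_trace (abs_power D s \<circ> B) / op_trace (abs_power D s)) \<longlongrightarrow> \<tau>) (at_right s0))"

end

theory Submission
  imports Defs
begin

text \<open>The eigenvectors of \<open>D\<^sub>1\<close> and \<open>D\<^sub>2\<close> form orthonormal bases, and \<open>|D|\<^sup>-\<^sup>s\<close> is diagonal in
  the tensor product basis with entries \<open>(l\<^sup>2 + m\<^sup>2)\<^sup>-\<^sup>s\<^sup>/\<^sup>2\<close>. Hence \<open>\<Gamma>(s/2) Tr(|D|\<^sup>-\<^sup>s A\<^sub>1 \<otimes> A\<^sub>2)\<close> is the
  Mellin transform at \<open>s/2\<close> of the product of the two heat traces. With \<open>t = exp(-x)\<close> and
  \<open>u = s/2 + \<alpha>\<^sub>1 + \<alpha>\<^sub>2\<close> the part \<open>t \<le> 1\<close> becomes a Laplace transform at \<open>u\<close>, and the part \<open>t \<ge> 1\<close> stays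
  bounded. As the heat asymptotics have bounded coefficients, an Abelian argument shows that
  \<open>u \<Gamma>(s/2) Tr(|D|\<^sup>-\<^sup>s A\<^sub>1 \<otimes> A\<^sub>2)\<close> and \<open>u \<L>[f\<^sub>A\<^sub>1 f\<^sub>A\<^sub>2](u)\<close> differ by \<open>o(1)\<close> as \<open>u \<rightarrow> 0\<close>, and likewise without
  \<open>A\<^sub>1\<close>, \<open>A\<^sub>2\<close>, where the limit is non-zero. So the abscissa is \<open>-2(\<alpha>\<^sub>1 + \<alpha>\<^sub>2)\<close> and the two quotients
  differ by \<open>o(1)\<close>.\<close>

section \<open>Complex Hilbert spaces\<close>

text \<open>Two points shape the proof. A vector \<open>ten e f\<close> is in general no eigenvector
  of \<open>D\<close>, since \<open>\<gamma>\<close> moves \<open>e\<close>; it is a sum of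
  eigenvectors for opposite eigenvalues, and an even function of \<open>D\<close> treats both alike.
  Traces are therefore computed in a basis of elementary tensors, although \<open>D\<close> itself
  need not be diagonal there. As \<open>op_trace\<close> and \<open>trace_class\<close> refer to
  arbitrary orthonormal bases and an arbitrary absolute value, independence of these choices has to
  be shown, which is done for diagonal operators (times a bounded one, in the case of the trace).
  The other point is that neither quotient needs to converge: after scaling, the two denominators
  tend to the same non-zero limit, while the numerators are merely bounded. So quotients are
  compared instead of computed, which gives an equivalence for each \<open>\<tau>\<close>. The same
  non-zero limit bounds the abscissa from below: trace class at a smaller exponent would keep the
  zeta function bounded near the claimed abscissa, and the factor \<open>u\<close> would force the
  limit to be 0.\<close>

instance complex_hilbert \<subseteq> banach ..

lemma cinner_scaleC_left: "cinner (c *\<^sub>C x) (y::'h::complex_hilbert) = cnj c * cinner x y"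
  by (metis cinner_commute cinner_scaleC_right complex_cnj_mult)

lemma cinner_add_left: "cinner (x + y) (z::'h::complex_hilbert) = cinner x z + cinner y z"
  by (metis cinner_add_right cinner_commute complex_cnj_add)

lemma cinner_scaleR_right: "cinner x (r *\<^sub>R (y::'h::complex_hilbert)) = of_real r * cinner x y"
  by (simp add: scaleR_scaleC cinner_scaleC_right)

lemma cinner_scaleR_left: "cinner (r *\<^sub>R x) (y::'h::complex_hilbert) = of_real r * cinner x y"
  by (simp add: scaleR_scaleC cinner_scaleC_left)

lemma cinner_minus_right: "cinner x (- (y::'h::complex_hilbert)) = - cinner x y"
  using cinner_scaleR_right[of x "-1" y] by simp

lemma cinner_diff_right: "cinner x (y - (z::'h::complex_hilbert)) = cinner x y - cinner x z"
  using cinner_add_right[of x y "- z"] by (simp add: cinner_minus_right)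

lemma cinner_zero_right [simp]: "cinner x (0::'h::complex_hilbert) = 0"
  using cinner_scaleR_right[of x 0 0] by simp

lemma cinner_zero_left [simp]: "cinner 0 (x::'h::complex_hilbert) = 0"
  using cinner_scaleR_left[of 0 0 x] by simp

lemma cinner_sum_right: "cinner x (sum f F) = (\<Sum>i\<in>F. cinner x (f i :: 'h::complex_hilbert))"
  by (induction F rule: infinite_finite_induct) (auto simp: cinner_add_right)

lemma cinner_self: "cinner (x::'h::complex_hilbert) x = of_real ((norm x)\<^sup>2)"
proof -
  have "Im (cinner x x) = 0"
    using arg_cong[OF cinner_commute[of x x], of Im] by simp
  then show ?thesis
    by (simp add: complex_eq_iff Re_cinner power2_norm_eq_inner)
qed

lemma cinner_self_eq_0_iff [simp]: "cinner (x::'h::complex_hilbert) x = 0 \<longleftrightarrow> x = 0"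
  by (simp add: cinner_self)

lemma cinner_eq_0_commute: "cinner x (y::'h::complex_hilbert) = 0 \<longleftrightarrow> cinner y x = 0"
  by (metis cinner_commute complex_cnj_zero)

lemma inner_eq_0_if_cinner: "cinner x (y::'h::complex_hilbert) = 0 \<Longrightarrow> inner x y = 0"
  by (metis Re_cinner zero_complex.simps(1))

lemma norm_scaleC: "norm (c *\<^sub>C (x::'h::complex_hilbert)) = cmod c * norm x"
proof -
  have "complex_of_real ((norm (c *\<^sub>C x))\<^sup>2) = (cnj c * c) * of_real ((norm x)\<^sup>2)"
    by (simp only: cinner_self[symmetric] cinner_scaleC_left cinner_scaleC_right mult_ac)
  also have "cnj c * c = of_real ((cmod c)\<^sup>2)"
    by (metis complex_norm_square mult.commute)
  also have "of_real ((cmod c)\<^sup>2) * complex_of_real ((norm x)\<^sup>2) = of_real ((cmod c * norm x)\<^sup>2)"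
    by (simp add: power_mult_distrib)
  finally have "(norm (c *\<^sub>C x))\<^sup>2 = (cmod c * norm x)\<^sup>2"
    by (simp only: of_real_eq_iff)
  then show ?thesis
    by (simp add: power2_eq_iff_nonneg)
qed

lemma cinner_norm_le: "cmod (cinner x (y::'h::complex_hilbert)) \<le> norm x * norm y"
proof (cases "cinner x y = 0")
  case False
  \<comment> \<open>The phase that rotates the complex inner product onto the positive real axis,
    where it agrees with the real one and the real Cauchy-Schwarz inequality applies.\<close>
  define c where "c = cnj (sgn (cinner x y))"
  have "cinner x (c *\<^sub>C y) = of_real (cmod (cinner x y))"
    by (simp add: cinner_scaleC_right c_def sgn_div_norm scaleR_conv_of_real field_simps)
       (metis False complex_norm_square mult.commute nonzero_eq_divide_eq norm_eq_zero of_real_eq_0_iff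
          power2_eq_square of_real_mult)
  then have "cmod (cinner x y) = inner x (c *\<^sub>C y)"
    by (metis Re_cinner Re_complex_of_real)
  also have "\<dots> \<le> norm x * norm (c *\<^sub>C y)"
    by (rule norm_cauchy_schwarz)
  also have "norm (c *\<^sub>C y) = norm y"
    using False by (simp add: norm_scaleC c_def norm_sgn)
  finally show ?thesis .
qed auto

lemma bounded_bilinear_cinner: "bounded_bilinear (cinner :: 'h::complex_hilbert \<Rightarrow> _)"
proof
  show "\<exists>K. \<forall>a b. cmod (cinner (a::'h) b) \<le> norm a * norm b * K"
    by (rule exI[of _ 1]) (simp add: cinner_norm_le)
qed (auto simp: cinner_add_left cinner_add_right cinner_scaleR_left cinner_scaleR_right
       scaleR_conv_of_real)

lemmas bounded_linear_cinner_right = bounded_bilinear.bounded_linear_right[OF bounded_bilinear_cinner]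
lemmas tendsto_cinner [tendsto_intros] = bounded_bilinear.tendsto[OF bounded_bilinear_cinner]
lemmas continuous_on_cinner [continuous_intros] =
  bounded_bilinear.continuous_on[OF bounded_bilinear_cinner]

lemma bounded_linear_scaleC_right: "bounded_linear (\<lambda>x::'h::complex_hilbert. c *\<^sub>C x)"
proof
  show "c *\<^sub>C (r *\<^sub>R x) = r *\<^sub>R c *\<^sub>C (x::'h)" for r x
    by (simp add: scaleR_scaleC scaleC_scaleC mult.commute)
  show "\<exists>K. \<forall>x. norm (c *\<^sub>C (x::'h)) \<le> norm x * K"
    by (rule exI[of _ "cmod c"]) (simp add: norm_scaleC)
qed (rule scaleC_add_right)

lemma scaleC_zero_left [simp]: "0 *\<^sub>C (x::'a::complex_vector) = 0"
  by (metis of_real_0 scaleR_scaleC scaleR_zero_left)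

lemma scaleC_zero_right [simp]: "c *\<^sub>C (0::'a::complex_vector) = 0"
  using scaleC_scaleC[of c 0 "0::'a"] by simp

lemma scaleR_scaleC_commute: "r *\<^sub>R c *\<^sub>C (x::'a::complex_vector) = c *\<^sub>C (r *\<^sub>R x)"
  by (simp add: scaleR_scaleC scaleC_scaleC mult.commute)

lemma bounded_opD:
  assumes "bounded_op T"
  shows "bounded_linear T" "T (x + y) = T x + T y" "T (c *\<^sub>C x) = c *\<^sub>C T x"
    "T (r *\<^sub>R x) = r *\<^sub>R T x"
  using assms by (auto simp: bounded_op_def clinear_map_def scaleR_scaleC)

section \<open>Orthogonal series and orthonormal bases\<close>

lemma norm_sum_orthogonal:
  fixes a :: "'i \<Rightarrow> 'h::real_inner"
  assumes "finite F" "\<And>i j. i \<in> F \<Longrightarrow> j \<in> F \<Longrightarrow> i \<noteq> j \<Longrightarrow> inner (a i) (a j) = 0"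
  shows "(norm (sum a F))\<^sup>2 = (\<Sum>i\<in>F. (norm (a i))\<^sup>2)"
  using assms
proof (induction F rule: finite_induct)
  case (insert i F)
  have "inner (a i) (sum a F) = 0"
    using insert by (auto simp: inner_sum_right intro!: sum.neutral)
  then have "(norm (a i + sum a F))\<^sup>2 = (norm (a i))\<^sup>2 + (norm (sum a F))\<^sup>2"
    by (simp add: power2_norm_eq_inner inner_add_left inner_add_right inner_commute)
  with insert show ?case by auto
qed auto

lemma summable_on_orthogonal:
  fixes a :: "'i \<Rightarrow> 'h::{real_inner,complete_space}"
  assumes orth: "\<And>i j. i \<in> I \<Longrightarrow> j \<in> I \<Longrightarrow> i \<noteq> j \<Longrightarrow> inner (a i) (a j) = 0"
    and sq: "(\<lambda>i. (norm (a i))\<^sup>2) summable_on I"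
  shows "a summable_on I"
proof -
  have "cauchy_filter (filtermap (sum a) (finite_subsets_at_top I))"
    unfolding cauchy_filter_metric_filtermap
  proof (intro allI impI)
    fix e :: real assume "0 < e"
    \<comment> \<open>Pythagoras controls squared distances; two partial sums are compared through
      \<open>sum a F0\<close>, so each may be off by \<open>e/2\<close>.\<close>
    define d where "d = (e/2)\<^sup>2"
    have "d > 0" using \<open>0 < e\<close> by (simp add: d_def)
    obtain F0 where F0: "finite F0" "F0 \<subseteq> I"
      "dist (\<Sum>i\<in>F0. (norm (a i))\<^sup>2) (\<Sum>\<^sub>\<infinity>i\<in>I. (norm (a i))\<^sup>2) \<le> d / 2"
      using infsum_finite_approximation[OF sq, of "d/2"] \<open>d > 0\<close> by auto
    have tail: "dist (sum a F) (sum a F0) < e / 2" if F: "finite F" "F0 \<subseteq> F" "F \<subseteq> I" for F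
    proof -
      have "sum a F - sum a F0 = sum a (F - F0)"
        using F by (simp add: sum_diff)
      then have "(dist (sum a F) (sum a F0))\<^sup>2 = (\<Sum>i\<in>F-F0. (norm (a i))\<^sup>2)"
        using F by (auto simp: dist_norm subset_iff intro!: norm_sum_orthogonal orth)
      also have "\<dots> = (\<Sum>i\<in>F. (norm (a i))\<^sup>2) - (\<Sum>i\<in>F0. (norm (a i))\<^sup>2)"
        using F by (simp add: sum_diff)
      also have "\<dots> \<le> (\<Sum>\<^sub>\<infinity>i\<in>I. (norm (a i))\<^sup>2) - (\<Sum>i\<in>F0. (norm (a i))\<^sup>2)"
        using finite_sum_le_infsum[OF sq, of F] F by auto
      also have "\<dots> \<le> d / 2"
        using F0(3) unfolding dist_real_def by linarith
      also have "\<dots> < (e/2)\<^sup>2"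
        using \<open>d > 0\<close> by (simp add: d_def)
      finally show ?thesis
        by (rule power_less_imp_less_base) (use \<open>0 < e\<close> in auto)
    qed
    show "\<exists>P. eventually P (finite_subsets_at_top I) \<and>
            (\<forall>x y. P x \<and> P y \<longrightarrow> dist (sum a x) (sum a y) < e)"
    proof (intro exI conjI allI impI)
      show "\<forall>\<^sub>F F in finite_subsets_at_top I. finite F \<and> F0 \<subseteq> F \<and> F \<subseteq> I"
        using F0 by (auto simp: eventually_finite_subsets_at_top)
      fix F G assume "(finite F \<and> F0 \<subseteq> F \<and> F \<subseteq> I) \<and> (finite G \<and> F0 \<subseteq> G \<and> G \<subseteq> I)"
      then have "dist (sum a F) (sum a F0) < e/2" "dist (sum a G) (sum a F0) < e/2"
        using tail by auto
      then show "dist (sum a F) (sum a G) < e"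
        by metric
    qed
  qed
  moreover have "complete (UNIV :: 'h set)"
    by (rule complete_UNIV)
  ultimately have "\<exists>x. filtermap (sum a) (finite_subsets_at_top I) \<le> nhds x"
    unfolding complete_uniform by (auto simp: filtermap_bot_iff)
  then show ?thesis
    by (auto simp: summable_on_def has_sum_def filterlim_def)
qed

lemma has_sum_norm_orthogonal:
  fixes a :: "'i \<Rightarrow> 'h::real_inner"
  assumes orth: "\<And>i j. i \<in> I \<Longrightarrow> j \<in> I \<Longrightarrow> i \<noteq> j \<Longrightarrow> inner (a i) (a j) = 0"
    and x: "(a has_sum x) I"
  shows "((\<lambda>i. (norm (a i))\<^sup>2) has_sum (norm x)\<^sup>2) I"
proof -
  have "((\<lambda>F. (norm (sum a F))\<^sup>2) \<longlongrightarrow> (norm x)\<^sup>2) (finite_subsets_at_top I)"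
    using x by (auto simp: has_sum_def intro!: tendsto_intros)
  then show ?thesis
    unfolding has_sum_def
    by (rule tendsto_cong[THEN iffD1, rotated])
       (auto intro!: eventually_finite_subsets_at_top_weakI norm_sum_orthogonal orth)
qed

definition orthonormal_set :: "'h::complex_hilbert set \<Rightarrow> bool" where
  "orthonormal_set E \<longleftrightarrow> (\<forall>e\<in>E. \<forall>e'\<in>E. cinner e e' = (if e = e' then 1 else 0))"

lemma orthonormal_set_basis: "orthonormal_basis E \<Longrightarrow> orthonormal_set E"
  by (auto simp: orthonormal_basis_def orthonormal_set_def)

lemma orthonormal_norm:
  assumes "orthonormal_set E" "e \<in> E"
  shows "norm e = 1"
proof -
  have "complex_of_real ((norm e)\<^sup>2) = 1"
    using assms by (simp only: cinner_self[symmetric] orthonormal_set_def) simp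
  then have "(norm e)\<^sup>2 = 1"
    by (simp only: of_real_eq_1_iff)
  then show ?thesis
    using norm_ge_zero[of e] by (auto simp: power2_eq_1_iff)
qed

lemma orthonormal_inner_0:
  assumes "orthonormal_set E" "e \<in> E" "e' \<in> E" "e \<noteq> e'"
  shows "inner (c *\<^sub>C e) (c' *\<^sub>C e') = 0"
  using assms by (intro inner_eq_0_if_cinner)
    (auto simp: cinner_scaleC_left cinner_scaleC_right orthonormal_set_def)

text \<open>The partial Fourier sum \<open>y\<close> has the inner product of \<open>x\<close> and
  \<open>y\<close> equal to its own squared norm, so Cauchy-Schwarz bounds its norm by that of
  \<open>x\<close>.\<close>

lemma bessel:
  assumes E: "orthonormal_set E" and "finite F" "F \<subseteq> E"
  shows "(\<Sum>e\<in>F. (cmod (cinner e x))\<^sup>2) \<le> (norm x)\<^sup>2"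
proof -
  define y where "y = (\<Sum>e\<in>F. cinner e x *\<^sub>C e)"
  have ny: "(norm y)\<^sup>2 = (\<Sum>e\<in>F. (cmod (cinner e x))\<^sup>2)"
    unfolding y_def using assms
    by (subst norm_sum_orthogonal)
       (auto simp: norm_scaleC orthonormal_norm[OF E] subset_iff intro!: orthonormal_inner_0[OF E])
  have "cinner x y = (\<Sum>e\<in>F. of_real ((cmod (cinner e x))\<^sup>2))"
    unfolding y_def
    by (simp only: cinner_sum_right cinner_scaleC_right complex_norm_square cinner_commute[of x])
  also have "\<dots> = of_real ((norm y)\<^sup>2)"
    unfolding ny by simp
  finally have "cinner x y = of_real ((norm y)\<^sup>2)" .
  then have "inner x y = (norm y)\<^sup>2"
    by (metis Re_cinner Re_complex_of_real)
  moreover have "inner x y \<le> norm x * norm y"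
    by (rule norm_cauchy_schwarz)
  ultimately have "norm y * norm y \<le> norm x * norm y"
    by (simp add: power2_eq_square)
  then have "norm y \<le> norm x"
    by (cases "norm y = 0") (auto simp: mult_le_cancel_right)
  then show ?thesis
    by (metis ny norm_ge_zero power_mono)
qed

lemma bessel_summable:
  assumes E: "orthonormal_set E"
  shows "(\<lambda>e. (cmod (cinner e x))\<^sup>2) summable_on E"
  by (rule nonneg_bdd_above_summable_on)
     (auto intro!: bdd_aboveI[of _ "(norm x)\<^sup>2"] bessel[OF E])

lemma orthonormal_coeff_summable:
  assumes E: "orthonormal_set E" and "(\<lambda>e. (cmod (c e))\<^sup>2) summable_on E"
  shows "(\<lambda>e. c e *\<^sub>C e) summable_on E"
  by (rule summable_on_orthogonal)
     (auto intro!: orthonormal_inner_0[OF E] summable_on_cong[THEN iffD1, OF _ assms(2)]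
       simp: norm_scaleC orthonormal_norm[OF E])

lemma cinner_has_sum:
  assumes "(a has_sum x) I"
  shows "((\<lambda>i. cinner y (a i)) has_sum cinner y x) I"
  using has_sum_bounded_linear[OF bounded_linear_cinner_right assms] .

lemma orthonormal_coeff:
  assumes E: "orthonormal_set E" and x: "((\<lambda>e. c e *\<^sub>C e) has_sum x) E" and e: "e \<in> E"
  shows "cinner e x = c e"
proof -
  have "((\<lambda>e'. cinner e (c e' *\<^sub>C e')) has_sum cinner e x) E"
    by (rule cinner_has_sum[OF x])
  moreover have "((\<lambda>e'. cinner e (c e' *\<^sub>C e')) has_sum c e) E"
    using E e by (intro has_sum_finite_neutralI[of "{e}"])
      (auto simp: cinner_scaleC_right orthonormal_set_def)
  ultimately show ?thesis
    by (rule has_sum_unique)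
qed

text \<open>The Fourier series converges for every orthonormal set; its difference from
  \<open>x\<close> is orthogonal to \<open>E\<close>, and the second half of
  \<open>orthonormal_basis\<close> makes it vanish.\<close>

lemma basis_expansion:
  assumes B: "orthonormal_basis E"
  shows "((\<lambda>e. cinner e x *\<^sub>C e) has_sum x) E"
proof -
  note E = orthonormal_set_basis[OF B]
  obtain y where y: "((\<lambda>e. cinner e x *\<^sub>C e) has_sum y) E"
    using orthonormal_coeff_summable[OF E bessel_summable[OF E]] by (auto simp: summable_on_def)
  have "cinner e (x - y) = 0" if "e \<in> E" for e
    using orthonormal_coeff[OF E y that] by (simp add: cinner_diff_right)
  then have "x - y = 0"
    using B unfolding orthonormal_basis_def by blast
  with y show ?thesis by simp
qed

lemma parseval:
  assumes B: "orthonormal_basis E"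
  shows "((\<lambda>e. (cmod (cinner e x))\<^sup>2) has_sum (norm x)\<^sup>2) E"
proof -
  note E = orthonormal_set_basis[OF B]
  have "((\<lambda>e. (norm (cinner e x *\<^sub>C e))\<^sup>2) has_sum (norm x)\<^sup>2) E"
    by (rule has_sum_norm_orthogonal[OF orthonormal_inner_0[OF E] basis_expansion[OF B]])
  then show ?thesis
    by (rule has_sum_cong[THEN iffD1, rotated]) (simp add: norm_scaleC orthonormal_norm[OF E])
qed

section \<open>Spectral decomposition\<close>

lemma bounded_op_0: "bounded_op T \<Longrightarrow> T 0 = 0"
  using bounded_opD(1) linear_simps(3) by blast

text \<open>\<open>T\<close> is known only through its series, which is the form in which
  \<open>fun_calc\<close> becomes available: linearity comes from uniqueness of sums, the norm bound
  from Parseval. The bound is by the absolute value of \<open>C\<close>, since \<open>C\<close> may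
  be negative when \<open>E\<close> is empty.\<close>

lemma bounded_op_diagonal:
  assumes B: "orthonormal_basis E" and C: "\<And>e. e \<in> E \<Longrightarrow> \<bar>c e\<bar> \<le> C"
    and T: "\<And>x. ((\<lambda>e. c e *\<^sub>R cinner e x *\<^sub>C e) has_sum T x) E"
  shows "bounded_op T"
proof -
  note E = orthonormal_set_basis[OF B]
  have add: "T (x + y) = T x + T y" for x y
    using has_sum_unique[OF T[of "x + y"]] has_sum_add[OF T[of x] T[of y]]
    by (simp add: cinner_add_right scaleC_add_left scaleR_add_right)
  have scaleC: "T (r *\<^sub>C x) = r *\<^sub>C T x" for r x
    using has_sum_unique[OF T[of "r *\<^sub>C x"]] has_sum_bounded_linear[OF bounded_linear_scaleC_right T[of x]]
    by (simp add: cinner_scaleC_right scaleC_scaleC[symmetric] scaleR_scaleC_commute)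
  have norm: "norm (T x) \<le> norm x * \<bar>C\<bar>" for x
  proof -
    have "((\<lambda>e. (norm (c e *\<^sub>R cinner e x *\<^sub>C e))\<^sup>2) has_sum (norm (T x))\<^sup>2) E"
      by (rule has_sum_norm_orthogonal[OF _ T]) (simp add: orthonormal_inner_0[OF E])
    moreover have "((\<lambda>e. C\<^sup>2 * (cmod (cinner e x))\<^sup>2) has_sum C\<^sup>2 * (norm x)\<^sup>2) E"
      by (rule has_sum_cmult_right[OF parseval[OF B]])
    moreover have "(norm (c e *\<^sub>R cinner e x *\<^sub>C e))\<^sup>2 \<le> C\<^sup>2 * (cmod (cinner e x))\<^sup>2" if "e \<in> E" for e
      using C[OF that] abs_le_square_iff[of "c e" C]
      by (auto simp: norm_scaleC orthonormal_norm[OF E that] power_mult_distrib intro!: mult_right_mono)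
    ultimately have "(norm (T x))\<^sup>2 \<le> C\<^sup>2 * (norm x)\<^sup>2"
      by (rule has_sum_mono)
    then show ?thesis
      by (metis abs_le_square_iff abs_mult abs_norm_cancel mult.commute power_mult_distrib)
  qed
  have "bounded_linear T"
    using norm by (intro bounded_linear_intro) (auto simp: add scaleR_scaleC scaleC)
  then show ?thesis
    by (auto simp: bounded_op_def clinear_map_def add scaleC)
qed

text \<open>\<open>V\<close> is an arbitrary set because it will be the union of all eigenspaces,
  which is no subspace. Restricting Zorn's lemma to subsets of \<open>V\<close> keeps every member
  of the family an eigenvector; maximality can then be tested only against unit vectors of
  \<open>V\<close>.\<close>

lemma exists_maximal_orthonormal:
  obtains M where "M \<subseteq> V" "orthonormal_set M"
    "\<And>v. v \<in> V \<Longrightarrow> norm v = 1 \<Longrightarrow> \<exists>e\<in>M. cinner e v \<noteq> 0"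
proof -
  let ?A = "{M. M \<subseteq> V \<and> orthonormal_set M}"
  have "\<exists>M\<in>?A. \<forall>X\<in>?A. M \<subseteq> X \<longrightarrow> X = M"
  proof (rule subset_Zorn')
    fix C assume C: "subset.chain ?A C"
    have "cinner e e' = (if e = e' then 1 else 0)" if ee: "e \<in> \<Union>C" "e' \<in> \<Union>C" for e e'
    proof -
      obtain X Y where XY: "X \<in> C" "Y \<in> C" "e \<in> X" "e' \<in> Y"
        using ee by auto
      have "X \<subseteq> Y \<or> Y \<subseteq> X"
        using C XY unfolding subset_chain_def by blast
      moreover have "orthonormal_set X" "orthonormal_set Y"
        using C XY unfolding subset_chain_def by blast+
      ultimately show ?thesis
        using XY unfolding orthonormal_set_def by blast
    qed
    then show "\<Union>C \<in> ?A"
      using C by (auto simp: orthonormal_set_def subset.chain_def)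
  qed
  then obtain M where M: "M \<subseteq> V" "orthonormal_set M"
    and max: "\<And>X. X \<subseteq> V \<Longrightarrow> orthonormal_set X \<Longrightarrow> M \<subseteq> X \<Longrightarrow> X = M"
    by auto
  have "\<exists>e\<in>M. cinner e v \<noteq> 0" if v: "v \<in> V" "norm v = 1" for v
  proof (rule ccontr)
    assume *: "\<not> ?thesis"
    then have "orthonormal_set (insert v M)"
      using M(2) v by (auto simp: orthonormal_set_def cinner_self cinner_eq_0_commute)
    then have "v \<in> M"
      using max[of "insert v M"] M(1) v by auto
    then show False
      using * v by (auto simp: cinner_self)
  qed
  with M that show ?thesis by blast
qed

text \<open>Common ground of \<open>D1\<close>, \<open>D2\<close> and \<open>tensor_dirac\<close>:
  the first two satisfy it by self-adjointness, the last by inspection of its generators. Together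
  with totality of the eigenvectors it carries the whole functional calculus.\<close>

locale symmetric_graph =
  fixes D :: "'h::complex_hilbert graph"
  assumes graph_zero: "(0, 0) \<in> D"
    and graph_add: "(x, u) \<in> D \<Longrightarrow> (y, v) \<in> D \<Longrightarrow> (x + y, u + v) \<in> D"
    and graph_scaleC: "(x, u) \<in> D \<Longrightarrow> (c *\<^sub>C x, c *\<^sub>C u) \<in> D"
    and closed_graph: "closed D"
    and graph_sym: "(x, u) \<in> D \<Longrightarrow> (y, v) \<in> D \<Longrightarrow> cinner x v = cinner u y"
begin

lemma eigenspace_zero: "0 \<in> eigenspace D l"
  by (simp add: eigenspace_def graph_zero)

lemma eigenspace_add: "x \<in> eigenspace D l \<Longrightarrow> y \<in> eigenspace D l \<Longrightarrow> x + y \<in> eigenspace D l"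
  using graph_add by (auto simp: eigenspace_def scaleR_add_right)

lemma eigenspace_scaleC: "x \<in> eigenspace D l \<Longrightarrow> c *\<^sub>C x \<in> eigenspace D l"
  using graph_scaleC by (auto simp: eigenspace_def scaleR_scaleC_commute)

lemma eigenspace_scaleR: "x \<in> eigenspace D l \<Longrightarrow> r *\<^sub>R x \<in> eigenspace D l"
  by (simp add: scaleR_scaleC eigenspace_scaleC)

lemma eigenspace_diff: "x \<in> eigenspace D l \<Longrightarrow> y \<in> eigenspace D l \<Longrightarrow> x - y \<in> eigenspace D l"
  using eigenspace_add[of x l "- y"] eigenspace_scaleR[of y l "-1"] by simp

lemma eigenspace_sum: "(\<And>i. i \<in> F \<Longrightarrow> a i \<in> eigenspace D l) \<Longrightarrow> sum a F \<in> eigenspace D l"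
  by (induction F rule: infinite_finite_induct) (auto intro: eigenspace_zero eigenspace_add)

lemma closed_eigenspace: "closed (eigenspace D l)"
proof -
  have "closed ((\<lambda>x. (x, l *\<^sub>R x)) -` D)"
    by (intro closed_vimage closed_graph continuous_intros)
  then show ?thesis
    by (simp add: eigenspace_def vimage_def)
qed

lemma eigenspace_has_sum:
  assumes "\<And>i. i \<in> I \<Longrightarrow> a i \<in> eigenspace D l" "(a has_sum x) I"
  shows "x \<in> eigenspace D l"
  using assms(2) unfolding has_sum_def
  by (rule Lim_in_closed_set[OF closed_eigenspace, rotated 2])
     (auto intro!: eventually_finite_subsets_at_top_weakI eigenspace_sum assms(1))

lemma eigenspace_orth:
  assumes "x \<in> eigenspace D l" "y \<in> eigenspace D m" "l \<noteq> m"
  shows "cinner x y = 0"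
proof -
  have "of_real m * cinner x y = of_real l * cinner x y"
    using graph_sym[of x "l *\<^sub>R x" y "m *\<^sub>R y"] assms
    by (simp add: eigenspace_def cinner_scaleR_left cinner_scaleR_right)
  then show ?thesis
    using assms(3) by simp
qed

text \<open>Makes the definite description in \<open>orth_proj\<close> computable: the difference of
  two candidates lies in the eigenspace and is orthogonal to it.\<close>

lemma orth_projI:
  assumes "y \<in> eigenspace D l" "\<And>z. z \<in> eigenspace D l \<Longrightarrow> cinner z (x - y) = 0"
  shows "orth_proj (eigenspace D l) x = y"
  unfolding orth_proj_def
proof (rule the_equality)
  show "y \<in> eigenspace D l \<and> (\<forall>z\<in>eigenspace D l. cinner z (x - y) = 0)"
    using assms by auto
  fix y' assume y': "y' \<in> eigenspace D l \<and> (\<forall>z\<in>eigenspace D l. cinner z (x - y') = 0)"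
  have "cinner (y - y') ((x - y') - (x - y)) = 0"
    using assms y' eigenspace_diff[of y l y'] by (auto simp: cinner_diff_right)
  then show "y' = y"
    by simp
qed

text \<open>All terms but that of \<open>l\<close> vanish, so \<open>g\<close> may be unbounded on
  the eigenvalues. This is what allows \<open>abs_power\<close> to be evaluated for exponents of
  either sign.\<close>

lemma fun_calc_eigenvector:
  assumes v: "v \<in> eigenspace D l"
  shows "fun_calc D g v = g l *\<^sub>R v"
proof (cases "v = 0")
  case True
  have "orth_proj (eigenspace D m) 0 = 0" for m
    by (rule orth_projI) (auto simp: eigenspace_zero)
  then show ?thesis
    using True by (simp add: fun_calc_def)
next
  case False
  have p: "orth_proj (eigenspace D m) v = (if m = l then v else 0)" for m
    using v by (intro orth_projI) (auto simp: eigenspace_zero intro: eigenspace_orth)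
  have "l \<in> eigenvalues D"
    using v False by (auto simp: eigenvalues_def)
  then have "((\<lambda>m. g m *\<^sub>R orth_proj (eigenspace D m) v) has_sum g l *\<^sub>R v) (eigenvalues D)"
    by (intro has_sum_finite_neutralI[of "{l}"]) (auto simp: p)
  then show ?thesis
    by (simp add: fun_calc_def infsumI)
qed

text \<open>A maximal orthonormal family \<open>M\<close> of eigenvectors is total. For
  \<open>v\<close> in the eigenspace of \<open>l\<close>, only members of \<open>M\<close> in that
  eigenspace have non-zero coefficients, so the remainder \<open>w\<close> of the expansion of
  \<open>v\<close> along \<open>M\<close> stays in the closed eigenspace. It is orthogonal to
  \<open>M\<close>, hence 0 by maximality. A vector orthogonal to \<open>M\<close> is thus
  orthogonal to all eigenvectors.\<close>

lemma eigenbasis_exists: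
  assumes total: "\<And>x. (\<And>l v. v \<in> eigenspace D l \<Longrightarrow> cinner v x = 0) \<Longrightarrow> x = 0"
  obtains E ev where "orthonormal_basis E" "\<And>e. e \<in> E \<Longrightarrow> e \<in> eigenspace D (ev e)"
proof -
  obtain M where M: "M \<subseteq> (\<Union>l. eigenspace D l)" "orthonormal_set M"
    and max: "\<And>v. v \<in> (\<Union>l. eigenspace D l) \<Longrightarrow> norm v = 1 \<Longrightarrow> \<exists>e\<in>M. cinner e v \<noteq> 0"
    using exists_maximal_orthonormal[of "\<Union>l. eigenspace D l"] by blast
  have "\<forall>e\<in>M. \<exists>l. e \<in> eigenspace D l"
    using M(1) by blast
  then obtain ev where ev: "\<And>e. e \<in> M \<Longrightarrow> e \<in> eigenspace D (ev e)"
    by metis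
  have "x = 0" if x: "\<And>e. e \<in> M \<Longrightarrow> cinner e x = 0" for x
  proof (rule total)
    fix l v assume v: "v \<in> eigenspace D l"
    obtain y where y: "((\<lambda>e. cinner e v *\<^sub>C e) has_sum y) M"
      using orthonormal_coeff_summable[OF M(2) bessel_summable[OF M(2)]] by (auto simp: summable_on_def)
    have "cinner e v *\<^sub>C e \<in> eigenspace D l" if "e \<in> M" for e
    proof (cases "ev e = l")
      case False
      then show ?thesis
        using eigenspace_orth[OF ev[OF that] v] by (simp add: eigenspace_zero)
    qed (use ev[OF that] eigenspace_scaleC in auto)
    then have "y \<in> eigenspace D l"
      using y by (rule eigenspace_has_sum)
    define w where "w = v - y"
    have w: "w \<in> eigenspace D l"
      using v \<open>y \<in> _\<close> eigenspace_diff by (simp add: w_def)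
    have "cinner e w = 0" if "e \<in> M" for e
      using orthonormal_coeff[OF M(2) y that] by (simp add: w_def cinner_diff_right)
    then have "\<not> (\<exists>e\<in>M. cinner e ((1 / norm w) *\<^sub>R w) \<noteq> 0)"
      by (auto simp: cinner_scaleR_right)
    then have "w = 0"
      using max[of "(1 / norm w) *\<^sub>R w"] eigenspace_scaleR[OF w] by (cases "w = 0") auto
    then have "((\<lambda>e. cinner x (cinner e v *\<^sub>C e)) has_sum cinner x v) M"
      using cinner_has_sum[OF y, of x] by (simp add: w_def)
    moreover have "cinner x (cinner e v *\<^sub>C e) = 0" if "e \<in> M" for e
      using x[OF that] by (simp add: cinner_scaleC_right cinner_eq_0_commute)
    ultimately have "cinner x v = 0"
      by (metis (mono_tags, lifting) has_sum_0 has_sum_unique)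
    then show "cinner v x = 0"
      by (simp add: cinner_eq_0_commute)
  qed
  then have "orthonormal_basis M"
    using M(2) unfolding orthonormal_basis_def orthonormal_set_def by blast
  then show ?thesis
    using ev that by blast
qed

end

section \<open>Functional calculus in an eigenbasis\<close>

locale eigenbasis = symmetric_graph D for D :: "'h::complex_hilbert graph" +
  fixes E :: "'h set" and ev :: "'h \<Rightarrow> real"
  assumes basis: "orthonormal_basis E"
    and eigenvector: "e \<in> E \<Longrightarrow> e \<in> eigenspace D (ev e)"
begin

lemmas orthonormal = orthonormal_set_basis[OF basis]

lemma eigenspace_coeff_0:
  assumes "z \<in> eigenspace D l" "e \<in> E" "ev e \<noteq> l"
  shows "cinner e z = 0"
  using eigenspace_orth[OF eigenvector[OF assms(2)] assms(1,3)] .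

lemma orthonormal_subset: "orthonormal_set {e \<in> E. ev e = l}"
  using orthonormal by (auto simp: orthonormal_set_def)

lemma has_sum_orth_proj:
  "((\<lambda>e. cinner e x *\<^sub>C e) has_sum orth_proj (eigenspace D l) x) {e\<in>E. ev e = l}"
proof -
  obtain y where y: "((\<lambda>e. cinner e x *\<^sub>C e) has_sum y) {e\<in>E. ev e = l}"
    using orthonormal_coeff_summable[OF orthonormal_subset bessel_summable[OF orthonormal_subset]]
    by (auto simp: summable_on_def)
  have "orth_proj (eigenspace D l) x = y"
  proof (rule orth_projI)
    show "y \<in> eigenspace D l"
      using y by (rule eigenspace_has_sum[rotated]) (auto intro: eigenspace_scaleC dest: eigenvector)
    fix z assume z: "z \<in> eigenspace D l"
    have "cinner (x - y) (cinner e z *\<^sub>C e) = 0" if "e \<in> E" for e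
    proof (cases "ev e = l")
      case True
      then have "cinner e y = cinner e x"
        using orthonormal_coeff[OF orthonormal_subset y] that by auto
      then have "cinner (x - y) e = 0"
        by (simp add: cinner_eq_0_commute[of _ e] cinner_diff_right)
      then show ?thesis
        by (simp add: cinner_scaleC_right)
    qed (simp add: eigenspace_coeff_0[OF z that])
    then have "cinner (x - y) z = 0"
      using cinner_has_sum[OF basis_expansion[OF basis, of z], of "x - y"]
      by (metis (mono_tags, lifting) has_sum_0 has_sum_unique)
    then show "cinner z (x - y) = 0"
      by (simp add: cinner_eq_0_commute)
  qed
  with y show ?thesis by simp
qed

lemma eigenvalues_eq: "eigenvalues D = ev ` E"
proof (intro equalityI subsetI)
  fix l assume "l \<in> eigenvalues D"
  then obtain x where x: "x \<in> eigenspace D l" "x \<noteq> 0"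
    by (auto simp: eigenvalues_def)
  then obtain e where "e \<in> E" "cinner e x \<noteq> 0"
    using basis unfolding orthonormal_basis_def by blast
  then show "l \<in> ev ` E"
    using eigenspace_coeff_0[OF x(1)] by auto
next
  fix l assume "l \<in> ev ` E"
  then obtain e where "e \<in> E" "l = ev e" by auto
  moreover have "e \<noteq> 0"
    using orthonormal_norm[OF orthonormal \<open>e \<in> E\<close>] by auto
  ultimately show "l \<in> eigenvalues D"
    using eigenvector by (auto simp: eigenvalues_def)
qed

text \<open>\<open>fun_calc\<close> sums over eigenvalues, the basis expansion over eigenvectors.
  Orthogonality gives unconditional summability over \<open>E\<close>; then the family may be
  regrouped along the fibres of \<open>ev\<close>, each of which sums to a projection.\<close>

lemma has_sum_fun_calc:
  assumes C: "\<And>e. e \<in> E \<Longrightarrow> \<bar>g (ev e)\<bar> \<le> C"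
  shows "((\<lambda>e. g (ev e) *\<^sub>R cinner e x *\<^sub>C e) has_sum fun_calc D g x) E"
proof -
  define F where "F = (\<lambda>e. g (ev e) *\<^sub>R cinner e x *\<^sub>C e)"
  have "F summable_on E"
  proof (rule summable_on_orthogonal)
    show "inner (F e) (F e') = 0" if "e \<in> E" "e' \<in> E" "e \<noteq> e'" for e e'
      using that by (simp add: F_def orthonormal_inner_0[OF orthonormal])
    have "(\<lambda>e. C\<^sup>2 * (cmod (cinner e x))\<^sup>2) summable_on E"
      by (intro summable_on_cmult_right bessel_summable[OF orthonormal])
    then show "(\<lambda>e. (norm (F e))\<^sup>2) summable_on E"
    proof (rule summable_on_comparison_test)
      fix e assume "e \<in> E"
      then show "(norm (F e))\<^sup>2 \<le> C\<^sup>2 * (cmod (cinner e x))\<^sup>2"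
        using C[of e] abs_le_square_iff[of "g (ev e)" C]
        by (auto simp: F_def norm_scaleC orthonormal_norm[OF orthonormal] power_mult_distrib
            intro!: mult_right_mono)
    qed auto
  qed
  moreover define S where "S = Sigma (ev ` E) (\<lambda>l. {e\<in>E. ev e = l})"
  have bij: "bij_betw snd S E"
    by (auto simp: S_def bij_betw_def inj_on_def image_iff)
  ultimately have FS: "(\<lambda>(l, e). F e) summable_on S"
    using summable_on_reindex_bij_betw[OF bij, of F] by (simp add: case_prod_unfold)
  have "infsum F E = (\<Sum>\<^sub>\<infinity>(l, e)\<in>S. F e)"
    using infsum_reindex_bij_betw[OF bij, of F] by (simp add: case_prod_unfold)
  also have "\<dots> = (\<Sum>\<^sub>\<infinity>l\<in>ev ` E. \<Sum>\<^sub>\<infinity>e\<in>{e\<in>E. ev e = l}. F e)"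
    using FS unfolding S_def by (rule infsum_Sigma'_banach[symmetric])
  also have "\<dots> = (\<Sum>\<^sub>\<infinity>l\<in>ev ` E. g l *\<^sub>R orth_proj (eigenspace D l) x)"
  proof (rule infsum_cong)
    fix l
    have "((\<lambda>e. g l *\<^sub>R cinner e x *\<^sub>C e) has_sum g l *\<^sub>R orth_proj (eigenspace D l) x) {e\<in>E. ev e = l}"
      using has_sum_bounded_linear[OF bounded_linear_scaleR_right has_sum_orth_proj] .
    then have "(F has_sum g l *\<^sub>R orth_proj (eigenspace D l) x) {e\<in>E. ev e = l}"
      by (rule has_sum_cong[THEN iffD1, rotated]) (auto simp: F_def)
    then show "(\<Sum>\<^sub>\<infinity>e\<in>{e\<in>E. ev e = l}. F e) = g l *\<^sub>R orth_proj (eigenspace D l) x"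
      by (rule infsumI)
  qed
  also have "\<dots> = fun_calc D g x"
    by (simp add: fun_calc_def eigenvalues_eq)
  finally show ?thesis
    using has_sum_infsum[OF \<open>F summable_on E\<close>] by (simp add: F_def)
qed

lemma bounded_op_fun_calc:
  assumes "\<And>e. e \<in> E \<Longrightarrow> \<bar>g (ev e)\<bar> \<le> C"
  shows "bounded_op (fun_calc D g)"
  by (rule bounded_op_diagonal[OF basis, where c = "\<lambda>e. g (ev e)" and C = C])
     (auto intro: assms has_sum_fun_calc)

end

text \<open>A graph equal to its adjoint is the solution set of continuous, real-linear conditions
  indexed by its own elements; closedness and linearity are read off from these conditions.\<close>

lemma self_adjoint_symmetric_graph:
  assumes "self_adjoint D"
  shows "symmetric_graph D"
proof
  have adj: "adjoint_graph D = D"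
    using assms by (simp add: self_adjoint_def)
  have DI: "(y, z) \<in> D" if "\<And>x w. (x, w) \<in> D \<Longrightarrow> cinner y w = cinner z x" for y z
    using that by (subst adj[symmetric]) (auto simp: adjoint_graph_def)
  have DD: "cinner y w = cinner z x" if "(y, z) \<in> D" "(x, w) \<in> D" for x y z w
    using that by (subst (asm) (1) adj[symmetric]) (auto simp: adjoint_graph_def)
  show "(0, 0) \<in> D"
    by (rule DI) auto
  show "(x + y, u + v) \<in> D" if xy: "(x, u) \<in> D" "(y, v) \<in> D" for x y u v
  proof (rule DI)
    show "cinner (x + y) w = cinner (u + v) z" if "(z, w) \<in> D" for z w
      using DD[OF xy(1) that] DD[OF xy(2) that] by (simp add: cinner_add_left)
  qed
  show "(c *\<^sub>C x, c *\<^sub>C u) \<in> D" if xu: "(x, u) \<in> D" for c x u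
  proof (rule DI)
    show "cinner (c *\<^sub>C x) w = cinner (c *\<^sub>C u) z" if "(z, w) \<in> D" for z w
      using DD[OF xu that] by (simp add: cinner_scaleC_left)
  qed
  show "cinner x v = cinner u y" if "(x, u) \<in> D" "(y, v) \<in> D" for x y u v
    using that by (rule DD)
  have "D = (\<Inter>q\<in>D. {p. cinner (fst p) (snd q) = cinner (snd p) (fst q)})"
  proof (rule set_eqI)
    fix p
    have "p \<in> D" if "\<forall>q\<in>D. cinner (fst p) (snd q) = cinner (snd p) (fst q)"
      using DI[of "fst p" "snd p"] that by force
    moreover have "cinner (fst p) (snd q) = cinner (snd p) (fst q)" if "p \<in> D" "q \<in> D" for q
      using DD[of "fst p" "snd p" "fst q" "snd q"] that by simp
    ultimately show "p \<in> D \<longleftrightarrow> p \<in> (\<Inter>q\<in>D. {p. cinner (fst p) (snd q) = cinner (snd p) (fst q)})"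
      by auto
  qed
  also have "closed \<dots>"
    by (intro closed_INT ballI closed_Collect_eq continuous_intros)
  finally show "closed D" .
qed

section \<open>Spectral theorem for self-adjoint operators with compact inverse\<close>

locale compact_inverse = symmetric_graph D for D :: "'h::complex_hilbert graph" +
  fixes K :: "'h \<Rightarrow> 'h"
  assumes dense: "closure (Domain D) = UNIV"
    and compact: "compact_op K"
    and inverse: "D\<inverse> = {(y, K y) | y. True}"
begin

lemma graph_iff: "(x, u) \<in> D \<longleftrightarrow> x = K u"
  using inverse by (auto simp: converse_iff set_eq_iff)

lemma K_bounded_op: "bounded_op K"
  using compact by (simp add: compact_op_def)

lemmas K_simps = bounded_opD(2-4)[OF K_bounded_op]

lemma K_sym: "cinner (K x) y = cinner x (K y)"
  using graph_sym[of "K x" x "K y" y] by (simp add: graph_iff)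

text \<open>If \<open>K y = 0\<close>, then \<open>(0, y)\<close> lies in the graph, and symmetry
  makes \<open>y\<close> orthogonal to the dense domain.\<close>

lemma K_inj: assumes "K y = 0" shows "y = 0"
proof -
  have "Domain D \<subseteq> {x. cinner y x = 0}"
    using graph_sym[of 0 y] assms by (auto simp: graph_iff)
  moreover have "closed {x. cinner y x = 0}"
    by (intro closed_Collect_eq continuous_intros)
  ultimately have "UNIV \<subseteq> {x. cinner y x = 0}"
    using dense closure_minimal by metis
  then show ?thesis
    using cinner_self_eq_0_iff by blast
qed

text \<open>An eigenvector satisfies \<open>x = l *\<^sub>R K x\<close>, so the modulus of
  \<open>l\<close> is at least the inverse of any bound for \<open>K\<close>. This gap around 0
  later keeps negative powers of the absolute value bounded and makes heat traces decay
  exponentially for large times.\<close>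

lemma eigenvalue_lower_bound:
  obtains c where "c > 0" "\<And>l x. x \<in> eigenspace D l \<Longrightarrow> x \<noteq> 0 \<Longrightarrow> c \<le> \<bar>l\<bar>"
proof -
  obtain B where B: "B > 0" "\<And>x. norm (K x) \<le> norm x * B"
    using bounded_linear.pos_bounded[OF bounded_opD(1)[OF K_bounded_op]] by auto
  show ?thesis
  proof (rule that[of "1 / B"])
    fix l x assume x: "x \<in> eigenspace D l" "(x::'h) \<noteq> 0"
    then have "x = K (l *\<^sub>R x)"
      by (simp add: eigenspace_def graph_iff)
    then have "norm x * 1 \<le> norm x * (\<bar>l\<bar> * B)"
      using B(2)[of "l *\<^sub>R x"] by (simp add: mult_ac)
    then show "1 / B \<le> \<bar>l\<bar>"
      using x B(1) by (simp add: mult_le_cancel_left field_simps)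
  qed (use B in auto)
qed

lemma eigenspace_eqI: "K x = m *\<^sub>R x \<Longrightarrow> m \<noteq> 0 \<Longrightarrow> x \<in> eigenspace D (1 / m)"
  by (simp add: eigenspace_def graph_iff K_simps)

text \<open>The norm of the restriction of \<open>K\<close> to the orthogonal complement of all eigenvectors is attained
  by compactness, and the maximising vector yields a further eigenvector.\<close>

lemma eigenvectors_total:
  assumes x0: "\<And>l v. v \<in> eigenspace D l \<Longrightarrow> cinner v x0 = 0"
  shows "x0 = 0"
proof (rule ccontr)
  assume "x0 \<noteq> 0"
  define N where "N = {x. \<forall>l. \<forall>v\<in>eigenspace D l. cinner v x = 0}"
  have N_scaleR: "r *\<^sub>R x \<in> N" if "x \<in> N" for r x
    using that by (auto simp: N_def cinner_scaleR_right)
  have N_add: "x + y \<in> N" if "x \<in> N" "y \<in> N" for x y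
    using that by (auto simp: N_def cinner_add_right)
  have "closed (\<Inter>l. \<Inter>v\<in>eigenspace D l. {x. cinner v x = 0})"
    by (intro closed_INT ballI closed_Collect_eq continuous_intros)
  moreover have "(\<Inter>l. \<Inter>v\<in>eigenspace D l. {x. cinner v x = 0}) = N"
    by (auto simp: N_def)
  ultimately have "closed N" by simp
  have N_0: "x = 0" if "x \<in> N" "x \<in> eigenspace D l" for x l
    using that cinner_self_eq_0_iff[of x] unfolding N_def by blast
  have N_K: "K x \<in> N" if x: "x \<in> N" for x
    unfolding N_def
  proof (clarify)
    fix l v assume v: "v \<in> eigenspace D l"
    then have "v = l *\<^sub>R K v"
      by (simp add: eigenspace_def graph_iff K_simps)
    have "of_real l * cinner v (K x) = cinner (l *\<^sub>R K v) x"
      by (simp add: cinner_scaleR_left K_sym)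
    also have "\<dots> = 0"
      using \<open>v = _\<close> x v by (auto simp: N_def)
    finally show "cinner v (K x) = 0"
      using \<open>v = l *\<^sub>R K v\<close> by (cases "l = 0") auto
  qed
  define u where "u = (1 / norm x0) *\<^sub>R x0"
  have u: "u \<in> N" "norm u = 1"
    using x0 \<open>x0 \<noteq> 0\<close> by (auto simp: u_def N_def cinner_scaleR_right)
  define S where "S = (\<lambda>x. norm (K x)) ` {x\<in>N. norm x \<le> 1}"
  obtain B where B: "B > 0" "\<And>x. norm (K x) \<le> norm x * B"
    using bounded_linear.pos_bounded[OF bounded_opD(1)[OF K_bounded_op]] by auto
  have bdd: "bdd_above S"
  proof (rule bdd_aboveI[of _ B])
    fix s assume "s \<in> S"
    then obtain x where "s = norm (K x)" "norm x \<le> 1" by (auto simp: S_def)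
    then show "s \<le> B"
      using B(2)[of x] B(1) mult_right_mono[of "norm x" 1 B] by linarith
  qed
  define m where "m = Sup S"
  have "norm (K u) \<le> m"
    unfolding m_def by (rule cSup_upper[OF _ bdd]) (use u in \<open>auto simp: S_def\<close>)
  \<comment> \<open>Injectivity of \<open>K\<close> excludes \<open>m = 0\<close>, so that division
    by \<open>m\<close> becomes possible.\<close>
  moreover have "K u \<noteq> 0"
    using K_inj[of u] u by auto
  ultimately have "m > 0"
    by (smt (verit) norm_le_zero_iff)
  have le_m: "norm (K x) \<le> m * norm x" if "x \<in> N" for x
  proof (cases "x = 0")
    case False
    have "norm (K ((1 / norm x) *\<^sub>R x)) \<le> m"
      unfolding m_def using that N_scaleR False
      by (intro cSup_upper[OF _ bdd]) (auto simp: S_def)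
    then show ?thesis
      using False by (simp add: K_simps field_simps)
  qed (use bounded_op_0[OF K_bounded_op] in auto)
  have "\<exists>x. x \<in> N \<and> norm x \<le> 1 \<and> m - 1 / Suc n < norm (K x)" for n
  proof -
    have "S \<noteq> {}"
      using u by (auto simp: S_def)
    moreover have "m - 1 / Suc n < Sup S"
      by (simp add: m_def)
    ultimately obtain s where "s \<in> S" "m - 1 / Suc n < s"
      using less_cSup_iff[OF _ bdd] by blast
    then show ?thesis
      by (auto simp: S_def)
  qed
  then obtain X where X: "\<And>n. X n \<in> N" "\<And>n. norm (X n) \<le> 1" "\<And>n. m - 1 / Suc n < norm (K (X n))"
    by metis
  have "compact (closure (K ` cball 0 1))"
    using compact by (simp add: compact_op_def)
  moreover have "K (X n) \<in> K ` cball 0 1" for n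
    using X(2) by auto
  then have "\<forall>n. K (X n) \<in> closure (K ` cball 0 1)"
    using closure_subset by blast
  ultimately obtain y r where r: "strict_mono (r :: nat \<Rightarrow> nat)" and y: "(\<lambda>n. K (X (r n))) \<longlonglongrightarrow> y"
    unfolding compact_def by (fastforce simp: o_def)
  define Y where "Y = X \<circ> r"
  have KY: "(\<lambda>n. K (Y n)) \<longlonglongrightarrow> y"
    using y by (simp add: Y_def)
  have "(\<lambda>n. norm (K (X n))) \<longlonglongrightarrow> m"
  proof (rule tendsto_sandwich[of "\<lambda>n. m - 1 / Suc n" _ _ "\<lambda>n. m"])
    show "(\<lambda>n. m - 1 / Suc n) \<longlonglongrightarrow> m"
      using tendsto_diff[OF tendsto_const[of m] LIMSEQ_Suc[OF lim_1_over_n]] by simp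
    show "\<forall>\<^sub>F n in sequentially. norm (K (X n)) \<le> m"
      using le_m[OF X(1)] X(2) \<open>m > 0\<close> mult_left_mono[of _ 1 m]
      by (intro always_eventually allI) (smt (verit))
  qed (use X(3) less_imp_le in \<open>auto intro!: always_eventually\<close>)
  then have KYm: "(\<lambda>n. norm (K (Y n))) \<longlonglongrightarrow> m"
    using LIMSEQ_subseq_LIMSEQ[OF _ r] by (force simp: Y_def o_def)
  have K_tendsto: "(\<lambda>n. K (a n)) \<longlonglongrightarrow> K b" if "a \<longlonglongrightarrow> b" for a b
    using bounded_linear.tendsto[OF bounded_opD(1)[OF K_bounded_op] that] .
  \<comment> \<open>On \<open>N\<close> the norm of \<open>K\<close> is at most \<open>m\<close>.
    Expanding the square therefore shows that a vector for which \<open>norm (K x)\<close> is close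
    to \<open>m\<close> is almost an eigenvector of the square of \<open>K\<close> for
    \<open>m\<^sup>2\<close>.\<close>
  have bound: "(norm (K (K x) - m\<^sup>2 *\<^sub>R x))\<^sup>2 \<le> m\<^sup>2 * m\<^sup>2 - m\<^sup>2 * (norm (K x))\<^sup>2"
    if x: "x \<in> N" "norm x \<le> 1" for x
  proof -
    have i: "inner (K (K x)) x = (norm (K x))\<^sup>2"
      by (metis K_sym Re_cinner power2_norm_eq_inner)
    have a: "(norm (K (K x)))\<^sup>2 \<le> m\<^sup>2 * (norm (K x))\<^sup>2"
      using le_m[OF N_K[OF x(1)]] by (metis norm_ge_zero power_mono power_mult_distrib)
    have b: "(m\<^sup>2)\<^sup>2 * (norm x)\<^sup>2 \<le> (m\<^sup>2)\<^sup>2 * 1"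
      using x(2) by (intro mult_left_mono) (auto simp: power_le_one)
    have "(norm (K (K x) - m\<^sup>2 *\<^sub>R x))\<^sup>2 =
        (norm (K (K x)))\<^sup>2 - 2 * m\<^sup>2 * (norm (K x))\<^sup>2 + (m\<^sup>2)\<^sup>2 * (norm x)\<^sup>2"
      unfolding i[symmetric]
      by (simp add: power2_norm_eq_inner inner_diff_left inner_diff_right inner_commute
          power2_eq_square[of "m\<^sup>2"])
    also have "\<dots> \<le> m\<^sup>2 * m\<^sup>2 - m\<^sup>2 * (norm (K x))\<^sup>2"
      using a b by (simp add: power2_eq_square[of "m\<^sup>2"])
    finally show ?thesis .
  qed
  have "(\<lambda>n. m\<^sup>2 * m\<^sup>2 - m\<^sup>2 * (norm (K (Y n)))\<^sup>2) \<longlonglongrightarrow> m\<^sup>2 * m\<^sup>2 - m\<^sup>2 * m\<^sup>2"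
    by (intro tendsto_intros KYm)
  then have lim0: "(\<lambda>n. m\<^sup>2 * m\<^sup>2 - m\<^sup>2 * (norm (K (Y n)))\<^sup>2) \<longlonglongrightarrow> 0"
    by simp
  have Y: "Y n \<in> N" "norm (Y n) \<le> 1" for n
    using X by (auto simp: Y_def)
  have "(\<lambda>n. (norm (K (K (Y n)) - m\<^sup>2 *\<^sub>R Y n))\<^sup>2) \<longlonglongrightarrow> 0"
    using bound[OF Y] by (intro tendsto_sandwich[OF _ _ tendsto_const lim0] always_eventually allI) auto
  then have "(\<lambda>n. sqrt ((norm (K (K (Y n)) - m\<^sup>2 *\<^sub>R Y n))\<^sup>2)) \<longlonglongrightarrow> sqrt 0"
    by (intro tendsto_intros)
  then have diff: "(\<lambda>n. K (K (Y n)) - m\<^sup>2 *\<^sub>R Y n) \<longlonglongrightarrow> 0"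
    by (simp add: tendsto_norm_zero_iff)
  \<comment> \<open>Compactness gives convergence of \<open>K (Y n)\<close> only. Since
    \<open>K (K (Y n)) - m\<^sup>2 *\<^sub>R Y n\<close> tends to 0, the vectors \<open>Y n\<close>
    converge too, and this is their limit.\<close>
  define x where "x = (1 / m\<^sup>2) *\<^sub>R K y"
  have "(\<lambda>n. (1 / m\<^sup>2) *\<^sub>R (K (K (Y n)) - (K (K (Y n)) - m\<^sup>2 *\<^sub>R Y n))) \<longlonglongrightarrow> (1 / m\<^sup>2) *\<^sub>R (K y - 0)"
    by (intro tendsto_intros diff K_tendsto KY)
  then have Yx: "Y \<longlonglongrightarrow> x"
    using \<open>m > 0\<close> by (simp add: x_def)
  have "x \<in> N"
    using \<open>closed N\<close> Y(1) Yx unfolding closed_sequential_limits by blast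
  have "y = K x"
    using LIMSEQ_unique[OF KY K_tendsto[OF Yx]] .
  have "m\<^sup>2 *\<^sub>R x = K y"
    using \<open>m > 0\<close> by (simp add: x_def)
  then have KKx: "K (K x) = m\<^sup>2 *\<^sub>R x"
    using \<open>y = K x\<close> by simp
  have "norm (K x) = m"
    using LIMSEQ_unique[OF tendsto_norm[OF KY] KYm] by (simp add: \<open>y = K x\<close>)
  \<comment> \<open>Factor the square of \<open>K\<close> minus \<open>m\<^sup>2\<close> as
    \<open>K - m\<close> after \<open>K + m\<close>: either \<open>w\<close> is an eigenvector of
    \<open>K\<close> for \<open>m\<close>, or \<open>x\<close> is one for \<open>- m\<close>. Both
    are excluded inside \<open>N\<close>.\<close>
  define w where "w = K x + m *\<^sub>R x"
  have "w \<in> N"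
    using \<open>x \<in> N\<close> by (simp add: w_def N_add N_K N_scaleR)
  have "K w = m *\<^sub>R w"
    by (simp add: w_def K_simps KKx scaleR_add_right power2_eq_square)
  then have "w = 0"
    using eigenspace_eqI[of w m] \<open>m > 0\<close> N_0[OF \<open>w \<in> N\<close>] by auto
  then have "K x = (- m) *\<^sub>R x"
    by (simp add: w_def eq_neg_iff_add_eq_0)
  then have "x = 0"
    using eigenspace_eqI[of x "- m"] \<open>m > 0\<close> N_0[OF \<open>x \<in> N\<close>] by auto
  then show False
    using \<open>norm (K x) = m\<close> \<open>m > 0\<close> bounded_op_0[OF K_bounded_op] by simp
qed

end

lemma self_adjoint_compact_inverse_eigenbasis:
  assumes "self_adjoint D" "has_compact_inverse D"
  obtains E ev c where "eigenbasis D E ev" "c > 0" "\<And>e. e \<in> E \<Longrightarrow> c \<le> \<bar>ev e\<bar>"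
proof -
  interpret symmetric_graph D
    by (rule self_adjoint_symmetric_graph) fact
  obtain K where K: "compact_op K" "D\<inverse> = {(y, K y) | y. True}"
    using assms(2) by (auto simp: has_compact_inverse_def)
  interpret compact_inverse D K
    using K assms(1) by unfold_locales (auto simp: self_adjoint_def)
  obtain E ev where E: "orthonormal_basis E" "\<And>e. e \<in> E \<Longrightarrow> e \<in> eigenspace D (ev e)"
    using eigenbasis_exists eigenvectors_total by metis
  then have "eigenbasis D E ev"
    by unfold_locales auto
  moreover obtain c where "c > 0" "\<And>l x. x \<in> eigenspace D l \<Longrightarrow> x \<noteq> 0 \<Longrightarrow> c \<le> \<bar>l\<bar>"
    using eigenvalue_lower_bound by blast
  moreover have "e \<noteq> 0" if "e \<in> E" for e
    using orthonormal_norm[OF orthonormal_set_basis[OF E(1)] that] by auto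
  ultimately show ?thesis
    using E that by blast
qed

section \<open>Traces of diagonal operators\<close>

text \<open>Replaces Riesz representation (and adjoints) in the trace formula below.\<close>

lemma functional_bessel:
  fixes \<psi> :: "'h::complex_hilbert \<Rightarrow> complex"
  assumes E: "orthonormal_set E" and F: "finite F" "F \<subseteq> E"
    and add: "\<And>x y. \<psi> (x + y) = \<psi> x + \<psi> y" and scale: "\<And>c x. \<psi> (c *\<^sub>C x) = c * \<psi> x"
    and bound: "\<And>x. cmod (\<psi> x) \<le> C * norm x"
  shows "(\<Sum>e\<in>F. (cmod (\<psi> e))\<^sup>2) \<le> C\<^sup>2"
proof -
  \<comment> \<open>The Riesz vector of the restriction of \<open>\<psi>\<close> to the complex span
    of \<open>F\<close>: \<open>\<psi> y\<close> and the squared norm of \<open>y\<close> are the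
    same sum.\<close>
  define y where "y = (\<Sum>e\<in>F. cnj (\<psi> e) *\<^sub>C e)"
  define s where "s = (\<Sum>e\<in>F. (cmod (\<psi> e))\<^sup>2)"
  have "s \<ge> 0"
    by (simp add: s_def sum_nonneg)
  have ny: "(norm y)\<^sup>2 = s"
    unfolding y_def s_def using F
    by (subst norm_sum_orthogonal)
       (auto simp: norm_scaleC orthonormal_norm[OF E] subset_iff intro!: orthonormal_inner_0[OF E])
  have "\<psi> 0 = 0"
    using scale[of 0 0] by simp
  then have "\<psi> (sum a F) = (\<Sum>e\<in>F. \<psi> (a e))" for a
    by (induction F rule: infinite_finite_induct) (auto simp: add)
  then have "\<psi> y = (\<Sum>e\<in>F. of_real ((cmod (\<psi> e))\<^sup>2))"
    unfolding y_def by (simp only: scale complex_norm_square mult.commute)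
  then have "\<psi> y = of_real s"
    by (simp add: s_def)
  then have "s \<le> C * norm y"
    using bound[of y] \<open>s \<ge> 0\<close> by simp
  then have "s\<^sup>2 \<le> C\<^sup>2 * s"
    using \<open>s \<ge> 0\<close> by (metis ny power_mono power_mult_distrib)
  then have "s \<le> C\<^sup>2"
    using \<open>s \<ge> 0\<close> by (cases "s = 0") (auto simp: power2_eq_square mult_le_cancel_right)
  then show ?thesis
    by (simp add: s_def)
qed

lemma functional_has_sum:
  fixes \<psi> :: "'h::complex_hilbert \<Rightarrow> complex"
  assumes B: "orthonormal_basis E"
    and add: "\<And>x y. \<psi> (x + y) = \<psi> x + \<psi> y" and scale: "\<And>c x. \<psi> (c *\<^sub>C x) = c * \<psi> x"
    and bound: "\<And>x. cmod (\<psi> x) \<le> C * norm x"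
  shows "((\<lambda>e. cinner e x * \<psi> e) has_sum \<psi> x) E"
proof -
  have "\<psi> (r *\<^sub>R x) = r *\<^sub>R \<psi> x" for r x
    using scale[of "of_real r" x] by (simp add: scaleR_scaleC[of r x] scaleR_conv_of_real)
  then have "bounded_linear \<psi>"
    using bound by (intro bounded_linear_intro[of _ C]) (auto simp: add mult.commute)
  from has_sum_bounded_linear[OF this basis_expansion[OF B, of x]] show ?thesis
    by (simp add: scale)
qed

text \<open>Bounds one row of the double series in the trace formula, uniformly in \<open>F\<close>:
  Cauchy-Schwarz for finite sums joins Bessel's inequality for \<open>x\<close> and its analogue for
  \<open>\<psi>\<close>.\<close>

lemma functional_abs_sum_le:
  fixes \<psi> :: "'h::complex_hilbert \<Rightarrow> complex"
  assumes E: "orthonormal_set E" and F: "finite F" "F \<subseteq> E"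
    and add: "\<And>x y. \<psi> (x + y) = \<psi> x + \<psi> y" and scale: "\<And>c x. \<psi> (c *\<^sub>C x) = c * \<psi> x"
    and bound: "\<And>x. cmod (\<psi> x) \<le> C * norm x" and "C \<ge> 0" and "norm x = 1"
  shows "(\<Sum>e\<in>F. cmod (cinner e x * \<psi> e)) \<le> C"
proof -
  have "(\<Sum>e\<in>F. cmod (cinner e x) * cmod (\<psi> e))
      \<le> L2_set (\<lambda>e. cmod (cinner e x)) F * L2_set (\<lambda>e. cmod (\<psi> e)) F"
    using L2_set_mult_ineq[of "\<lambda>e. cmod (cinner e x)" "\<lambda>e. cmod (\<psi> e)" F] by simp
  also have "\<dots> \<le> sqrt ((norm x)\<^sup>2) * sqrt (C\<^sup>2)"
    unfolding L2_set_def using bessel[OF E F] functional_bessel[OF E F add scale bound]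
    by (intro mult_mono real_sqrt_le_mono) (auto intro: sum_nonneg)
  finally show ?thesis
    using assms by (simp add: norm_mult)
qed

text \<open>Expanding \<open>T (B e)\<close> along \<open>b\<close> gives a double series over \<open>b \<times> E\<close>, which converges absolutely;
  summing over \<open>E\<close> first removes the dependence on \<open>E\<close>.\<close>

lemma diagonal_trace_has_sum:
  fixes T B :: "'h::complex_hilbert \<Rightarrow> 'h" and c :: "'h \<Rightarrow> real"
  assumes b: "orthonormal_basis b" and E: "orthonormal_basis E"
    and T: "bounded_op T" "\<And>k. k \<in> b \<Longrightarrow> T k = c k *\<^sub>R k" and "bounded_op B"
    and c: "(\<lambda>k. \<bar>c k\<bar>) summable_on b"
  shows "((\<lambda>e. cinner e (T (B e))) has_sum (\<Sum>\<^sub>\<infinity>k\<in>b. of_real (c k) * cinner k (B k))) E"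
proof -
  obtain C where C: "C \<ge> 0" "\<And>x. norm (B x) \<le> norm x * C"
    using bounded_linear.nonneg_bounded[OF bounded_opD(1)[OF \<open>bounded_op B\<close>]] by auto
  note B = bounded_opD[OF \<open>bounded_op B\<close>] and T' = bounded_opD[OF T(1)]
  have functional: "cinner k (B (x + y)) = cinner k (B x) + cinner k (B y)"
    "cinner k (B (r *\<^sub>C x)) = r * cinner k (B x)" for k x y r
    by (auto simp: B cinner_add_right cinner_scaleC_right)
  have bound: "cmod (cinner k (B x)) \<le> C * norm x" if "k \<in> b" for k x
    using cinner_norm_le[of k "B x"] C(2)[of x] orthonormal_norm[OF orthonormal_set_basis[OF b] that]
    by (simp add: mult.commute order_trans)
  define f where "f = (\<lambda>(k, e). of_real (c k) * (cinner e k * cinner k (B e)))"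
  have row: "((\<lambda>e. f (k, e)) has_sum of_real (c k) * cinner k (B k)) E" if "k \<in> b" for k
    unfolding f_def prod.case
    by (intro has_sum_cmult_right functional_has_sum[OF E]) (use functional bound[OF that] in auto)
  have column: "((\<lambda>k. f (k, e)) has_sum cinner e (T (B e))) b" for e
  proof -
    have "((\<lambda>k. T (cinner k (B e) *\<^sub>C k)) has_sum T (B e)) b"
      by (rule has_sum_bounded_linear[OF T'(1) basis_expansion[OF b]])
    then have "((\<lambda>k. cinner e (T (cinner k (B e) *\<^sub>C k))) has_sum cinner e (T (B e))) b"
      by (rule cinner_has_sum)
    then show ?thesis
      by (rule has_sum_cong[THEN iffD1, rotated])
         (simp add: f_def T' T(2) cinner_scaleC_right cinner_scaleR_right)
  qed
  have cC: "(\<lambda>k. \<bar>c k\<bar> * C) summable_on b"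
    by (rule summable_on_cmult_left[OF c])
  have "(\<lambda>p. norm (f p)) summable_on (b \<times> E)"
  proof (rule nonneg_bounded_partial_sums_imp_summable_on)
    show "\<forall>\<^sub>F F in finite_subsets_at_top (b \<times> E). (\<Sum>p\<in>F. norm (f p)) \<le> (\<Sum>\<^sub>\<infinity>k\<in>b. \<bar>c k\<bar> * C)"
    proof (rule eventually_finite_subsets_at_top_weakI)
      fix F assume F: "finite F" "F \<subseteq> b \<times> E"
      \<comment> \<open>Enlarging \<open>F\<close> to a rectangle makes every row a full finite sum
        over the same subset of \<open>E\<close>, to which the row bound applies.\<close>
      have "(\<Sum>p\<in>F. norm (f p)) \<le> (\<Sum>p\<in>fst ` F \<times> snd ` F. norm (f p))"
        by (rule sum_mono2) (use F in force)+
      also have "\<dots> = (\<Sum>k\<in>fst ` F. \<Sum>e\<in>snd ` F. norm (f (k, e)))"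
        by (simp add: sum.cartesian_product)
      also have "\<dots> \<le> (\<Sum>k\<in>fst ` F. \<bar>c k\<bar> * C)"
      proof (rule sum_mono)
        fix k assume "k \<in> fst ` F"
        then have k: "k \<in> b" using F by auto
        have "(\<Sum>e\<in>snd ` F. cmod (cinner e k * cinner k (B e))) \<le> C"
          by (rule functional_abs_sum_le[OF orthonormal_set_basis[OF E]])
             (use F C functional bound[OF k] orthonormal_norm[OF orthonormal_set_basis[OF b] k] in auto)
        then show "(\<Sum>e\<in>snd ` F. norm (f (k, e))) \<le> \<bar>c k\<bar> * C"
          by (simp add: f_def norm_mult[of "of_real _"] sum_distrib_left[symmetric] mult_left_mono
              del: norm_mult)
      qed
      also have "\<dots> \<le> (\<Sum>\<^sub>\<infinity>k\<in>b. \<bar>c k\<bar> * C)"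
        by (rule finite_sum_le_infsum) (use F C cC in auto)
      finally show "(\<Sum>p\<in>F. norm (f p)) \<le> (\<Sum>\<^sub>\<infinity>k\<in>b. \<bar>c k\<bar> * C)" .
    qed
  qed auto
  then have f: "f summable_on (b \<times> E)"
    by (rule abs_summable_summable)
  then obtain \<tau> where \<tau>: "(f has_sum \<tau>) (b \<times> E)"
    by (auto simp: summable_on_def)
  have "((\<lambda>k. of_real (c k) * cinner k (B k)) has_sum \<tau>) b"
    using has_sum_SigmaD[OF \<tau> row] .
  then have "\<tau> = (\<Sum>\<^sub>\<infinity>k\<in>b. of_real (c k) * cinner k (B k))"
    by (simp add: infsumI)
  moreover have "((\<lambda>(e, k). f (k, e)) has_sum \<tau>) (E \<times> b)"
    using \<tau> has_sum_swap[of f b E] by (simp add: case_prod_unfold)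
  then have "((\<lambda>e. cinner e (T (B e))) has_sum \<tau>) E"
    by (rule has_sum_SigmaD) (use column in auto)
  ultimately show ?thesis by simp
qed

text \<open>The value serves every basis by \<open>diagonal_trace_has_sum\<close>; for uniqueness
  one basis is enough, and \<open>b\<close> is at hand.\<close>

lemma diagonal_op_trace:
  fixes T B :: "'h::complex_hilbert \<Rightarrow> 'h" and c :: "'h \<Rightarrow> real"
  assumes "orthonormal_basis b" "bounded_op T" "\<And>k. k \<in> b \<Longrightarrow> T k = c k *\<^sub>R k" "bounded_op B"
    and "(\<lambda>k. \<bar>c k\<bar>) summable_on b"
  shows "op_trace (T \<circ> B) = (\<Sum>\<^sub>\<infinity>k\<in>b. of_real (c k) * cinner k (B k))"
proof -
  note * = diagonal_trace_has_sum[OF assms(1) _ assms(2-5)]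
  show ?thesis
    unfolding op_trace_def
  proof (rule the_equality)
    fix \<tau> assume "\<forall>E. orthonormal_basis E \<longrightarrow> ((\<lambda>e. cinner e ((T \<circ> B) e)) has_sum \<tau>) E"
    then show "\<tau> = (\<Sum>\<^sub>\<infinity>k\<in>b. of_real (c k) * cinner k (B k))"
      using *[OF assms(1)] assms(1) has_sum_unique by fastforce
  qed (use * in auto)
qed

section \<open>The trace class criterion for diagonal operators\<close>

lemma diagonal_positive_op:
  fixes T :: "'h::complex_hilbert \<Rightarrow> 'h" and c :: "'h \<Rightarrow> real"
  assumes b: "orthonormal_basis b" and T: "bounded_op T" "\<And>k. k \<in> b \<Longrightarrow> T k = c k *\<^sub>R k"
    and c: "\<And>k. k \<in> b \<Longrightarrow> c k \<ge> 0"
  shows "((\<lambda>k. c k * (cmod (cinner k x))\<^sup>2) has_sum Re (cinner x (T x))) b"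
    and "positive_op T"
proof -
  have sq: "cinner k x * cinner x k = of_real ((cmod (cinner k x))\<^sup>2)" for k x
    by (metis cinner_commute complex_norm_square)
  have "((\<lambda>k. cinner x (T (cinner k x *\<^sub>C k))) has_sum cinner x (T x)) b" for x
    by (intro cinner_has_sum has_sum_bounded_linear[OF bounded_opD(1)[OF T(1)] basis_expansion[OF b]])
  then have "((\<lambda>k. of_real (c k * (cmod (cinner k x))\<^sup>2)) has_sum cinner x (T x)) b" for x
    by (rule has_sum_cong[THEN iffD1, rotated])
       (simp add: bounded_opD[OF T(1)] T(2) cinner_scaleC_right cinner_scaleR_right sq)
  from has_sum_Re[OF this] has_sum_Im[OF this]
  have *: "((\<lambda>k. c k * (cmod (cinner k x))\<^sup>2) has_sum Re (cinner x (T x))) b"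
    "((\<lambda>k. 0) has_sum Im (cinner x (T x))) b" for x
    by auto
  show "((\<lambda>k. c k * (cmod (cinner k x))\<^sup>2) has_sum Re (cinner x (T x))) b"
    by (rule *(1))
  have "Im (cinner x (T x)) = 0" for x
    using *(2) has_sum_0 has_sum_unique by fastforce
  moreover have "Re (cinner x (T x)) \<ge> 0" for x
    using *(1) by (rule has_sum_nonneg) (auto simp: c)
  ultimately show "positive_op T"
    using T(1) by (auto simp: positive_op_def complex_nonneg_Reals_iff)
qed

text \<open>If \<open>P\<close> is positive with \<open>P\<^sup>2 = T\<^sup>2\<close> and \<open>T k = c k\<close>, then \<open>v = (P - c) k\<close> satisfies
  \<open>P v = - c v\<close>, which forces \<open>v = 0\<close>: the absolute value of a diagonal operator is diagonal.\<close>

lemma abs_op_eigenvector: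
  fixes T :: "'h::complex_hilbert \<Rightarrow> 'h"
  assumes P: "is_abs_op P T" and T: "bounded_op T" and sym: "\<And>x. cinner (T x) (T k) = cinner x (T (T k))"
    and k: "T k = r *\<^sub>R k" "r \<ge> 0"
  shows "P k = r *\<^sub>R k"
proof -
  have Pb: "bounded_op P" and pos: "\<And>x. cinner x (P x) \<in> \<real>\<^sub>\<ge>\<^sub>0"
    and eq: "\<And>x y. cinner (P x) (P y) = cinner (T x) (T y)"
    using P by (auto simp: is_abs_op_def positive_op_def)
  note P' = bounded_opD[OF Pb]
  \<comment> \<open>Polarisation: reality of the quadratic form at \<open>x + y\<close> relates the
    imaginary parts, and replacing \<open>x\<close> by \<open>\<i> *\<^sub>C x\<close> then relates
    the real parts.\<close>
  have P_sym: "cinner (P x) y = cinner x (P y)" for x y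
  proof -
    have real: "Im (cinner z (P z)) = 0" for z
      using pos[of z] by (simp add: complex_nonneg_Reals_iff)
    have im: "Im (cinner x (P y)) = - Im (cinner y (P x))" for x y
      using real[of "x + y"] real[of x] real[of y]
      by (simp add: P' cinner_add_left cinner_add_right)
    have re: "Re (cinner x (P y)) = Re (cinner y (P x))"
      using im[of "\<i> *\<^sub>C x" y] by (simp add: P' cinner_scaleC_left cinner_scaleC_right)
    have "cinner x (P y) = cnj (cinner y (P x))"
      using im[of x y] re by (simp add: complex_eq_iff)
    then show ?thesis
      by (metis cinner_commute)
  qed
  have "cinner x (P (P k)) = cinner x (T (T k))" for x
    using eq[of x k] sym[of x] by (simp add: P_sym)
  then have "cinner x (P (P k) - T (T k)) = 0" for x
    by (simp add: cinner_diff_right)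
  then have "P (P k) - T (T k) = 0"
    using cinner_self_eq_0_iff by blast
  then have PP: "P (P k) = r\<^sup>2 *\<^sub>R k"
    by (simp add: k(1) bounded_opD[OF T] power2_eq_square)
  define v where "v = P k - r *\<^sub>R k"
  have Pv: "P v = (- r) *\<^sub>R v"
    unfolding v_def
    by (simp add: linear_simps(2)[OF P'(1)] P' PP power2_eq_square scaleR_diff_right)
  have "Re (cinner v (P v)) \<ge> 0"
    using pos[of v] by (simp add: complex_nonneg_Reals_iff)
  then have "r * (norm v)\<^sup>2 \<le> 0"
    by (simp add: Pv cinner_scaleR_right cinner_self cinner_minus_right)
  then have "r = 0 \<or> v = 0"
    using k(2) by (auto simp: mult_le_0_iff)
  moreover have "v = 0" if "r = 0"
  proof -
    have "cinner (P k) (P k) = 0"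
      using eq[of k k] that k(1) by simp
    then show ?thesis
      using that by (simp add: v_def)
  qed
  ultimately show ?thesis
    by (auto simp: v_def)
qed

text \<open>For summable \<open>c\<close>, the operator is its own absolute value and
  \<open>b\<close> is a witness. Conversely, the absolute value \<open>P\<close> supplied by the
  definition agrees with \<open>T\<close> on \<open>b\<close>. The non-negative double series over
  \<open>E \<times> b\<close> then has row sums given by the quadratic form of \<open>P\<close> and,
  by Parseval, column sums \<open>c k\<close>; summability passes from one to the other.\<close>

lemma diagonal_trace_class_iff:
  fixes T :: "'h::complex_hilbert \<Rightarrow> 'h" and c :: "'h \<Rightarrow> real"
  assumes b: "orthonormal_basis b" and T: "bounded_op T" "\<And>k. k \<in> b \<Longrightarrow> T k = c k *\<^sub>R k"
    and c: "\<And>k. k \<in> b \<Longrightarrow> c k \<ge> 0"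
  shows "trace_class T \<longleftrightarrow> c summable_on b"
proof
  assume "c summable_on b"
  moreover have "cinner k (T k) = of_real (c k)" if "k \<in> b" for k
    using that T(2) orthonormal_norm[OF orthonormal_set_basis[OF b]]
    by (simp add: cinner_scaleR_right cinner_self)
  ultimately have "(\<lambda>k. cinner k (T k)) summable_on b"
    using summable_on_of_real[of c b, where 'a = complex] by (simp cong: summable_on_cong)
  moreover have "is_abs_op T T"
    using diagonal_positive_op(2)[OF b T c] by (simp add: is_abs_op_def)
  ultimately show "trace_class T"
    using b T(1) unfolding trace_class_def by blast
next
  assume "trace_class T"
  then obtain P E where P: "is_abs_op P T" and E: "orthonormal_basis E"
    and sum: "(\<lambda>e. cinner e (P e)) summable_on E"
    by (auto simp: trace_class_def)
  have T_sym: "cinner (T x) k = cinner x (T k)" if "k \<in> b" for x k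
  proof -
    have "((\<lambda>j. cinner k (T (cinner j x *\<^sub>C j))) has_sum cinner k (T x)) b"
      by (intro cinner_has_sum has_sum_bounded_linear[OF bounded_opD(1)[OF T(1)] basis_expansion[OF b]])
    moreover have "((\<lambda>j. cinner k (T (cinner j x *\<^sub>C j))) has_sum cinner k (c k *\<^sub>R cinner k x *\<^sub>C k)) b"
      using that orthonormal_set_basis[OF b]
      by (intro has_sum_finite_neutralI[of "{k}"])
         (auto simp: bounded_opD[OF T(1)] T(2) cinner_scaleC_right cinner_scaleR_right orthonormal_set_def)
    ultimately have "cinner k (T x) = cinner k (c k *\<^sub>R cinner k x *\<^sub>C k)"
      by (rule has_sum_unique)
    also have "\<dots> = cinner (T k) x"
      using orthonormal_norm[OF orthonormal_set_basis[OF b] that]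
      by (simp add: T(2)[OF that] cinner_scaleR_right cinner_scaleC_right cinner_scaleR_left cinner_self)
    finally show ?thesis
      by (metis cinner_commute)
  qed
  have Pb: "bounded_op P"
    using P by (auto simp: is_abs_op_def positive_op_def)
  have Pk: "P k = c k *\<^sub>R k" if "k \<in> b" for k
    using P T(1) _ T(2)[OF that] c[OF that]
    by (rule abs_op_eigenvector)
       (simp add: T(2)[OF that] cinner_scaleR_right cinner_scaleR_left bounded_opD[OF T(1)] T_sym[OF that])
  have row: "((\<lambda>k. c k * (cmod (cinner k e))\<^sup>2) has_sum Re (cinner e (P e))) b" for e
    by (rule diagonal_positive_op(1)[OF b Pb Pk c])
  have col: "((\<lambda>e. c k * (cmod (cinner k e))\<^sup>2) has_sum c k) E" if "k \<in> b" for k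
    using has_sum_cmult_right[OF parseval[OF E, of k], of "c k"]
      orthonormal_norm[OF orthonormal_set_basis[OF b] that]
    by (simp add: cinner_commute[of k])
  have sumRe: "(\<lambda>e. Re (cinner e (P e))) summable_on E"
    using sum by (rule summable_on_Re)
  have "(\<lambda>(e, k). c k * (cmod (cinner k e))\<^sup>2) summable_on (E \<times> b)"
    by (rule summable_on_SigmaI[where g = "\<lambda>e. Re (cinner e (P e))"]) (use row sumRe c in auto)
  then have "(\<lambda>(k, e). c k * (cmod (cinner k e))\<^sup>2) summable_on (b \<times> E)"
    using summable_on_swap[of "\<lambda>(k, e). c k * (cmod (cinner k e))\<^sup>2" b E] by (simp add: case_prod_unfold)
  then obtain \<tau> where \<tau>: "((\<lambda>(k, e). c k * (cmod (cinner k e))\<^sup>2) has_sum \<tau>) (b \<times> E)"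
    by (auto simp: summable_on_def)
  have "(c has_sum \<tau>) b"
    using has_sum_SigmaD[OF \<tau>] col by auto
  then show "c summable_on b"
    by (auto simp: summable_on_def)
qed

section \<open>Tensor products\<close>

lemma closure_span_minimal:
  fixes G :: "'v::real_normed_vector set"
  assumes "G \<subseteq> S" "subspace S" "closed S"
  shows "closure (span G) \<subseteq> S"
  using assms by (intro closure_minimal span_minimal)

lemma subspace_closure:
  fixes S :: "'v::real_normed_vector set"
  assumes S: "subspace S"
  shows "subspace (closure S)"
  unfolding subspace_def
proof (intro conjI ballI allI)
  show "0 \<in> closure S"
    using subspace_0[OF S] closure_subset by blast
  show "x + y \<in> closure S" if "x \<in> closure S" "y \<in> closure S" for x y
  proof -
    obtain a b where "\<And>n. a n \<in> S" "a \<longlonglongrightarrow> x" "\<And>n. b n \<in> S" "b \<longlonglongrightarrow> y"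
      using \<open>x \<in> _\<close> \<open>y \<in> _\<close> unfolding closure_sequential by blast
    then have "\<forall>n. a n + b n \<in> S" "(\<lambda>n. a n + b n) \<longlonglongrightarrow> x + y"
      using subspace_add[OF S] by (auto intro: tendsto_add)
    then show ?thesis
      unfolding closure_sequential by (intro exI[of _ "\<lambda>n. a n + b n"] conjI)
  qed
  show "r *\<^sub>R x \<in> closure S" if "x \<in> closure S" for r x
  proof -
    obtain a where "\<And>n. a n \<in> S" "a \<longlonglongrightarrow> x"
      using \<open>x \<in> _\<close> unfolding closure_sequential by blast
    then have "\<forall>n. r *\<^sub>R a n \<in> S" "(\<lambda>n. r *\<^sub>R a n) \<longlonglongrightarrow> r *\<^sub>R x"
      using subspace_scale[OF S] by (auto intro: tendsto_scaleR)
    then show ?thesis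
      unfolding closure_sequential by (intro exI[of _ "\<lambda>n. r *\<^sub>R a n"] conjI)
  qed
qed

locale hilbert_tensor_product =
  fixes ten :: "'h1::complex_hilbert \<Rightarrow> 'h2::complex_hilbert \<Rightarrow> 'h::complex_hilbert"
  assumes tensor: "hilbert_tensor ten"
begin

lemma ten_simps:
  "ten (x + x') y = ten x y + ten x' y" "ten x (y + y') = ten x y + ten x y'"
  "ten (c *\<^sub>C x) y = c *\<^sub>C ten x y" "ten x (c *\<^sub>C y) = c *\<^sub>C ten x y"
  using tensor by (auto simp: hilbert_tensor_def cbilinear_map_def clinear_map_def)

lemma ten_scaleR: "ten (r *\<^sub>R x) y = r *\<^sub>R ten x y" "ten x (r *\<^sub>R y) = r *\<^sub>R ten x y"
  by (simp_all add: scaleR_scaleC ten_simps)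

lemma cinner_ten: "cinner (ten x y) (ten x' y') = cinner x x' * cinner y y'"
  using tensor by (auto simp: hilbert_tensor_def)

lemma norm_ten: "norm (ten x y) = norm x * norm y"
proof -
  have "complex_of_real ((norm (ten x y))\<^sup>2) = of_real ((norm x * norm y)\<^sup>2)"
    using cinner_ten[of x y x y] by (simp only: cinner_self of_real_mult power_mult_distrib)
  then have "(norm (ten x y))\<^sup>2 = (norm x * norm y)\<^sup>2"
    by (simp only: of_real_eq_iff)
  then show ?thesis
    by (simp add: power2_eq_iff_nonneg)
qed

lemma bounded_bilinear_ten: "bounded_bilinear ten"
proof
  show "\<exists>K. \<forall>a b. norm (ten a b) \<le> norm a * norm b * K"
    by (rule exI[of _ 1]) (simp add: norm_ten)
qed (auto simp: ten_simps ten_scaleR)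

lemmas bounded_linear_ten_right = bounded_bilinear.bounded_linear_right[OF bounded_bilinear_ten]
lemmas bounded_linear_ten_left = bounded_bilinear.bounded_linear_left[OF bounded_bilinear_ten]

lemma tensor_dense:
  assumes "\<And>x y. ten x y \<in> S" "subspace S" "closed S"
  shows "z \<in> S"
proof -
  have "closure (span {ten x y | x y. True}) \<subseteq> S"
    using assms by (intro closure_span_minimal) auto
  then show ?thesis
    using tensor by (auto simp: hilbert_tensor_def)
qed

lemma flip: "hilbert_tensor_product (\<lambda>y x. ten x y)"
proof
  have "{ten x y | y x. True} = {ten x y | x y. True}"
    by auto
  then show "hilbert_tensor (\<lambda>y x. ten x y)"
    using tensor by (auto simp: hilbert_tensor_def cbilinear_map_def clinear_map_def mult.commute)
qed

lemma bounded_op_eqI: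
  fixes T T' :: "'h \<Rightarrow> 'h"
  assumes "bounded_op T" "bounded_op T'" "\<And>x y. T (ten x y) = T' (ten x y)"
  shows "T = T'"
proof
  note T = bounded_opD[OF assms(1)] bounded_op_0[OF assms(1)]
    bounded_opD[OF assms(2)] bounded_op_0[OF assms(2)]
  fix z
  have "z \<in> {z. T z = T' z}"
  proof (rule tensor_dense)
    show "closed {z. T z = T' z}"
      using T by (intro closed_Collect_eq linear_continuous_on)
  qed (auto simp: T assms(3) subspace_def)
  then show "T z = T' z" by simp
qed

end

section \<open>Product bases and tensor products of operators\<close>

locale tensor_bases = hilbert_tensor_product ten
  for ten :: "'h1::complex_hilbert \<Rightarrow> 'h2::complex_hilbert \<Rightarrow> 'h::complex_hilbert" +
  fixes E :: "'h1 set" and F :: "'h2 set"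
  assumes basis1: "orthonormal_basis E" and basis2: "orthonormal_basis F"
begin

definition "tensor_basis = (\<lambda>(e, f). ten e f) ` (E \<times> F)"

lemma cinner_ten_basis:
  assumes "e \<in> E" "f \<in> F" "e' \<in> E" "f' \<in> F"
  shows "cinner (ten e f) (ten e' f') = (if e = e' \<and> f = f' then 1 else 0)"
  using assms orthonormal_set_basis[OF basis1] orthonormal_set_basis[OF basis2]
  by (simp add: cinner_ten orthonormal_set_def)

lemma inj_ten: "inj_on (\<lambda>(e, f). ten e f) (E \<times> F)"
proof (rule inj_onI, clarsimp)
  fix e f e' f' assume *: "e \<in> E" "f \<in> F" "e' \<in> E" "f' \<in> F" and "ten e f = ten e' f'"
  then have "cinner (ten e f) (ten e' f') = 1"
    using cinner_ten_basis[of e' f' e' f'] by simp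
  then show "e = e' \<and> f = f'"
    using cinner_ten_basis[OF *] by (auto split: if_splits)
qed

text \<open>For completeness, orthogonality to all \<open>ten e f\<close> is widened one factor at a
  time, expanding along \<open>F\<close> and then along \<open>E\<close>, until it covers all
  elementary tensors; these are total.\<close>

lemma orthonormal_basis_tensor: "orthonormal_basis tensor_basis"
  unfolding orthonormal_basis_def
proof (intro conjI allI impI)
  show "\<forall>k\<in>tensor_basis. \<forall>k'\<in>tensor_basis. cinner k k' = (if k = k' then 1 else 0)"
    using inj_ten by (auto simp: tensor_basis_def cinner_ten_basis inj_on_def)
next
  fix x assume x: "\<forall>k\<in>tensor_basis. cinner k x = 0"
  have 1: "cinner x (ten e f) = 0" if "e \<in> E" "f \<in> F" for e f
    using that x by (auto simp: tensor_basis_def cinner_eq_0_commute)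
  have 2: "cinner x (ten e b) = 0" if "e \<in> E" for e b
  proof -
    have "((\<lambda>f. cinner x (ten e (cinner f b *\<^sub>C f))) has_sum cinner x (ten e b)) F"
      by (intro cinner_has_sum has_sum_bounded_linear[OF bounded_linear_ten_right basis_expansion[OF basis2]])
    moreover have "((\<lambda>f. cinner x (ten e (cinner f b *\<^sub>C f))) has_sum 0) F"
      by (rule has_sum_0) (simp add: ten_simps cinner_scaleC_right 1 that)
    ultimately show ?thesis by (rule has_sum_unique)
  qed
  have 3: "cinner x (ten a b) = 0" for a b
  proof -
    have "((\<lambda>e. cinner x (ten (cinner e a *\<^sub>C e) b)) has_sum cinner x (ten a b)) E"
      by (intro cinner_has_sum has_sum_bounded_linear[OF bounded_linear_ten_left basis_expansion[OF basis1]])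
    moreover have "((\<lambda>e. cinner x (ten (cinner e a *\<^sub>C e) b)) has_sum 0) E"
      by (rule has_sum_0) (simp add: ten_simps cinner_scaleC_right 2)
    ultimately show ?thesis by (rule has_sum_unique)
  qed
  have "x \<in> {z. cinner x z = 0}"
  proof (rule tensor_dense)
    show "closed {z. cinner x z = 0}"
      by (intro closed_Collect_eq continuous_intros)
  qed (auto simp: 3 subspace_def cinner_add_right cinner_scaleR_right)
  then show "x = 0" by simp
qed

lemma ten_basis_coeff_has_sum:
  "((\<lambda>(e, f). (cmod (cinner (ten e f) v))\<^sup>2) has_sum (norm v)\<^sup>2) (E \<times> F)"
proof -
  have "((\<lambda>k. (cmod (cinner k v))\<^sup>2) has_sum (norm v)\<^sup>2) ((\<lambda>(e, f). ten e f) ` (E \<times> F))"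
    using parseval[OF orthonormal_basis_tensor, of v] by (simp only: tensor_basis_def)
  then show ?thesis
    by (subst (asm) has_sum_reindex[OF inj_ten]) (simp add: o_def case_prod_unfold)
qed

text \<open>\<open>A \<otimes> 1\<close> acts on the coefficients of \<open>v = \<Sum>f\<in>F. slice f v \<otimes> f\<close>.\<close>

lemma left_tensor_op_exists:
  assumes "bounded_op A"
  obtains T where "bounded_op T" "\<And>x y. T (ten x y) = ten (A x) y"
proof -
  note A = bounded_opD[OF assms]
  obtain C where C: "C \<ge> 0" "\<And>x. norm (A x) \<le> norm x * C"
    using bounded_linear.nonneg_bounded[OF A(1)] by auto
  have slice_summable: "(\<lambda>e. cinner (ten e f) v *\<^sub>C e) summable_on E" if "f \<in> F" for f v
  proof (rule orthonormal_coeff_summable[OF orthonormal_set_basis[OF basis1]])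
    have "(\<lambda>p. (cmod (cinner (ten (fst p) (snd p)) v))\<^sup>2) summable_on (E \<times> {f})"
      by (rule summable_on_subset_banach[where A = "E \<times> F"])
         (use ten_basis_coeff_has_sum[of v] that in \<open>auto simp: summable_on_def case_prod_unfold\<close>)
    moreover have "bij_betw (\<lambda>e. (e, f)) E (E \<times> {f})"
      by (auto simp: bij_betw_def inj_on_def)
    ultimately show "(\<lambda>e. (cmod (cinner (ten e f) v))\<^sup>2) summable_on E"
      using summable_on_reindex_bij_betw[of "\<lambda>e. (e, f)" E "E \<times> {f}"] by force
  qed
  \<comment> \<open>The partial inner product of \<open>v\<close> with \<open>f\<close> in the
    second factor. It is determined by its coefficients along \<open>E\<close>, as no such map is
    available yet.\<close>
  define slice where "slice f v = (\<Sum>\<^sub>\<infinity>e\<in>E. cinner (ten e f) v *\<^sub>C e)" for f v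
  have slice: "((\<lambda>e. cinner (ten e f) v *\<^sub>C e) has_sum slice f v) E" if "f \<in> F" for f v
    using slice_summable[OF that] by (simp add: slice_def)
  have slice_norm: "((\<lambda>e. (cmod (cinner (ten e f) v))\<^sup>2) has_sum (norm (slice f v))\<^sup>2) E" if "f \<in> F" for f v
  proof -
    have "((\<lambda>e. (norm (cinner (ten e f) v *\<^sub>C e))\<^sup>2) has_sum (norm (slice f v))\<^sup>2) E"
      by (rule has_sum_norm_orthogonal[OF orthonormal_inner_0[OF orthonormal_set_basis[OF basis1]] slice[OF that]])
    then show ?thesis
      by (rule has_sum_cong[THEN iffD1, rotated])
         (simp add: norm_scaleC orthonormal_norm[OF orthonormal_set_basis[OF basis1]])
  qed
  have slice_add: "slice f (v + w) = slice f v + slice f w" if "f \<in> F" for f v w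
    using has_sum_unique[OF slice[OF that, of "v + w"]] has_sum_add[OF slice[OF that, of v] slice[OF that, of w]]
    by (simp add: cinner_add_right scaleC_add_left)
  have slice_scaleC: "slice f (c *\<^sub>C v) = c *\<^sub>C slice f v" if "f \<in> F" for f v c
    using has_sum_unique[OF slice[OF that, of "c *\<^sub>C v"]]
      has_sum_bounded_linear[OF bounded_linear_scaleC_right slice[OF that, of v]]
    by (simp add: cinner_scaleC_right scaleC_scaleC[symmetric])
  have slice_ten: "slice f (ten x y) = cinner f y *\<^sub>C x" if "f \<in> F" for f x y
    using has_sum_unique[OF slice[OF that, of "ten x y"]]
      has_sum_bounded_linear[OF bounded_linear_scaleC_right basis_expansion[OF basis1, of x], of "cinner f y"]
    by (simp add: cinner_ten scaleC_scaleC mult.commute)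
  have slices: "((\<lambda>f. (norm (slice f v))\<^sup>2) has_sum (norm v)\<^sup>2) F" for v
  proof (rule has_sum_SigmaD)
    show "((\<lambda>(f, e). (cmod (cinner (ten e f) v))\<^sup>2) has_sum (norm v)\<^sup>2) (F \<times> E)"
      using ten_basis_coeff_has_sum[of v] by (subst has_sum_swap) simp
  qed (use slice_norm in auto)
  have orth: "inner (ten a f) (ten a' f') = 0" if "f \<in> F" "f' \<in> F" "f \<noteq> f'" for f f' a a'
    using that orthonormal_set_basis[OF basis2]
    by (intro inner_eq_0_if_cinner) (auto simp: cinner_ten orthonormal_set_def)
  have bound: "(norm (ten (A (slice f v)) f))\<^sup>2 \<le> C\<^sup>2 * (norm (slice f v))\<^sup>2" if "f \<in> F" for f v
    using power_mono[OF C(2)[of "slice f v"], of 2] orthonormal_norm[OF orthonormal_set_basis[OF basis2] that]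
    by (simp add: norm_ten power_mult_distrib mult.commute)
  have sq: "((\<lambda>f. C\<^sup>2 * (norm (slice f v))\<^sup>2) has_sum C\<^sup>2 * (norm v)\<^sup>2) F" for v
    by (rule has_sum_cmult_right[OF slices])
  have "(\<lambda>f. ten (A (slice f v)) f) summable_on F" for v
  proof (rule summable_on_orthogonal[OF orth])
    show "(\<lambda>f. (norm (ten (A (slice f v)) f))\<^sup>2) summable_on F"
      by (rule summable_on_comparison_test[OF has_sum_imp_summable[OF sq[of v]]]) (use bound in auto)
  qed
  then obtain T where T: "\<And>v. ((\<lambda>f. ten (A (slice f v)) f) has_sum T v) F"
    unfolding summable_on_def by metis
  have T_add: "T (v + w) = T v + T w" for v w
  proof (rule has_sum_unique[OF T[of "v + w"]])
    show "((\<lambda>f. ten (A (slice f (v + w))) f) has_sum T v + T w) F"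
      using has_sum_add[OF T[of v] T[of w]]
      by (rule has_sum_cong[THEN iffD1, rotated]) (simp add: slice_add A ten_simps)
  qed
  have T_scaleC: "T (c *\<^sub>C v) = c *\<^sub>C T v" for c v
  proof (rule has_sum_unique[OF T[of "c *\<^sub>C v"]])
    show "((\<lambda>f. ten (A (slice f (c *\<^sub>C v))) f) has_sum c *\<^sub>C T v) F"
      using has_sum_bounded_linear[OF bounded_linear_scaleC_right T[of v]]
      by (rule has_sum_cong[THEN iffD1, rotated]) (simp add: slice_scaleC A ten_simps)
  qed
  have T_ten: "T (ten x y) = ten (A x) y" for x y
  proof (rule has_sum_unique[OF T[of "ten x y"]])
    show "((\<lambda>f. ten (A (slice f (ten x y))) f) has_sum ten (A x) y) F"
      using has_sum_bounded_linear[OF bounded_linear_ten_right basis_expansion[OF basis2, of y], of "A x"]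
      by (rule has_sum_cong[THEN iffD1, rotated]) (simp add: slice_ten A ten_simps)
  qed
  have T_norm: "norm (T v) \<le> norm v * C" for v
  proof -
    have "((\<lambda>f. (norm (ten (A (slice f v)) f))\<^sup>2) has_sum (norm (T v))\<^sup>2) F"
      by (rule has_sum_norm_orthogonal[OF orth T])
    then have "(norm (T v))\<^sup>2 \<le> C\<^sup>2 * (norm v)\<^sup>2"
      using sq bound by (rule has_sum_mono)
    then have "(norm (T v))\<^sup>2 \<le> (norm v * C)\<^sup>2"
      by (simp add: power_mult_distrib mult.commute)
    then show ?thesis
      by (rule power2_le_imp_le) (use C in auto)
  qed
  have "bounded_linear T"
    using T_norm by (intro bounded_linear_intro) (auto simp: T_add scaleR_scaleC T_scaleC)
  then have "bounded_op T"
    by (auto simp: bounded_op_def clinear_map_def T_add T_scaleC)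
  then show ?thesis
    using T_ten that by blast
qed

text \<open>Existence is the composition of \<open>A \<otimes> 1\<close> and
  \<open>1 \<otimes> B\<close>, the latter being the first construction applied to the flipped
  tensor product. Uniqueness is density of the elementary tensors.\<close>

lemma tensor_op:
  assumes "bounded_op A" "bounded_op B"
  shows "bounded_op (tensor_op ten A B)" "tensor_op ten A B (ten x y) = ten (A x) (B y)"
proof -
  interpret flip: tensor_bases "\<lambda>y x. ten x y" F E
    using flip basis1 basis2 by (simp add: tensor_bases_def tensor_bases_axioms_def)
  obtain S where S: "bounded_op S" "\<And>x y. S (ten x y) = ten (A x) y"
    using left_tensor_op_exists[OF assms(1)] by blast
  obtain R where R: "bounded_op R" "\<And>y x. R (ten x y) = ten x (B y)"
    using flip.left_tensor_op_exists[OF assms(2)] by blast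
  have "bounded_op (S \<circ> R)"
    using S(1) R(1) by (auto simp: bounded_op_def clinear_map_def o_def bounded_linear_compose)
  moreover have "(S \<circ> R) (ten x y) = ten (A x) (B y)" for x y
    by (simp add: S R)
  ultimately have "\<exists>!T. bounded_op T \<and> (\<forall>x y. T (ten x y) = ten (A x) (B y))"
    using bounded_op_eqI by (intro ex1I[of _ "S \<circ> R"]) (metis+)
  from theI'[OF this] show "bounded_op (tensor_op ten A B)"
    "tensor_op ten A B (ten x y) = ten (A x) (B y)"
    by (auto simp: tensor_op_def)
qed

end

section \<open>The Dirac operator of the tensor product\<close>

locale tensor_dirac_operator = hilbert_tensor_product ten + D1: symmetric_graph D1 + D2: symmetric_graph D2
  for ten :: "'h1::complex_hilbert \<Rightarrow> 'h2::complex_hilbert \<Rightarrow> 'h::complex_hilbert"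
    and D1 :: "'h1 graph" and D2 :: "'h2 graph" +
  fixes \<gamma> :: "'h1 \<Rightarrow> 'h1"
  assumes \<gamma>_bounded: "bounded_op \<gamma>"
    and \<gamma>_involution: "\<gamma> (\<gamma> x) = x"
    and \<gamma>_sym: "cinner (\<gamma> x) x' = cinner x (\<gamma> x')"
    and \<gamma>_anticommute: "(x, u) \<in> D1 \<Longrightarrow> (\<gamma> x, - \<gamma> u) \<in> D1"
begin

definition "generators = {(ten x y, ten u y + ten (\<gamma> x) v) | x u y v. (x, u) \<in> D1 \<and> (y, v) \<in> D2}"

abbreviation "D \<equiv> tensor_dirac ten D1 \<gamma> D2"

lemma D_def: "D = closure (span generators)"
  by (simp add: tensor_dirac_def generators_def)

lemma generators_subset: "generators \<subseteq> D"
  unfolding D_def using span_superset closure_subset by blast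

lemma subspace_D: "subspace D"
  unfolding D_def by (intro subspace_closure subspace_span)

lemma D_scaleC: assumes "p \<in> D" shows "(c *\<^sub>C fst p, c *\<^sub>C snd p) \<in> D"
proof -
  have *: "bounded_linear (\<lambda>p::'h \<times> 'h. (c *\<^sub>C fst p, c *\<^sub>C snd p))"
    by (intro bounded_linear_Pair bounded_linear_compose[OF bounded_linear_scaleC_right]
        bounded_linear_fst bounded_linear_snd)
  have "generators \<subseteq> {p. (c *\<^sub>C fst p, c *\<^sub>C snd p) \<in> D}"
  proof
    fix p assume "p \<in> generators"
    then obtain x u y v where p: "p = (ten x y, ten u y + ten (\<gamma> x) v)" "(x, u) \<in> D1" "(y, v) \<in> D2"
      by (auto simp: generators_def)
    then have "(ten (c *\<^sub>C x) y, ten (c *\<^sub>C u) y + ten (\<gamma> (c *\<^sub>C x)) v) \<in> generators"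
      using D1.graph_scaleC unfolding generators_def by blast
    then show "p \<in> {p. (c *\<^sub>C fst p, c *\<^sub>C snd p) \<in> D}"
      using generators_subset p(1)
      by (auto simp: ten_simps bounded_opD[OF \<gamma>_bounded] scaleC_add_right)
  qed
  moreover have "subspace {p. (c *\<^sub>C fst p, c *\<^sub>C snd p) \<in> D}"
    using linear_subspace_linear_preimage[OF bounded_linear.linear[OF *] subspace_D] by simp
  moreover have "closed {p. (c *\<^sub>C fst p, c *\<^sub>C snd p) \<in> D}"
    using closed_vimage[OF _ linear_continuous_on[OF *], of D] by (simp add: D_def vimage_def)
  ultimately have "D \<subseteq> {p. (c *\<^sub>C fst p, c *\<^sub>C snd p) \<in> D}"
    unfolding D_def[symmetric] by (subst (1) D_def) (rule closure_span_minimal)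
  then show ?thesis using assms by auto
qed

text \<open>On generators the mixed terms agree because \<open>\<gamma>\<close>, \<open>D1\<close>
  and \<open>D2\<close> are symmetric. With one argument fixed, the identity cuts out a closed real
  subspace in the other, so it extends from generators to \<open>D\<close> in two rounds.\<close>

lemma D_sym:
  assumes "p \<in> D" "q \<in> D"
  shows "cinner (fst p) (snd q) = cinner (snd p) (fst q)"
proof -
  have 1: "p \<in> {p. cinner (fst p) (snd q) = cinner (snd p) (fst q)}" if qp: "q \<in> generators" "p \<in> D" for p q
  proof (rule subsetD[OF _ qp(2)], subst D_def, rule closure_span_minimal)
    show "generators \<subseteq> {p. cinner (fst p) (snd q) = cinner (snd p) (fst q)}"
    proof
      fix p assume "p \<in> generators"
      then obtain x u y v where p: "p = (ten x y, ten u y + ten (\<gamma> x) v)" "(x, u) \<in> D1" "(y, v) \<in> D2"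
        by (auto simp: generators_def)
      obtain x' u' y' v' where q: "q = (ten x' y', ten u' y' + ten (\<gamma> x') v')" "(x', u') \<in> D1" "(y', v') \<in> D2"
        using qp(1) by (auto simp: generators_def)
      show "p \<in> {p. cinner (fst p) (snd q) = cinner (snd p) (fst q)}"
        using D1.graph_sym[OF p(2) q(2)] D2.graph_sym[OF p(3) q(3)]
        by (simp add: p(1) q(1) cinner_add_left cinner_add_right cinner_ten \<gamma>_sym)
    qed
  qed (auto simp: subspace_def cinner_add_left cinner_scaleR_left intro!: closed_Collect_eq continuous_intros)
  have "q \<in> {q. cinner (fst p) (snd q) = cinner (snd p) (fst q)}"
  proof (rule subsetD[OF _ assms(2)], subst D_def, rule closure_span_minimal)
    show "generators \<subseteq> {q. cinner (fst p) (snd q) = cinner (snd p) (fst q)}"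
      using 1 assms by auto
  qed (auto simp: subspace_def cinner_add_right cinner_scaleR_right intro!: closed_Collect_eq continuous_intros)
  then show ?thesis by simp
qed

sublocale symmetric_graph D
proof
  show "(0, 0) \<in> D"
    using subspace_0[OF subspace_D] by (simp add: zero_prod_def)
  show "(x + y, u + v) \<in> D" if "(x, u) \<in> D" "(y, v) \<in> D" for x y u v
    using subspace_add[OF subspace_D that] by simp
  show "(c *\<^sub>C x, c *\<^sub>C u) \<in> D" if "(x, u) \<in> D" for x u c
    using D_scaleC[OF that] by simp
  show "closed D"
    by (simp add: D_def)
  show "cinner x v = cinner u y" if "(x, u) \<in> D" "(y, v) \<in> D" for x y u v
    using D_sym[OF that] by simp
qed

text \<open>On the span of \<open>w = e \<otimes> f\<close> and \<open>w' = \<gamma> e \<otimes> f\<close> the operator \<open>D\<close> is the matrix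
  \<open>[[l, m], [m, -l]]\<close>, with square \<open>l\<^sup>2 + m\<^sup>2\<close>.\<close>

lemma ten_eigenvectors:
  assumes e: "e \<in> eigenspace D1 l" and f: "f \<in> eigenspace D2 m" and "l \<noteq> 0"
  defines "\<nu> \<equiv> sqrt (l\<^sup>2 + m\<^sup>2)"
  obtains v v' where "v \<in> eigenspace D \<nu>" "v' \<in> eigenspace D (- \<nu>)" "ten e f = v + v'"
proof -
  have "\<nu> > 0"
    using \<open>l \<noteq> 0\<close> by (simp add: \<nu>_def sum_power2_gt_zero_iff)
  have \<nu>2: "\<nu>\<^sup>2 = l\<^sup>2 + m\<^sup>2"
    by (simp add: \<nu>_def)
  define w where "w = ten e f"
  define w' where "w' = ten (\<gamma> e) f"
  have e1: "(e, l *\<^sub>R e) \<in> D1" and f1: "(f, m *\<^sub>R f) \<in> D2"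
    using e f by (auto simp: eigenspace_def)
  have e2: "(\<gamma> e, - (l *\<^sub>R \<gamma> e)) \<in> D1"
    using \<gamma>_anticommute[OF e1] by (simp add: bounded_opD[OF \<gamma>_bounded])
  define z where "z = l *\<^sub>R w + m *\<^sub>R w'"
  have "(ten e f, ten (l *\<^sub>R e) f + ten (\<gamma> e) (m *\<^sub>R f)) \<in> generators"
    using e1 f1 unfolding generators_def by blast
  then have w: "(w, z) \<in> D"
    using generators_subset by (auto simp: w_def w'_def z_def ten_scaleR)
  have "(ten (\<gamma> e) f, ten (- (l *\<^sub>R \<gamma> e)) f + ten (\<gamma> (\<gamma> e)) (m *\<^sub>R f)) \<in> generators"
    using e2 f1 unfolding generators_def by blast
  then have w': "(w', - l *\<^sub>R w' + m *\<^sub>R w) \<in> D"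
    using generators_subset ten_scaleR(1)[of "- l" "\<gamma> e" f]
    by (auto simp: w_def w'_def ten_scaleR \<gamma>_involution)
  have scaleR: "(r *\<^sub>R a, r *\<^sub>R b) \<in> D" if "(a, b) \<in> D" for r a b
    using graph_scaleC[OF that] by (simp add: scaleR_scaleC)
  have "(z, l *\<^sub>R z + m *\<^sub>R (- l *\<^sub>R w' + m *\<^sub>R w)) \<in> D"
    using graph_add[OF scaleR[OF w, of l] scaleR[OF w', of m]] by (simp add: z_def)
  moreover have "l *\<^sub>R z + m *\<^sub>R (- l *\<^sub>R w' + m *\<^sub>R w) = (l\<^sup>2 + m\<^sup>2) *\<^sub>R w"
    by (simp add: z_def algebra_simps power2_eq_square)
  ultimately have z: "(z, \<nu>\<^sup>2 *\<^sub>R w) \<in> D"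
    by (simp add: \<nu>2)
  \<comment> \<open>With \<open>z = D w\<close> and \<open>D z = \<nu>\<^sup>2 *\<^sub>R w\<close>,
    these are the spectral projections of \<open>w\<close> for \<open>s = \<nu>\<close> and
    \<open>s = - \<nu>\<close>.\<close>
  define v where "v s = (1 / 2) *\<^sub>R w + (1 / (2 * s)) *\<^sub>R z" for s
  have "v s \<in> eigenspace D s" if "s = \<nu> \<or> s = - \<nu>" for s
  proof -
    have "(v s, (1 / 2) *\<^sub>R z + (1 / (2 * s)) *\<^sub>R (\<nu>\<^sup>2 *\<^sub>R w)) \<in> D"
      unfolding v_def by (intro graph_add scaleR w z)
    moreover have "(1 / 2) *\<^sub>R z + (1 / (2 * s)) *\<^sub>R (\<nu>\<^sup>2 *\<^sub>R w) = s *\<^sub>R v s"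
      using that \<open>\<nu> > 0\<close> by (auto simp: v_def scaleR_add_right power2_eq_square)
    ultimately show ?thesis
      by (simp add: eigenspace_def)
  qed
  moreover have "ten e f = v \<nu> + v (- \<nu>)"
    unfolding w_def[symmetric] by (simp add: v_def scaleR_add_left[symmetric])
  ultimately show ?thesis
    using that by blast
qed

end

locale tensor_dirac_bases = tensor_dirac_operator ten D1 D2 \<gamma>
    + E1: eigenbasis D1 E1 ev1 + E2: eigenbasis D2 E2 ev2
  for ten :: "'h1::complex_hilbert \<Rightarrow> 'h2::complex_hilbert \<Rightarrow> 'h::complex_hilbert"
    and D1 :: "'h1 graph" and D2 :: "'h2 graph" and \<gamma> :: "'h1 \<Rightarrow> 'h1"
    and E1 ev1 E2 ev2 +
  fixes c :: real
  assumes gap_pos: "c > 0" and gap: "e \<in> E1 \<Longrightarrow> c \<le> \<bar>ev1 e\<bar>"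
begin

sublocale tensor_bases ten E1 E2
  by unfold_locales (rule E1.basis E2.basis)+

text \<open>The eigenvalue of the square of \<open>D\<close> on \<open>ten e f\<close>. Indexing by
  pairs instead of vectors lets heat traces factor over \<open>E1 \<times> E2\<close>.\<close>

definition "square_eigenvalue = (\<lambda>(e, f). (ev1 e)\<^sup>2 + (ev2 f)\<^sup>2)"

lemma square_eigenvalue_ge: "p \<in> E1 \<times> E2 \<Longrightarrow> c\<^sup>2 \<le> square_eigenvalue p"
  using gap gap_pos by (auto simp: square_eigenvalue_def abs_le_square_iff[symmetric] intro!: add_increasing2)

lemma ten_basis_eigenvectors:
  assumes "e \<in> E1" "f \<in> E2"
  obtains v v' where "v \<in> eigenspace D (sqrt (square_eigenvalue (e, f)))"
    "v' \<in> eigenspace D (- sqrt (square_eigenvalue (e, f)))" "ten e f = v + v'"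
proof -
  have "ev1 e \<noteq> 0"
    using gap[OF assms(1)] gap_pos by auto
  from ten_eigenvectors[OF E1.eigenvector[OF assms(1)] E2.eigenvector[OF assms(2)] this] that
  show ?thesis
    by (auto simp: square_eigenvalue_def)
qed

text \<open>Eigenvectors are total because each \<open>ten e f\<close> is a sum of two. An
  eigenvector whose eigenvalue has modulus below \<open>c\<close> would be orthogonal to all these
  summands, hence to a basis. This eigenbasis serves to show that powers are bounded; the traces use
  \<open>tensor_basis\<close>.\<close>

lemma eigenbasis_tensor_exists:
  obtains E ev where "eigenbasis D E ev" "\<And>e. e \<in> E \<Longrightarrow> c \<le> \<bar>ev e\<bar>"
proof -
  have total: "x = 0" if x: "\<And>l v. v \<in> eigenspace D l \<Longrightarrow> cinner v x = 0" for x
  proof -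
    have "cinner (ten e f) x = 0" if "e \<in> E1" "f \<in> E2" for e f
      using ten_basis_eigenvectors[OF that] x by (metis add_0 cinner_add_left)
    then have "\<forall>k\<in>tensor_basis. cinner k x = 0"
      by (auto simp: tensor_basis_def)
    then show ?thesis
      using orthonormal_basis_tensor unfolding orthonormal_basis_def by blast
  qed
  obtain E ev where E: "orthonormal_basis E" "\<And>e. e \<in> E \<Longrightarrow> e \<in> eigenspace D (ev e)"
    using eigenbasis_exists[OF total] by blast
  have "c \<le> \<bar>ev k\<bar>" if k: "k \<in> E" for k
  proof (rule ccontr)
    assume small: "\<not> c \<le> \<bar>ev k\<bar>"
    have "cinner (ten e f) k = 0" if ef: "e \<in> E1" "f \<in> E2" for e f
    proof -
      obtain v v' where v: "v \<in> eigenspace D (sqrt (square_eigenvalue (e, f)))"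
        "v' \<in> eigenspace D (- sqrt (square_eigenvalue (e, f)))" "ten e f = v + v'"
        using ten_basis_eigenvectors[OF ef] .
      have "c \<le> sqrt (square_eigenvalue (e, f))"
        using square_eigenvalue_ge[of "(e, f)"] ef gap_pos by (simp add: real_le_rsqrt)
      then have "cinner v k = 0" "cinner v' k = 0"
        using small eigenspace_orth[OF v(1) E(2)[OF k]] eigenspace_orth[OF v(2) E(2)[OF k]] by auto
      then show ?thesis
        by (simp add: v(3) cinner_add_left)
    qed
    then have "\<forall>j\<in>tensor_basis. cinner j k = 0"
      by (auto simp: tensor_basis_def)
    then have "k = 0"
      using orthonormal_basis_tensor unfolding orthonormal_basis_def by blast
    then show False
      using orthonormal_norm[OF orthonormal_set_basis[OF E(1)] k] by simp
  qed
  moreover have "eigenbasis D E ev"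
    using E by unfold_locales
  ultimately show ?thesis
    using that by blast
qed

lemma bounded_op_abs_power:
  assumes "s \<ge> 0"
  shows "bounded_op (abs_power D s)"
proof -
  obtain E ev where "eigenbasis D E ev" and ev: "\<And>e. e \<in> E \<Longrightarrow> c \<le> \<bar>ev e\<bar>"
    using eigenbasis_tensor_exists by blast
  then interpret eigenbasis D E ev by simp
  show ?thesis
    unfolding abs_power_def
    by (rule bounded_op_fun_calc[of _ "c powr (- s)"]) (use ev assms gap_pos in \<open>auto intro!: powr_mono2'\<close>)
qed

text \<open>The two components of \<open>ten e f\<close> have eigenvalues of equal modulus, so the
  operator scales both alike. Boundedness, which gives additivity, is a premise rather than a sign
  condition on \<open>s\<close>: in the lower bound for the abscissa it is extracted from
  \<open>trace_class\<close>.\<close>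

lemma abs_power_ten:
  assumes T: "bounded_op (abs_power D s)" and "p \<in> E1 \<times> E2"
  shows "abs_power D s (ten (fst p) (snd p)) = (square_eigenvalue p powr (- s / 2)) *\<^sub>R ten (fst p) (snd p)"
proof -
  let ?\<nu> = "sqrt (square_eigenvalue p)"
  have *: "fst p \<in> E1" "snd p \<in> E2"
    using assms(2) by auto
  obtain v v' where v: "v \<in> eigenspace D ?\<nu>" "v' \<in> eigenspace D (- ?\<nu>)" "ten (fst p) (snd p) = v + v'"
    using ten_basis_eigenvectors[OF *, unfolded prod.collapse] by blast
  have pos: "square_eigenvalue p > 0"
    using square_eigenvalue_ge[OF assms(2)] gap_pos zero_less_power[of c 2] by linarith
  then have "\<bar>?\<nu>\<bar> powr (- s) = square_eigenvalue p powr (- s / 2)"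
    by (simp add: powr_half_sqrt[symmetric] powr_powr)
  then show ?thesis
    using fun_calc_eigenvector[OF v(1), of "\<lambda>l. \<bar>l\<bar> powr (- s)"]
      fun_calc_eigenvector[OF v(2), of "\<lambda>l. \<bar>l\<bar> powr (- s)"]
    by (simp add: v(3) bounded_opD[OF T] scaleR_add_right) (simp add: abs_power_def)
qed

text \<open>Recovers the pair from its tensor, since the trace lemmas take the diagonal entries as a
  function of the basis vector.\<close>

definition "ten_index = the_inv_into (E1 \<times> E2) (\<lambda>(e, f). ten e f)"

lemma ten_index: "p \<in> E1 \<times> E2 \<Longrightarrow> ten_index (ten (fst p) (snd p)) = p"
  using the_inv_into_f_f[OF inj_ten, of p] by (simp add: ten_index_def case_prod_unfold)

lemma summable_on_tensor_basis_iff: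
  "g summable_on tensor_basis \<longleftrightarrow> (\<lambda>p. g (ten (fst p) (snd p))) summable_on (E1 \<times> E2)"
  unfolding tensor_basis_def by (subst summable_on_reindex[OF inj_ten]) (simp add: o_def case_prod_unfold)

lemma infsum_tensor_basis:
  "infsum g tensor_basis = (\<Sum>\<^sub>\<infinity>p\<in>E1 \<times> E2. g (ten (fst p) (snd p)))"
  unfolding tensor_basis_def by (subst infsum_reindex[OF inj_ten]) (simp add: o_def case_prod_unfold)

lemma abs_power_tensor_basis:
  assumes "bounded_op (abs_power D s)" "k \<in> tensor_basis"
  shows "abs_power D s k = (square_eigenvalue (ten_index k) powr (- s / 2)) *\<^sub>R k"
  using assms(2) abs_power_ten[OF assms(1)] ten_index by (fastforce simp: tensor_basis_def)

lemma trace_class_abs_power_iff: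
  assumes "bounded_op (abs_power D s)"
  shows "trace_class (abs_power D s) \<longleftrightarrow>
    (\<lambda>p. square_eigenvalue p powr (- s / 2)) summable_on (E1 \<times> E2)"
  using diagonal_trace_class_iff[OF orthonormal_basis_tensor assms abs_power_tensor_basis[OF assms]]
  by (simp add: summable_on_tensor_basis_iff ten_index cong: summable_on_cong)

lemma op_trace_abs_power:
  assumes "bounded_op (abs_power D s)" "bounded_op B"
    and "(\<lambda>p. square_eigenvalue p powr (- s / 2)) summable_on (E1 \<times> E2)"
  shows "op_trace (abs_power D s \<circ> B) = (\<Sum>\<^sub>\<infinity>p\<in>E1 \<times> E2. of_real (square_eigenvalue p powr (- s / 2)) *
    cinner (ten (fst p) (snd p)) (B (ten (fst p) (snd p))))"
proof -
  have "(\<lambda>k. \<bar>square_eigenvalue (ten_index k) powr (- s / 2)\<bar>) summable_on tensor_basis"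
    using assms(3) by (simp add: summable_on_tensor_basis_iff ten_index cong: summable_on_cong)
  from diagonal_op_trace[OF orthonormal_basis_tensor assms(1) abs_power_tensor_basis[OF assms(1)] assms(2) this]
  show ?thesis
    by (simp add: infsum_tensor_basis ten_index cong: infsum_cong)
qed

end

section \<open>Laplace and Mellin transforms\<close>

text \<open>Passes from unordered sums to integrals over a counting measure, so that sums and
  integrals can be exchanged by Fubini.\<close>

lemma count_space_integral_infsum:
  fixes f :: "'i \<Rightarrow> 'b::{banach, second_countable_topology}"
  assumes "(\<lambda>i. norm (f i)) summable_on I"
  shows "integrable (count_space I) f" "integral\<^sup>L (count_space I) f = infsum f I"
  using assms infsetsum_infsum[of f I] abs_summable_equivalent[of f I]
  by (auto simp: abs_summable_on_def infsetsum_def)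

lemma infsum_times_product:
  fixes f :: "'a \<Rightarrow> 'c::{banach, real_normed_field, second_countable_topology}"
  assumes "countable A" "countable B"
    and "(\<lambda>i. norm (f i)) summable_on A" "(\<lambda>j. norm (g j)) summable_on B"
  shows "(\<lambda>(i, j). norm (f i * g j)) summable_on (A \<times> B)"
    and "(\<Sum>\<^sub>\<infinity>(i, j)\<in>A \<times> B. f i * g j) = infsum f A * infsum g B"
proof -
  have f: "Infinite_Set_Sum.abs_summable_on f A" and g: "Infinite_Set_Sum.abs_summable_on g B"
    using assms abs_summable_equivalent[of f A] abs_summable_equivalent[of g B] by auto
  have "Infinite_Set_Sum.abs_summable_on (\<lambda>(i, j). f i * g j) (A \<times> B)"
    by (rule abs_summable_on_product[OF assms(1,2) f g])
  then show "(\<lambda>(i, j). norm (f i * g j)) summable_on (A \<times> B)"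
    using abs_summable_equivalent[of "\<lambda>(i, j). f i * g j" "A \<times> B"] by (simp add: case_prod_unfold)
  show "(\<Sum>\<^sub>\<infinity>(i, j)\<in>A \<times> B. f i * g j) = infsum f A * infsum g B"
    using infsetsum_product[OF assms(1,2) f g] infsetsum_infsum[OF f] infsetsum_infsum[OF g]
      infsetsum_infsum[OF abs_summable_on_product[OF assms(1,2) f g]] by simp
qed

text \<open>Euler's integral after the substitution \<open>t = q exp (- x)\<close>.\<close>

lemma Gamma_integral_exp:
  fixes q z :: real
  assumes "q > 0" "z > 0"
  shows "integrable lborel (\<lambda>x. exp (- z * x) * exp (- q * exp (- x)))"
    and "(LBINT x. exp (- z * x) * exp (- q * exp (- x))) = Gamma z * q powr (- z)"
proof -
  define h where "h x = exp (- z * x) * exp (- q * exp (- x))" for x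
  define f where "f t = t powr (z - 1) / exp t" for t :: real
  define g where "g x = q * exp (- x)" for x :: real
  have range: "range g = {0<..}"
  proof (intro equalityI subsetI)
    fix t :: real assume "t \<in> {0<..}"
    then have "t = g (- ln (t / q))"
      using assms by (simp add: g_def)
    then show "t \<in> range g" by blast
  qed (use assms in \<open>auto simp: g_def\<close>)
  have f_int: "(f has_integral Gamma z) {0<..}"
  proof (rule has_integral_spike_set_eq[THEN iffD1, OF _ _ Gamma_integral_real[OF \<open>z > 0\<close>, folded f_def]])
    show "negligible {x \<in> {0..} - {0<..}. f x \<noteq> 0}"
      by (rule negligible_subset[of "{0}"]) auto
    show "negligible {x \<in> {0<..} - {0..}. f x \<noteq> 0}"
      by (rule negligible_subset[of "{}"]) auto
  qed
  then have "f absolutely_integrable_on {0<..}" "integral {0<..} f = Gamma z"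
    by (auto intro!: nonnegative_absolutely_integrable_1 simp: f_def has_integral_iff)
  moreover have "(\<lambda>x. \<bar>- (q * exp (- x))\<bar> * f (g x)) absolutely_integrable_on UNIV \<and>
      integral UNIV (\<lambda>x. \<bar>- (q * exp (- x))\<bar> * f (g x)) = Gamma z
     \<longleftrightarrow> f absolutely_integrable_on (g ` UNIV) \<and> integral (g ` UNIV) f = Gamma z"
    by (rule has_absolute_integral_change_of_variables_1')
       (use assms in \<open>auto simp: g_def inj_on_def intro!: derivative_eq_intros\<close>)
  moreover have "\<bar>- (q * exp (- x))\<bar> * f (g x) = q powr z * h x" for x
  proof -
    have "\<bar>- (q * exp (- x))\<bar> * f (g x) = (q * exp (- x)) * (q * exp (- x)) powr (z - 1) / exp (q * exp (- x))"
      using assms by (simp add: f_def g_def)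
    also have "(q * exp (- x)) * (q * exp (- x)) powr (z - 1) = (q * exp (- x)) powr z"
      using powr_add[of "q * exp (- x)" 1 "z - 1"] assms by simp
    also have "\<dots> = q powr z * exp (- z * x)"
      using assms by (simp add: powr_mult exp_powr_real mult.commute)
    finally show ?thesis
      by (simp add: h_def exp_minus divide_inverse)
  qed
  ultimately have h: "(\<lambda>x. q powr z * h x) absolutely_integrable_on UNIV"
    "integral UNIV (\<lambda>x. q powr z * h x) = Gamma z"
    by (auto simp: range)
  have meas: "(\<lambda>x. q powr z * h x) \<in> borel_measurable lborel"
    unfolding h_def by measurable
  have "integrable lebesgue (\<lambda>x. q powr z * h x)"
    using h(1) unfolding set_integrable_def by (simp only: indicator_UNIV scaleR_one)
  then have A: "integrable lborel (\<lambda>x. q powr z * h x)"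
    using integrable_completion[OF meas] by blast
  have "(LINT x|lebesgue. q powr z * h x) = Gamma z"
    using h(2) set_lebesgue_integral_eq_integral(2)[OF h(1)]
    unfolding set_lebesgue_integral_def by (simp only: indicator_UNIV scaleR_one)
  then have B: "(LBINT x. q powr z * h x) = Gamma z"
    using integral_completion[OF meas] by (simp only:)
  have "q powr (- z) * (q powr z * h x) = h x" for x
    using assms by (simp add: mult.assoc[symmetric] powr_add[symmetric])
  then have "integrable lborel h" "integral\<^sup>L lborel h = q powr (- z) * Gamma z"
    using integrable_mult_right[OF A, of "q powr (- z)"]
      Bochner_Integration.integral_mult_right_zero[of lborel "q powr (- z)" "\<lambda>x. q powr z * h x"]
    by (simp_all only: B)
  then show "integrable lborel (\<lambda>x. exp (- z * x) * exp (- q * exp (- x)))"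
    "(LBINT x. exp (- z * x) * exp (- q * exp (- x))) = Gamma z * q powr (- z)"
    by (simp_all only: h_def[abs_def] mult.commute)
qed

section \<open>Laplace transforms of bounded functions\<close>

lemma laplace_exp_integrable:
  fixes u :: real
  assumes "u > 0"
  shows "set_integrable lebesgue {0..} (\<lambda>x. exp (- u * x))" "(LINT x:{0..}|lebesgue. exp (- u * x)) = 1 / u"
proof -
  have i: "((\<lambda>x. exp (- u * x)) has_integral exp (- u * 0) / u) {0..}"
    by (rule has_integral_exp_minus_to_infinity[OF assms])
  show "set_integrable lebesgue {0..} (\<lambda>x. exp (- u * x))"
    using i by (intro nonnegative_absolutely_integrable_1) (auto simp: integrable_on_def)
  from set_lebesgue_integral_eq_integral(2)[OF this] integral_unique[OF i]
  show "(LINT x:{0..}|lebesgue. exp (- u * x)) = 1 / u" by simp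
qed

lemma laplace_integrable:
  fixes R :: "real \<Rightarrow> 'v::{banach, second_countable_topology}"
  assumes R: "set_borel_measurable lebesgue {0..} R" "\<And>x. x \<ge> 0 \<Longrightarrow> norm (R x) \<le> B" and "u > 0"
  shows "set_integrable lebesgue {0..} (\<lambda>x. exp (- u * x) *\<^sub>R R x)"
proof -
  have "set_integrable lebesgue {0..} (\<lambda>x. B * exp (- u * x))"
    using laplace_exp_integrable(1)[OF \<open>u > 0\<close>] by simp
  moreover have "(\<lambda>x. exp (- u * x)) \<in> borel_measurable lebesgue"
    by (intro measurable_completion) measurable
  then have "(\<lambda>x. exp (- u * x) *\<^sub>R (indicator {0..} x *\<^sub>R R x)) \<in> borel_measurable lebesgue"
    using R(1) unfolding set_borel_measurable_def by (rule borel_measurable_scaleR)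
  then have "set_borel_measurable lebesgue {0..} (\<lambda>x. exp (- u * x) *\<^sub>R R x)"
    unfolding set_borel_measurable_def by (simp add: mult.commute)
  ultimately show ?thesis
    by (rule set_integrable_bound)
       (auto simp: abs_mult mult.commute intro!: AE_I2 mult_left_mono order_trans[OF R(2)])
qed

text \<open>Beyond \<open>X\<close> the function is below \<open>e / 2\<close>, which contributes at
  most \<open>e / (2 * u)\<close>; the part up to \<open>X\<close> contributes a constant
  independent of \<open>u\<close>, removed by the factor \<open>u\<close>.\<close>

lemma laplace_abelian_null:
  fixes R :: "real \<Rightarrow> 'v::{banach, second_countable_topology}"
  assumes R: "set_borel_measurable lebesgue {0..} R" "\<And>x. x \<ge> 0 \<Longrightarrow> norm (R x) \<le> B"
    and lim: "(R \<longlongrightarrow> 0) at_top"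
  shows "((\<lambda>u. u *\<^sub>R laplace R u) \<longlongrightarrow> 0) (at_right 0)"
proof (rule tendstoI)
  fix e :: real assume "e > 0"
  have "B \<ge> 0"
    using order_trans[OF norm_ge_zero R(2)[of 0]] by simp
  obtain X where X: "\<And>x. x \<ge> X \<Longrightarrow> norm (R x) < e / 2"
    using tendstoD[OF lim, of "e/2"] \<open>e > 0\<close> by (auto simp: eventually_at_top_linorder)
  define X' where "X' = max X 0"
  \<comment> \<open>Chosen so that \<open>u * (B * X')\<close> stays below \<open>e / 2\<close>; the
    summand 1 keeps the denominator positive.\<close>
  define d where "d = e / (2 * (B * X' + 1))"
  have "d > 0"
    using \<open>e > 0\<close> \<open>B \<ge> 0\<close> by (auto simp: d_def X'_def add_nonneg_pos)
  have "norm (u *\<^sub>R laplace R u) < e" if u: "u > 0" "u < d" for u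
  proof -
    have i1: "set_integrable lebesgue {0..} (\<lambda>x. e / 2 * exp (- u * x))"
      using laplace_exp_integrable(1)[OF u(1)] by simp
    have i2: "set_integrable lebesgue {0..} (\<lambda>x. B * indicator {0..X'} x)"
    proof -
      have "(\<lambda>x. indicator {0..} x *\<^sub>R (B * indicator {0..X'} x)) = (\<lambda>x. B * indicator {0..X'} x :: real)"
        by (auto simp: indicator_def)
      moreover have "integrable lebesgue (indicator {0..X'} :: real \<Rightarrow> real)"
        by (intro integrable_real_indicator) (auto simp: X'_def)
      ultimately show ?thesis
        unfolding set_integrable_def by simp
    qed
    have i2': "(LINT x:{0..}|lebesgue. B * indicator {0..X'} x) = B * X'"
    proof -
      have "(LINT x:{0..}|lebesgue. B * indicator {0..X'} x) = (LINT x|lebesgue. B * indicator {0..X'} x)"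
        unfolding set_lebesgue_integral_def by (rule Bochner_Integration.integral_cong) (auto simp: indicator_def)
      then show ?thesis
        by (simp add: X'_def)
    qed
    have "norm (laplace R u) \<le> (LINT x:{0..}|lebesgue. norm (exp (- u * x) *\<^sub>R R x))"
      unfolding laplace_def by (rule set_integral_norm_bound[OF laplace_integrable[OF R u(1)]])
    also have "\<dots> \<le> (LINT x:{0..}|lebesgue. e / 2 * exp (- u * x) + B * indicator {0..X'} x)"
    proof (rule set_integral_mono)
      show "set_integrable lebesgue {0..} (\<lambda>x. norm (exp (- u * x) *\<^sub>R R x))"
        by (rule set_integrable_norm[OF laplace_integrable[OF R u(1)]])
      show "set_integrable lebesgue {0..} (\<lambda>x. e / 2 * exp (- u * x) + B * indicator {0..X'} x)"
        by (rule set_integral_add[OF i1 i2])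
      fix x :: real assume "x \<in> {0..}"
      then have x: "x \<ge> 0" by simp
      show "norm (exp (- u * x) *\<^sub>R R x) \<le> e / 2 * exp (- u * x) + B * indicator {0..X'} x"
      proof (cases "x \<le> X'")
        case True
        have "exp (- u * x) * norm (R x) \<le> 1 * B"
          using R(2)[OF x] x u(1) \<open>B \<ge> 0\<close> by (intro mult_mono) auto
        then show ?thesis
          using True x \<open>e > 0\<close> by (simp add: indicator_def add_increasing)
      next
        case False
        then have "norm (R x) \<le> e / 2"
          using X[of x] by (simp add: X'_def max_def split: if_splits)
        then show ?thesis
          using False mult_left_mono[of "norm (R x)" "e / 2" "exp (- u * x)"]
          by (simp add: indicator_def mult.commute)
      qed
    qed
    also have "\<dots> = e / 2 * (1 / u) + B * X'"
      unfolding set_integral_add(2)[OF i1 i2] i2'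
      by (simp only: set_integral_mult_right laplace_exp_integrable(2)[OF u(1)])
    finally have "norm (u *\<^sub>R laplace R u) \<le> u * (e / 2 * (1 / u) + B * X')"
      using u(1) by (simp add: mult_left_mono)
    also have "\<dots> = e / 2 + u * (B * X')"
      using u(1) by (simp add: field_simps)
    also have "u * (B * X') \<le> d * (B * X')"
      using u \<open>B \<ge> 0\<close> by (intro mult_right_mono) (auto simp: X'_def)
    also have "d * (B * X') < d * (B * X' + 1)"
      using \<open>d > 0\<close> by simp
    also have "\<dots> = e / 2"
      using \<open>B \<ge> 0\<close> by (simp add: d_def X'_def add_nonneg_pos add_nonneg_eq_0_iff field_simps)
    finally show ?thesis by simp
  qed
  then show "\<forall>\<^sub>F u in at_right 0. dist (u *\<^sub>R laplace R u) 0 < e"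
    using \<open>d > 0\<close> unfolding eventually_at_right_field by (auto intro!: exI[of _ d])
qed

section \<open>Theta series and their Mellin transforms\<close>

locale theta_series =
  fixes I :: "'i set" and q :: "'i \<Rightarrow> real" and c \<beta> M :: real
  assumes c_pos: "c > 0" and q_ge: "p \<in> I \<Longrightarrow> c \<le> q p" and \<beta>_pos: "\<beta> > 0"
    and heat_summable: "t > 0 \<Longrightarrow> (\<lambda>p. exp (- t * q p)) summable_on I"
    and heat_bound: "x \<ge> 0 \<Longrightarrow> (\<Sum>\<^sub>\<infinity>p\<in>I. exp (- exp (- x) * q p)) \<le> M * exp (\<beta> * x)"
begin

text \<open>The weighted heat trace at time \<open>exp (- x)\<close>. Small times are large
  \<open>x\<close>, where \<open>heat_bound\<close> controls growth; large times are negative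
  \<open>x\<close>, where the gap \<open>c\<close> does.\<close>

definition theta :: "('i \<Rightarrow> 'b::{banach, second_countable_topology}) \<Rightarrow> real \<Rightarrow> 'b" where
  "theta w x = (\<Sum>\<^sub>\<infinity>p\<in>I. exp (- exp (- x) * q p) *\<^sub>R w p)"

abbreviation theta1 :: "real \<Rightarrow> real" where
  "theta1 \<equiv> theta (\<lambda>_. 1)"

lemma q_pos: "p \<in> I \<Longrightarrow> q p > 0"
  using c_pos q_ge by fastforce

lemma countable_I: "countable I"
  using summable_countable_real[OF heat_summable[of 1]] by simp

lemma heat_summable': "(\<lambda>p. exp (- exp (- x) * q p)) summable_on I"
  by (rule heat_summable) simp

lemma theta_norm_summable:
  assumes W: "\<And>p. p \<in> I \<Longrightarrow> norm (w p) \<le> W"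
  shows "(\<lambda>p. norm (exp (- exp (- x) * q p) *\<^sub>R w p)) summable_on I"
  by (rule summable_on_comparison_test[OF summable_on_cmult_left[OF heat_summable'[of x], of W]])
     (auto intro: mult_left_mono W)

lemma theta1_nonneg: "theta1 x \<ge> 0"
  unfolding theta_def by (rule infsum_nonneg) auto

lemma norm_theta_le:
  assumes W: "\<And>p. p \<in> I \<Longrightarrow> norm (w p) \<le> W"
  shows "norm (theta w x) \<le> W * theta1 x"
proof -
  have "norm (theta w x) \<le> (\<Sum>\<^sub>\<infinity>p\<in>I. norm (exp (- exp (- x) * q p) *\<^sub>R w p))"
    unfolding theta_def by (rule norm_infsum_bound[OF theta_norm_summable[OF W]])
  also have "\<dots> \<le> (\<Sum>\<^sub>\<infinity>p\<in>I. W * exp (- exp (- x) * q p))"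
    by (rule infsum_mono[OF theta_norm_summable[OF W] summable_on_cmult_right[OF heat_summable']])
       (auto simp: mult.commute intro: mult_right_mono W)
  also have "\<dots> = W * theta1 x"
    by (simp add: theta_def infsum_cmult_right')
  finally show ?thesis .
qed

lemma theta1_le: "x \<ge> 0 \<Longrightarrow> theta1 x \<le> M * exp (\<beta> * x)"
  using heat_bound by (simp add: theta_def)

text \<open>For \<open>t \<ge> 1\<close> split \<open>exp (- t * q)\<close> into
  \<open>exp (- q)\<close> and \<open>exp (- (t - 1) * q)\<close>, and bound the second factor with
  \<open>q \<ge> c\<close>. At \<open>t = exp (- x)\<close> this decays doubly exponentially and
  beats the growth of \<open>exp (- z * x)\<close> for negative \<open>x\<close>.\<close>

lemma theta1_le_neg:
  assumes "x \<le> 0"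
  shows "theta1 x \<le> theta1 0 * exp c * exp (- c * exp (- x))"
proof -
  have "theta1 x \<le> (\<Sum>\<^sub>\<infinity>p\<in>I. exp (- exp (- 0) * q p) * (exp c * exp (- c * exp (- x))))"
    unfolding theta_def
  proof (rule infsum_mono)
    fix p assume "p \<in> I"
    have "0 \<le> (exp (- x) - 1) * (q p - c)"
      using q_ge[OF \<open>p \<in> I\<close>] assms by (intro mult_nonneg_nonneg) auto
    then have "- exp (- x) * q p \<le> - q p + c - c * exp (- x)"
      by (simp add: algebra_simps)
    then have "exp (- exp (- x) * q p) \<le> exp (- q p + c - c * exp (- x))"
      by (simp only: exp_le_cancel_iff)
    also have "\<dots> = exp (- exp (- 0) * q p) * (exp c * exp (- c * exp (- x)))"
      by (simp add: exp_add[symmetric])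
    finally show "exp (- exp (- x) * q p) *\<^sub>R 1 \<le> exp (- exp (- 0) * q p) * (exp c * exp (- c * exp (- x)))"
      by simp
  qed (use heat_summable'[of x] summable_on_cmult_left[OF heat_summable'[of 0]] in auto)
  also have "\<dots> = theta1 0 * (exp c * exp (- c * exp (- x)))"
    by (simp add: theta_def infsum_cmult_left')
  finally show ?thesis
    by (simp add: mult.assoc)
qed

lemma theta_measurable:
  assumes W: "\<And>p. p \<in> I \<Longrightarrow> norm (w p) \<le> W"
  shows "theta w \<in> borel_measurable borel"
proof -
  interpret sigma_finite_measure "count_space I"
    by (rule sigma_finite_measure_count_space_countable[OF countable_I])
  have "(\<lambda>(p, x). exp (- exp (- x) * q p) *\<^sub>R w p) \<in> borel_measurable (count_space I \<Otimes>\<^sub>M borel)"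
    using countable_I by (rule measurable_pair_measure_countable1) simp
  then have "(\<lambda>(x, p). exp (- exp (- x) * q p) *\<^sub>R w p) \<in> borel_measurable (borel \<Otimes>\<^sub>M count_space I)"
    using measurable_pair_swap by fastforce
  then have "(\<lambda>x. \<integral>p. exp (- exp (- x) * q p) *\<^sub>R w p \<partial>count_space I) \<in> borel_measurable borel"
    by (rule borel_measurable_lebesgue_integral)
  moreover have "(\<integral>p. exp (- exp (- x) * q p) *\<^sub>R w p \<partial>count_space I) = theta w x" for x
    unfolding theta_def by (rule count_space_integral_infsum(2)[OF theta_norm_summable[OF W]])
  ultimately show ?thesis
    by simp
qed

lemma theta1_integrable:
  assumes "z > \<beta>"
  shows "integrable lborel (\<lambda>x. exp (- z * x) * theta1 x)"
proof -
  let ?h = "\<lambda>x. exp (- (z - \<beta>) * x)"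
  have "integrable lebesgue (\<lambda>x. indicator {0..} x *\<^sub>R ?h x)"
    using laplace_exp_integrable(1)[of "z - \<beta>"] assms by (simp add: set_integrable_def)
  then have 1: "integrable lborel (\<lambda>x. indicator {0..} x *\<^sub>R ?h x)"
    by (subst (asm) integrable_completion) auto
  have 2: "integrable lborel (\<lambda>x. exp (- z * x) * exp (- c * exp (- x)))"
    using Gamma_integral_exp(1)[of c z] c_pos \<beta>_pos assms by simp
  have "integrable lborel (\<lambda>x. M * (indicator {0..} x *\<^sub>R ?h x)
      + (theta1 0 * exp c) * (exp (- z * x) * exp (- c * exp (- x))))"
    using 1 2 by (intro Bochner_Integration.integrable_add integrable_mult_right)
  then show ?thesis
  proof (rule Bochner_Integration.integrable_bound)
    show "(\<lambda>x. exp (- z * x) * theta1 x) \<in> borel_measurable lborel"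
      using theta_measurable[of "\<lambda>_. 1::real" 1] by measurable
    show "AE x in lborel. norm (exp (- z * x) * theta1 x) \<le>
      norm (M * (indicator {0..} x *\<^sub>R ?h x) + (theta1 0 * exp c) * (exp (- z * x) * exp (- c * exp (- x))))"
    proof (rule AE_I2)
      fix x :: real
      have le: "exp (- z * x) * theta1 x \<le>
        M * (indicator {0..} x *\<^sub>R ?h x) + (theta1 0 * exp c) * (exp (- z * x) * exp (- c * exp (- x)))"
      proof (cases "x \<ge> 0")
        case True
        have "exp (- z * x) * theta1 x \<le> exp (- z * x) * (M * exp (\<beta> * x))"
          by (rule mult_left_mono[OF theta1_le[OF True]]) simp
        also have "\<dots> = M * ?h x"
          by (simp add: exp_add[symmetric] algebra_simps)
        finally show ?thesis
          using True theta1_nonneg[of 0] by (simp add: add_increasing2)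
      next
        case False
        have "exp (- z * x) * theta1 x \<le> exp (- z * x) * (theta1 0 * exp c * exp (- c * exp (- x)))"
          by (rule mult_left_mono[OF theta1_le_neg]) (use False in auto)
        then show ?thesis
          using False by (simp add: mult_ac)
      qed
      moreover have "exp (- z * x) * theta1 x \<ge> 0"
        by (simp add: theta1_nonneg)
      ultimately show "norm (exp (- z * x) * theta1 x) \<le>
        norm (M * (indicator {0..} x *\<^sub>R ?h x) + (theta1 0 * exp c) * (exp (- z * x) * exp (- c * exp (- x))))"
        by simp
    qed
  qed
qed

text \<open>Finite partial sums times \<open>Gamma z\<close> are integrals of partial theta series,
  all below the integral of \<open>theta1\<close>. This has to precede \<open>mellin\<close>, where
  Fubini asks for absolute summability.\<close>

lemma zeta_summable:
  assumes "z > \<beta>"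
  shows "(\<lambda>p. q p powr (- z)) summable_on I"
proof -
  have "z > 0"
    using assms \<beta>_pos by simp
  let ?K = "LBINT x. exp (- z * x) * theta1 x"
  have "sum (\<lambda>p. q p powr (- z)) F \<le> ?K / Gamma z" if F: "finite F" "F \<subseteq> I" for F
  proof -
    have int: "integrable lborel (\<lambda>x. exp (- z * x) * exp (- q p * exp (- x)))" if "p \<in> F" for p
      using that F q_pos \<open>z > 0\<close> by (intro Gamma_integral_exp) auto
    have "(\<Sum>p\<in>F. Gamma z * q p powr (- z)) = (\<Sum>p\<in>F. LBINT x. exp (- z * x) * exp (- q p * exp (- x)))"
      using F q_pos \<open>z > 0\<close> by (intro sum.cong refl Gamma_integral_exp(2)[symmetric]) auto
    also have "\<dots> = (LBINT x. \<Sum>p\<in>F. exp (- z * x) * exp (- q p * exp (- x)))"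
      by (rule Bochner_Integration.integral_sum[OF int, symmetric])
    also have "\<dots> \<le> ?K"
    proof (rule integral_mono[OF Bochner_Integration.integrable_sum[OF int] theta1_integrable[OF assms]])
      fix x :: real
      have "(\<Sum>p\<in>F. exp (- exp (- x) * q p)) \<le> theta1 x"
        unfolding theta_def using F finite_sum_le_infsum[OF heat_summable'[of x]] by simp
      then have "exp (- z * x) * (\<Sum>p\<in>F. exp (- exp (- x) * q p)) \<le> exp (- z * x) * theta1 x"
        by (rule mult_left_mono) simp
      then show "(\<Sum>p\<in>F. exp (- z * x) * exp (- q p * exp (- x))) \<le> exp (- z * x) * theta1 x"
        by (simp add: sum_distrib_left mult.commute)
    qed
    finally have "Gamma z * sum (\<lambda>p. q p powr (- z)) F \<le> ?K"
      by (simp add: sum_distrib_left)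
    then show ?thesis
      using Gamma_real_pos[OF \<open>z > 0\<close>] by (simp add: field_simps)
  qed
  then show ?thesis
    by (intro nonneg_bdd_above_summable_on bdd_aboveI2) auto
qed

lemma mellin:
  fixes w :: "'i \<Rightarrow> 'b::{banach, second_countable_topology}"
  assumes W: "\<And>p. p \<in> I \<Longrightarrow> norm (w p) \<le> W" and "z > \<beta>"
  shows "integrable lborel (\<lambda>x. exp (- z * x) *\<^sub>R theta w x)"
    and "(LBINT x. exp (- z * x) *\<^sub>R theta w x) = Gamma z *\<^sub>R (\<Sum>\<^sub>\<infinity>p\<in>I. q p powr (- z) *\<^sub>R w p)"
proof -
  have "z > 0"
    using assms \<beta>_pos by simp
  interpret C: sigma_finite_measure "count_space I"
    by (rule sigma_finite_measure_count_space_countable[OF countable_I])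
  interpret pair_sigma_finite "count_space I" "lborel :: real measure" ..
  define f where "f p x = (exp (- z * x) * exp (- q p * exp (- x))) *\<^sub>R w p" for p x
  have int: "integrable lborel (f p)" "(LBINT x. f p x) = (Gamma z * q p powr (- z)) *\<^sub>R w p"
    "(LBINT x. norm (f p x)) = Gamma z * q p powr (- z) * norm (w p)" if "p \<in> I" for p
    using Gamma_integral_exp[OF q_pos[OF that] \<open>z > 0\<close>] by (simp_all add: f_def[abs_def] abs_mult)
  have wsum: "(\<lambda>p. norm ((Gamma z * q p powr (- z)) *\<^sub>R w p)) summable_on I"
  proof (rule summable_on_comparison_test)
    show "(\<lambda>p. Gamma z * W * q p powr (- z)) summable_on I"
      by (rule summable_on_cmult_right[OF zeta_summable[OF \<open>z > \<beta>\<close>]])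
    fix p assume "p \<in> I"
    then show "norm ((Gamma z * q p powr (- z)) *\<^sub>R w p) \<le> Gamma z * W * q p powr (- z)"
      using W[of p] Gamma_real_pos[OF \<open>z > 0\<close>] by (simp add: abs_mult mult_ac mult_right_mono)
  qed auto
  have pair: "integrable (count_space I \<Otimes>\<^sub>M lborel) (\<lambda>(p, x). f p x)"
  proof (rule Fubini_integrable)
    show "(\<lambda>(p, x). f p x) \<in> borel_measurable (count_space I \<Otimes>\<^sub>M lborel)"
      using countable_I by (rule measurable_pair_measure_countable1) (simp add: f_def)
    have "integrable (count_space I) (\<lambda>p. (Gamma z * q p powr (- z)) * norm (w p))"
      using wsum Gamma_real_pos[OF \<open>z > 0\<close>]
      by (intro count_space_integral_infsum(1)) (simp add: abs_mult)
    then show "integrable (count_space I) (\<lambda>p. LBINT x. norm (case (p, x) of (p, x) \<Rightarrow> f p x))"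
      by (subst Bochner_Integration.integrable_cong[OF refl, where g = "\<lambda>p. Gamma z * q p powr (- z) * norm (w p)"])
         (simp_all add: int)
    show "AE p in count_space I. integrable lborel (\<lambda>x. case (p, x) of (p, x) \<Rightarrow> f p x)"
      by (simp add: AE_count_space int)
  qed
  have theta: "(\<integral>p. f p x \<partial>count_space I) = exp (- z * x) *\<^sub>R theta w x" for x
  proof -
    have "(\<integral>p. f p x \<partial>count_space I)
        = (\<integral>p. exp (- z * x) *\<^sub>R (exp (- exp (- x) * q p) *\<^sub>R w p) \<partial>count_space I)"
      by (simp add: f_def mult.commute)
    also have "\<dots> = exp (- z * x) *\<^sub>R (\<integral>p. exp (- exp (- x) * q p) *\<^sub>R w p \<partial>count_space I)"
      by (rule integral_scaleR_right)
    also have "(\<integral>p. exp (- exp (- x) * q p) *\<^sub>R w p \<partial>count_space I) = theta w x"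
      unfolding theta_def by (rule count_space_integral_infsum(2)[OF theta_norm_summable[of w W x, OF W]])
    finally show ?thesis .
  qed
  show "integrable lborel (\<lambda>x. exp (- z * x) *\<^sub>R theta w x)"
    using integrable_snd[OF pair] by (simp add: theta)
  have "(LBINT x. exp (- z * x) *\<^sub>R theta w x) = (\<integral>p. (LBINT x. f p x) \<partial>count_space I)"
    using Fubini_integral[OF pair] by (simp add: theta)
  also have "\<dots> = (\<integral>p. (Gamma z * q p powr (- z)) *\<^sub>R w p \<partial>count_space I)"
    by (rule Bochner_Integration.integral_cong) (auto simp: int)
  also have "\<dots> = (\<Sum>\<^sub>\<infinity>p\<in>I. (Gamma z * q p powr (- z)) *\<^sub>R w p)"
    by (rule count_space_integral_infsum(2)[OF wsum])
  also have "\<dots> = Gamma z *\<^sub>R (\<Sum>\<^sub>\<infinity>p\<in>I. q p powr (- z) *\<^sub>R w p)"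
    unfolding scaleR_scaleR[symmetric] by (rule infsum_scaleR_right)
  finally show "(LBINT x. exp (- z * x) *\<^sub>R theta w x) = Gamma z *\<^sub>R (\<Sum>\<^sub>\<infinity>p\<in>I. q p powr (- z) *\<^sub>R w p)" .
qed

text \<open>Split the Mellin integral at \<open>x = 0\<close>. Since
  \<open>exp (- (\<beta> + u) * x)\<close> is \<open>exp (- u * x)\<close> times
  \<open>exp (- \<beta> * x)\<close>, the right half is the Laplace transform of
  \<open>F + R\<close> with a bounded null function \<open>R\<close>; the left half stays bounded as
  \<open>u\<close> tends to 0.\<close>

lemma zeta_asymptotics:
  fixes w :: "'i \<Rightarrow> 'b::{banach, second_countable_topology}"
  assumes W: "\<And>p. p \<in> I \<Longrightarrow> norm (w p) \<le> W"
    and F: "set_borel_measurable lebesgue {0..} F" "\<And>x. x \<ge> 0 \<Longrightarrow> norm (F x) \<le> B"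
    and lim: "((\<lambda>x. exp (- \<beta> * x) *\<^sub>R theta w x - F x) \<longlongrightarrow> 0) at_top"
  shows "((\<lambda>u. (u * Gamma (\<beta> + u)) *\<^sub>R (\<Sum>\<^sub>\<infinity>p\<in>I. q p powr (- (\<beta> + u)) *\<^sub>R w p) - u *\<^sub>R laplace F u) \<longlongrightarrow> 0)
    (at_right 0)"
proof -
  define R where "R x = exp (- \<beta> * x) *\<^sub>R theta w x - F x" for x
  have th: "theta w \<in> borel_measurable lebesgue"
    using theta_measurable[OF W] by (intro measurable_completion) simp
  have ex: "(\<lambda>x. exp (- \<beta> * x)) \<in> borel_measurable lebesgue"
    by (intro measurable_completion) measurable
  have "(\<lambda>x. indicator {0..} x *\<^sub>R (exp (- \<beta> * x) *\<^sub>R theta w x)) \<in> borel_measurable lebesgue"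
    by (intro borel_measurable_scaleR borel_measurable_indicator ex th) auto
  then have "(\<lambda>x. indicator {0..} x *\<^sub>R (exp (- \<beta> * x) *\<^sub>R theta w x) - indicator {0..} x *\<^sub>R F x) \<in> borel_measurable lebesgue"
    using F(1) unfolding set_borel_measurable_def by (rule borel_measurable_diff)
  then have R_meas: "set_borel_measurable lebesgue {0..} R"
    unfolding set_borel_measurable_def by (simp add: R_def scaleR_diff_right)
  have Wtheta: "norm (theta w x) \<le> \<bar>W\<bar> * theta1 x" for x
    by (rule norm_theta_le) (use W in force)
  have R_bound: "norm (R x) \<le> \<bar>W\<bar> * M + B" if "x \<ge> 0" for x
  proof -
    have "norm (exp (- \<beta> * x) *\<^sub>R theta w x) \<le> exp (- \<beta> * x) * (\<bar>W\<bar> * (M * exp (\<beta> * x)))"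
      using order_trans[OF Wtheta mult_left_mono[OF theta1_le[OF that] abs_ge_zero]] by simp
    also have "\<dots> = \<bar>W\<bar> * M"
      by (simp add: exp_minus)
    finally show ?thesis
      using F(2)[OF that] norm_triangle_ineq4[of "exp (- \<beta> * x) *\<^sub>R theta w x" "F x"] unfolding R_def by linarith
  qed
  define tail where "tail u = (LINT x:{..<0}|lebesgue. exp (- (\<beta> + u) * x) *\<^sub>R theta w x)" for u
  have split: "(u * Gamma (\<beta> + u)) *\<^sub>R (\<Sum>\<^sub>\<infinity>p\<in>I. q p powr (- (\<beta> + u)) *\<^sub>R w p) - u *\<^sub>R laplace F u
      = u *\<^sub>R laplace R u + u *\<^sub>R tail u" if "u > 0" for u
  proof -
    let ?g = "\<lambda>x. exp (- (\<beta> + u) * x) *\<^sub>R theta w x"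
    have g_int: "integrable lborel ?g" and g_val: "(LBINT x. ?g x) = Gamma (\<beta> + u) *\<^sub>R (\<Sum>\<^sub>\<infinity>p\<in>I. q p powr (- (\<beta> + u)) *\<^sub>R w p)"
      using mellin[OF W, where z = "\<beta> + u"] that by auto
    have g_leb: "integrable lebesgue ?g" "(LINT x|lebesgue. ?g x) = (LBINT x. ?g x)"
      using g_int integrable_completion[OF borel_measurable_integrable[OF g_int]]
        integral_completion[OF borel_measurable_integrable[OF g_int]] by auto
    have set_int: "set_integrable lebesgue A ?g" if "A \<in> sets lebesgue" for A
      using g_leb(1) that integrable_mult_indicator unfolding set_integrable_def by blast
    have "(LINT x|lebesgue. ?g x) = (LINT x:{0..} \<union> {..<0}|lebesgue. ?g x)"
    proof -
      have "{0..} \<union> {..<0} = (UNIV :: real set)" by auto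
      then show ?thesis by (simp add: set_lebesgue_integral_def)
    qed
    also have "\<dots> = (LINT x:{0..}|lebesgue. ?g x) + tail u"
      unfolding tail_def by (intro set_integral_Un set_int) auto
    finally have 1: "(LBINT x. ?g x) = (LINT x:{0..}|lebesgue. ?g x) + tail u"
      using g_leb(2) by (simp only:)
    have "laplace R u = (LINT x:{0..}|lebesgue. ?g x - exp (- u * x) *\<^sub>R F x)"
      unfolding laplace_def R_def
      by (simp add: scaleR_diff_right exp_add[symmetric] algebra_simps)
    also have "\<dots> = (LINT x:{0..}|lebesgue. ?g x) - laplace F u"
      unfolding laplace_def
      by (rule set_integral_diff(2)[OF set_int laplace_integrable[OF F that]]) auto
    finally show ?thesis
      using g_val 1 by (simp add: scaleR_scaleR[symmetric] scaleR_diff_right[symmetric] scaleR_add_right[symmetric]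
          del: scaleR_scaleR)
  qed
  \<comment> \<open>For negative \<open>x\<close>, \<open>exp (- (\<beta> + u) * x)\<close>
    increases with \<open>u\<close>, so the Gamma integral at \<open>u = 1\<close> dominates the
    tail for all \<open>u \<le> 1\<close>.\<close>
  define N where "N = \<bar>W\<bar> * (theta1 0 * exp c) * (Gamma (\<beta> + 1) * c powr (- (\<beta> + 1)))"
  have tail: "norm (tail u) \<le> N" if u: "0 < u" "u \<le> 1" for u
  proof -
    let ?k = "\<lambda>x. exp (- (\<beta> + 1) * x) * exp (- c * exp (- x))"
    have k: "integrable lborel ?k" "(LBINT x. ?k x) = Gamma (\<beta> + 1) * c powr (- (\<beta> + 1))"
      using Gamma_integral_exp[OF c_pos, of "\<beta> + 1"] \<beta>_pos by auto
    have k_leb: "integrable lebesgue ?k" "(LINT x|lebesgue. ?k x) = (LBINT x. ?k x)"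
      using k(1) integrable_completion[OF borel_measurable_integrable[OF k(1)]]
        integral_completion[OF borel_measurable_integrable[OF k(1)]] by auto
    have "norm (tail u) \<le> (LINT x|lebesgue. norm (indicator {..<0} x *\<^sub>R exp (- (\<beta> + u) * x) *\<^sub>R theta w x))"
      unfolding tail_def set_lebesgue_integral_def by (rule integral_norm_bound)
    also have "\<dots> \<le> (LINT x|lebesgue. \<bar>W\<bar> * (theta1 0 * exp c) * ?k x)"
    proof (rule Bochner_Integration.integral_mono)
      have "integrable lborel (\<lambda>x. exp (- (\<beta> + u) * x) *\<^sub>R theta w x)"
        using mellin(1)[OF W, where z = "\<beta> + u"] u by simp
      then have "integrable lebesgue (\<lambda>x. exp (- (\<beta> + u) * x) *\<^sub>R theta w x)"
        using integrable_completion[OF borel_measurable_integrable] by blast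
      then have "integrable lebesgue (\<lambda>x. indicator {..<0} x *\<^sub>R exp (- (\<beta> + u) * x) *\<^sub>R theta w x)"
        by (rule integrable_mult_indicator[rotated]) simp
      then show "integrable lebesgue (\<lambda>x. norm (indicator {..<0} x *\<^sub>R exp (- (\<beta> + u) * x) *\<^sub>R theta w x))"
        by (rule Bochner_Integration.integrable_norm)
      show "integrable lebesgue (\<lambda>x. \<bar>W\<bar> * (theta1 0 * exp c) * ?k x)"
        by (rule integrable_mult_right[OF k_leb(1)])
      fix x :: real
      show "norm (indicator {..<0} x *\<^sub>R exp (- (\<beta> + u) * x) *\<^sub>R theta w x) \<le> \<bar>W\<bar> * (theta1 0 * exp c) * ?k x"
      proof (cases "x < 0")
        case True
        have "(1 - u) * x \<le> 0"
          using u True by (intro mult_nonneg_nonpos) auto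
        then have e: "exp (- (\<beta> + u) * x) \<le> exp (- (\<beta> + 1) * x)"
          by (simp add: algebra_simps)
        have "norm (theta w x) \<le> \<bar>W\<bar> * (theta1 0 * exp c * exp (- c * exp (- x)))"
          using order_trans[OF Wtheta mult_left_mono[OF theta1_le_neg[of x] abs_ge_zero]] True by simp
        then have "exp (- (\<beta> + u) * x) * norm (theta w x) \<le>
            exp (- (\<beta> + 1) * x) * (\<bar>W\<bar> * (theta1 0 * exp c * exp (- c * exp (- x))))"
          using e by (intro mult_mono) auto
        then show ?thesis
          using True by (simp add: mult_ac)
      next
        case False
        then show ?thesis
          using theta1_nonneg[of 0] by simp
      qed
    qed
    also have "\<dots> = N"
      unfolding N_def integral_mult_right_zero k_leb(2) k(2) ..
    finally show ?thesis .
  qed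
  have "((\<lambda>u. u *\<^sub>R tail u) \<longlongrightarrow> 0) (at_right 0)"
  proof (rule Lim_null_comparison)
    show "((\<lambda>u. u * N) \<longlongrightarrow> 0) (at_right 0)"
      by (auto intro!: tendsto_eq_intros)
    show "\<forall>\<^sub>F u in at_right 0. norm (u *\<^sub>R tail u) \<le> u * N"
      unfolding eventually_at_right_field using tail
      by (intro exI[of _ 1]) (auto intro!: mult_left_mono)
  qed
  moreover have "((\<lambda>u. u *\<^sub>R laplace R u) \<longlongrightarrow> 0) (at_right 0)"
    using R_meas R_bound lim[folded R_def] by (rule laplace_abelian_null)
  ultimately have "((\<lambda>u. u *\<^sub>R laplace R u + u *\<^sub>R tail u) \<longlongrightarrow> 0) (at_right 0)"
    using tendsto_add by fastforce
  then show ?thesis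
  proof (rule Lim_transform_eventually)
    show "\<forall>\<^sub>F u in at_right 0. u *\<^sub>R laplace R u + u *\<^sub>R tail u =
        (u * Gamma (\<beta> + u)) *\<^sub>R (\<Sum>\<^sub>\<infinity>p\<in>I. q p powr (- (\<beta> + u)) *\<^sub>R w p) - u *\<^sub>R laplace F u"
      unfolding eventually_at_right_field using split by (intro exI[of _ 1]) auto
  qed
qed

text \<open>Convergence at some \<open>z < \<beta>\<close> bounds the zeta series uniformly for
  \<open>0 < u \<le> 1\<close>, so the factor \<open>u\<close> wins. Used by contradiction, against
  a non-zero limit.\<close>

lemma scaled_zeta_null_if_summable_below:
  assumes z: "(\<lambda>p. q p powr (- z)) summable_on I" "z < \<beta>"
  shows "((\<lambda>u. u * Gamma (\<beta> + u) * (\<Sum>\<^sub>\<infinity>p\<in>I. q p powr (- (\<beta> + u)))) \<longlongrightarrow> 0) (at_right 0)"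
proof -
  \<comment> \<open>As \<open>u\<close> runs through the unit interval, powers of \<open>c\<close>
    with exponent \<open>- (\<beta> + u - z)\<close> are at most 1 if \<open>c \<ge> 1\<close>, and
    at most their value at \<open>u = 1\<close> otherwise.\<close>
  define K where "K = max 1 (c powr (- (\<beta> + 1 - z)))"
  have le: "q p powr (- (\<beta> + u)) \<le> K * q p powr (- z)" if p: "p \<in> I" and u: "0 < u" "u \<le> 1" for p u
  proof -
    have "q p powr (- (\<beta> + u - z)) \<le> c powr (- (\<beta> + u - z))"
      using q_ge[OF p] c_pos z(2) u by (intro powr_mono2') auto
    also have "\<dots> \<le> K"
    proof (cases "c \<ge> 1")
      case True
      then have "c powr (- (\<beta> + u - z)) \<le> c powr 0"
        using z(2) u by (intro powr_mono) auto
      then show ?thesis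
        using c_pos by (simp add: K_def)
    next
      case False
      then have "c powr (- (\<beta> + u - z)) \<le> c powr (- (\<beta> + 1 - z))"
        using c_pos u by (intro powr_mono') auto
      then show ?thesis
        by (simp add: K_def)
    qed
    finally have "q p powr (- (\<beta> + u - z)) * q p powr (- z) \<le> K * q p powr (- z)"
      by (rule mult_right_mono) simp
    then show ?thesis
      by (simp add: powr_add[symmetric])
  qed
  define S where "S = K * (\<Sum>\<^sub>\<infinity>p\<in>I. q p powr (- z))"
  have sum: "norm (\<Sum>\<^sub>\<infinity>p\<in>I. q p powr (- (\<beta> + u))) \<le> S" if u: "0 < u" "u \<le> 1" for u
  proof -
    have "(\<Sum>\<^sub>\<infinity>p\<in>I. q p powr (- (\<beta> + u))) \<le> (\<Sum>\<^sub>\<infinity>p\<in>I. K * q p powr (- z))"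
      using u by (intro infsum_mono zeta_summable summable_on_cmult_right z(1) le) auto
    then have "(\<Sum>\<^sub>\<infinity>p\<in>I. q p powr (- (\<beta> + u))) \<le> S"
      by (simp add: S_def infsum_cmult_right')
    moreover have "(\<Sum>\<^sub>\<infinity>p\<in>I. q p powr (- (\<beta> + u))) \<ge> 0"
      by (rule infsum_nonneg) simp
    ultimately show ?thesis by simp
  qed
  have "\<beta> + 0 \<notin> \<int>\<^sub>\<le>\<^sub>0"
    using \<beta>_pos by (auto elim!: nonpos_Ints_cases)
  have "((\<lambda>u. Gamma (\<beta> + u)) \<longlongrightarrow> Gamma (\<beta> + 0)) (at_right 0)"
    by (intro tendsto_intros \<open>\<beta> + 0 \<notin> _\<close>)
  then have "((\<lambda>u. u * Gamma (\<beta> + u) * S) \<longlongrightarrow> 0 * Gamma (\<beta> + 0) * S) (at_right 0)"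
    by (intro tendsto_mult tendsto_const tendsto_ident_at)
  then have lim: "((\<lambda>u. u * Gamma (\<beta> + u) * S) \<longlongrightarrow> 0) (at_right 0)"
    by simp
  show ?thesis
  proof (rule Lim_null_comparison[OF _ lim])
    show "\<forall>\<^sub>F u in at_right 0. norm (u * Gamma (\<beta> + u) * (\<Sum>\<^sub>\<infinity>p\<in>I. q p powr (- (\<beta> + u)))) \<le> u * Gamma (\<beta> + u) * S"
      unfolding eventually_at_right_field
    proof (intro exI[of _ 1] conjI allI impI)
      fix u :: real assume u: "0 < u" "u < 1"
      have "Gamma (\<beta> + u) > 0"
        using u \<beta>_pos by (intro Gamma_real_pos) simp
      then show "norm (u * Gamma (\<beta> + u) * (\<Sum>\<^sub>\<infinity>p\<in>I. q p powr (- (\<beta> + u)))) \<le> u * Gamma (\<beta> + u) * S"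
        using u sum[of u] unfolding norm_mult by (intro mult_mono) auto
    qed simp
  qed
qed

end

section \<open>Heat traces and the spectral state\<close>

lemma bounded_op_id: "bounded_op (\<lambda>x. x)"
  by (simp add: bounded_op_def clinear_map_def bounded_linear_ident)

lemma bounded_op_coeff_bound:
  assumes "bounded_op A" "orthonormal_set E"
  obtains C where "\<And>e. e \<in> E \<Longrightarrow> cmod (cinner e (A e)) \<le> C"
proof -
  obtain C where C: "\<And>x. norm (A x) \<le> norm x * C"
    using bounded_linear.bounded[OF bounded_opD(1)[OF assms(1)]] by auto
  have "cmod (cinner e (A e)) \<le> C" if "e \<in> E" for e
    using cinner_norm_le[of e "A e"] C[of e] orthonormal_norm[OF assms(2) that] by simp
  then show ?thesis using that by blast
qed

context eigenbasis
begin

lemma heat_op_diagonal: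
  assumes "t > 0"
  shows "bounded_op (heat_op D t)" "e \<in> E \<Longrightarrow> heat_op D t e = exp (- t * (ev e)\<^sup>2) *\<^sub>R e"
  using assms bounded_op_fun_calc[of "\<lambda>l. exp (- t * l\<^sup>2)" 1]
    fun_calc_eigenvector[OF eigenvector, of e "\<lambda>l. exp (- t * l\<^sup>2)"]
  by (auto simp: heat_op_def)

lemma heat_summable:
  assumes "t > 0" "trace_class (heat_op D t)"
  shows "(\<lambda>e. exp (- t * (ev e)\<^sup>2)) summable_on E"
  using diagonal_trace_class_iff[OF basis heat_op_diagonal[OF assms(1)]] assms(2) by simp

lemma heat_trace:
  assumes "t > 0" "trace_class (heat_op D t)" "bounded_op A"
  shows "op_trace (heat_op D t \<circ> A) = (\<Sum>\<^sub>\<infinity>e\<in>E. of_real (exp (- t * (ev e)\<^sup>2)) * cinner e (A e))"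
  using diagonal_op_trace[OF basis heat_op_diagonal[OF assms(1)] assms(3)] heat_summable[OF assms(1,2)] by simp

lemma heat_coeff_summable:
  assumes "t > 0" "trace_class (heat_op D t)" "bounded_op A"
  shows "(\<lambda>e. norm (of_real (exp (- t * (ev e)\<^sup>2)) * cinner e (A e))) summable_on E"
proof -
  obtain C where C: "\<And>e. e \<in> E \<Longrightarrow> cmod (cinner e (A e)) \<le> C"
    using bounded_op_coeff_bound[OF assms(3) orthonormal] by blast
  show ?thesis
    by (rule summable_on_comparison_test[OF summable_on_cmult_left[OF heat_summable[OF assms(1,2)], of C]])
       (auto simp: norm_mult intro: mult_left_mono C)
qed

lemma countable_basis:
  assumes "trace_class (heat_op D 1)"
  shows "countable E"
  using summable_countable_real[OF heat_summable[OF _ assms]] by simp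

end

context tensor_dirac_bases
begin

definition "tensor_coeff A1 A2 = (\<lambda>(e, f). cinner e (A1 e) * cinner f (A2 f))"

text \<open>The Gaussian of a sum of squares factors, and so does the diagonal entry of
  \<open>A1 \<otimes> A2\<close>; absolute summability of both factors licenses the product of
  sums.\<close>

lemma heat_trace_product:
  assumes heat: "\<And>t. t > 0 \<Longrightarrow> trace_class (heat_op D1 t)" "\<And>t. t > 0 \<Longrightarrow> trace_class (heat_op D2 t)"
    and "t > 0" "bounded_op A1" "bounded_op A2"
  shows "(\<Sum>\<^sub>\<infinity>p\<in>E1 \<times> E2. exp (- t * square_eigenvalue p) *\<^sub>R tensor_coeff A1 A2 p)
    = op_trace (heat_op D1 t \<circ> A1) * op_trace (heat_op D2 t \<circ> A2)"
proof -
  let ?a = "\<lambda>e. of_real (exp (- t * (ev1 e)\<^sup>2)) * cinner e (A1 e)"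
  let ?b = "\<lambda>f. of_real (exp (- t * (ev2 f)\<^sup>2)) * cinner f (A2 f)"
  have "exp (- t * square_eigenvalue p) *\<^sub>R tensor_coeff A1 A2 p = (case p of (e, f) \<Rightarrow> ?a e * ?b f)" for p
    by (cases p) (simp add: square_eigenvalue_def tensor_coeff_def scaleR_conv_of_real distrib_left exp_add
        exp_diff exp_minus divide_inverse)
  then have "(\<Sum>\<^sub>\<infinity>p\<in>E1 \<times> E2. exp (- t * square_eigenvalue p) *\<^sub>R tensor_coeff A1 A2 p)
      = (\<Sum>\<^sub>\<infinity>(e, f)\<in>E1 \<times> E2. ?a e * ?b f)"
    by (simp cong: infsum_cong)
  also have "\<dots> = infsum ?a E1 * infsum ?b E2"
    using assms by (intro infsum_times_product E1.countable_basis E2.countable_basis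
        E1.heat_coeff_summable E2.heat_coeff_summable) auto
  finally show ?thesis
    using assms by (simp only: E1.heat_trace E2.heat_trace)
qed

lemma heat_pair_summable:
  assumes heat: "\<And>t. t > 0 \<Longrightarrow> trace_class (heat_op D1 t)" "\<And>t. t > 0 \<Longrightarrow> trace_class (heat_op D2 t)"
    and "t > 0"
  shows "(\<lambda>p. exp (- t * square_eigenvalue p)) summable_on (E1 \<times> E2)"
proof -
  have "(\<lambda>(e, f). norm (exp (- t * (ev1 e)\<^sup>2) * exp (- t * (ev2 f)\<^sup>2))) summable_on (E1 \<times> E2)"
    using assms by (intro infsum_times_product E1.countable_basis E2.countable_basis)
      (use E1.heat_summable[OF assms(3)] E2.heat_summable[OF assms(3)] in auto)
  then show ?thesis
    by (simp add: square_eigenvalue_def case_prod_unfold distrib_left exp_add exp_diff exp_minus divide_inverse)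
qed

lemma tensor_coeff_eq:
  assumes "bounded_op A1" "bounded_op A2"
  shows "cinner (ten (fst p) (snd p)) (tensor_op ten A1 A2 (ten (fst p) (snd p))) = tensor_coeff A1 A2 p"
  by (simp add: tensor_op[OF assms] cinner_ten tensor_coeff_def case_prod_unfold)

lemma tensor_coeff_bound:
  assumes "bounded_op A1" "bounded_op A2"
  obtains C where "\<And>p. p \<in> E1 \<times> E2 \<Longrightarrow> cmod (tensor_coeff A1 A2 p) \<le> C"
proof -
  obtain C1 where C1: "\<And>e. e \<in> E1 \<Longrightarrow> cmod (cinner e (A1 e)) \<le> C1"
    using bounded_op_coeff_bound[OF assms(1) E1.orthonormal] by blast
  obtain C2 where C2: "\<And>e. e \<in> E2 \<Longrightarrow> cmod (cinner e (A2 e)) \<le> C2"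
    using bounded_op_coeff_bound[OF assms(2) E2.orthonormal] by blast
  have "cmod (tensor_coeff A1 A2 p) \<le> \<bar>C1\<bar> * \<bar>C2\<bar>" if "p \<in> E1 \<times> E2" for p
    using that C1[of "fst p"] C2[of "snd p"]
    by (auto simp: tensor_coeff_def norm_mult intro!: mult_mono)
  then show ?thesis using that by blast
qed

text \<open>Makes the zeta function the case of two identities in the formulas for \<open>A1\<close>
  and \<open>A2\<close>.\<close>

lemma tensor_op_id: "tensor_op ten (\<lambda>x. x) (\<lambda>x. x) = (\<lambda>x. x)"
  by (rule bounded_op_eqI) (auto simp: tensor_op bounded_op_id)

end

text \<open>The error is small relative to \<open>f\<close>, which may have zeros, so no quotient is
  formed. Boundedness of \<open>f\<close> turns it into an additive error that survives
  multiplication of traces; \<open>exp (\<alpha> * x)\<close> is \<open>t powr (- \<alpha>)\<close>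
  at \<open>t = exp (- x)\<close>.\<close>

lemma asymptotic_at_0_exp:
  assumes g: "asymptotic_at_0 g (\<lambda>t. f (- ln t) * of_real (t powr \<alpha>))"
    and B: "\<And>x. x \<ge> 0 \<Longrightarrow> norm (f x) \<le> B"
  shows "((\<lambda>x. of_real (exp (\<alpha> * x)) * g (exp (- x)) - f x) \<longlongrightarrow> 0) at_top"
proof (rule tendstoI)
  fix e :: real assume "e > 0"
  have "B \<ge> 0"
    using order_trans[OF norm_ge_zero B[of 0]] by simp
  define d where "d = e / (B + 1)"
  have "d > 0"
    using \<open>e > 0\<close> \<open>B \<ge> 0\<close> by (simp add: d_def)
  have "filterlim (\<lambda>x::real. exp (- x)) (at_right 0) at_top"
    unfolding filterlim_at
    by (auto intro!: filterlim_compose[OF exp_at_bot] filterlim_uminus_at_bot_at_top)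
  moreover have "\<forall>\<^sub>F t in at_right 0. norm (g t - f (- ln t) * of_real (t powr \<alpha>))
      \<le> d * norm (f (- ln t) * of_real (t powr \<alpha>))"
    using g \<open>d > 0\<close> unfolding asymptotic_at_0_def by (rule landau_o.smallD)
  ultimately have "\<forall>\<^sub>F x in at_top. norm (g (exp (- x)) - f (- ln (exp (- x))) * of_real (exp (- x) powr \<alpha>))
      \<le> d * norm (f (- ln (exp (- x))) * of_real (exp (- x) powr \<alpha>))"
    by (rule eventually_compose_filterlim[rotated])
  then show "\<forall>\<^sub>F x in at_top. dist (of_real (exp (\<alpha> * x)) * g (exp (- x)) - f x) 0 < e"
    using eventually_ge_at_top[of 0]
  proof eventually_elim
    fix x :: real
    assume x: "x \<ge> 0" and le: "norm (g (exp (- x)) - f (- ln (exp (- x))) * of_real (exp (- x) powr \<alpha>))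
      \<le> d * norm (f (- ln (exp (- x))) * of_real (exp (- x) powr \<alpha>))"
    have p: "exp (- x) powr \<alpha> = exp (- (\<alpha> * x))"
      by (simp add: exp_powr_real mult.commute)
    have e1: "complex_of_real (exp (\<alpha> * x)) * of_real (exp (- (\<alpha> * x))) = 1"
      by (simp only: of_real_mult[symmetric] exp_add[symmetric]) simp
    have "of_real (exp (\<alpha> * x)) * g (exp (- x)) - f x
        = of_real (exp (\<alpha> * x)) * (g (exp (- x)) - f x * of_real (exp (- (\<alpha> * x))))"
      unfolding right_diff_distrib mult.left_commute[of "of_real (exp (\<alpha> * x))"] e1 by simp
    then have "norm (of_real (exp (\<alpha> * x)) * g (exp (- x)) - f x)
        = exp (\<alpha> * x) * norm (g (exp (- x)) - f x * of_real (exp (- (\<alpha> * x))))"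
      by (simp only: norm_mult norm_of_real abs_exp_cancel)
    also have "\<dots> \<le> exp (\<alpha> * x) * (d * norm (f x * of_real (exp (- (\<alpha> * x)))))"
      using le by (intro mult_left_mono) (simp_all add: p)
    also have "\<dots> = d * norm (f x) * (exp (\<alpha> * x) * exp (- (\<alpha> * x)))"
      by (simp only: norm_mult norm_of_real abs_exp_cancel mult_ac)
    also have "\<dots> = d * norm (f x)"
      by (simp only: exp_add[symmetric]) simp
    also have "\<dots> \<le> d * B"
      using B[OF x] \<open>d > 0\<close> by simp
    also have "\<dots> < d * (B + 1)"
      using \<open>d > 0\<close> by simp
    also have "\<dots> = e"
      using \<open>B \<ge> 0\<close> by (simp add: d_def)
    finally show "dist (of_real (exp (\<alpha> * x)) * g (exp (- x)) - f x) 0 < e"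
      by simp
  qed
qed

section \<open>Products and quotients known up to null functions\<close>

lemma tendsto_bounded_mult_null:
  fixes a b :: "_ \<Rightarrow> 'b::real_normed_algebra"
  assumes "(a \<longlongrightarrow> 0) F" "\<forall>\<^sub>F x in F. norm (b x) \<le> B"
  shows "((\<lambda>x. a x * b x) \<longlongrightarrow> 0) F"
proof (rule Lim_null_comparison)
  show "((\<lambda>x. norm (a x) * B) \<longlongrightarrow> 0) F"
    using tendsto_mult_left_zero[OF tendsto_norm_zero[OF assms(1)]] .
  show "\<forall>\<^sub>F x in F. norm (a x * b x) \<le> norm (a x) * B"
    using assms(2) by eventually_elim (meson mult_left_mono norm_ge_zero norm_mult_ineq order_trans)
qed

lemma tendsto_product_diff_null:
  fixes a1 a2 f1 f2 :: "_ \<Rightarrow> 'b::{real_normed_algebra, comm_ring}"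
  assumes 1: "((\<lambda>x. a1 x - f1 x) \<longlongrightarrow> 0) F" and 2: "((\<lambda>x. a2 x - f2 x) \<longlongrightarrow> 0) F"
    and "\<forall>\<^sub>F x in F. norm (f1 x) \<le> B1" "\<forall>\<^sub>F x in F. norm (f2 x) \<le> B2"
  shows "((\<lambda>x. a1 x * a2 x - f1 x * f2 x) \<longlongrightarrow> 0) F"
proof -
  have "((\<lambda>x. (a1 x - f1 x) * (a2 x - f2 x) + ((a1 x - f1 x) * f2 x + (a2 x - f2 x) * f1 x)) \<longlongrightarrow> 0) F"
    using tendsto_add[OF tendsto_mult_zero[OF 1 2]
      tendsto_add[OF tendsto_bounded_mult_null[OF 1 assms(4)] tendsto_bounded_mult_null[OF 2 assms(3)]]]
    by simp
  moreover have "(a1 x - f1 x) * (a2 x - f2 x) + ((a1 x - f1 x) * f2 x + (a2 x - f2 x) * f1 x)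
      = a1 x * a2 x - f1 x * f2 x" for x
    by (simp add: algebra_simps)
  ultimately show ?thesis by simp
qed

text \<open>Numerators are only bounded, so neither quotient need converge; the common non-zero
  limit of the denominators is what makes the difference vanish.\<close>

lemma tendsto_quotient_diff_null:
  fixes a a' b b' :: "_ \<Rightarrow> 'b::real_normed_field"
  assumes a: "((\<lambda>x. a' x - a x) \<longlongrightarrow> 0) F" and b: "(b \<longlongrightarrow> l) F" "(b' \<longlongrightarrow> l) F" and "l \<noteq> 0"
    and B: "\<forall>\<^sub>F x in F. norm (a x) \<le> B"
  shows "((\<lambda>x. a' x / b' x - a x / b x) \<longlongrightarrow> 0) F"
proof -
  have "((\<lambda>x. (a' x - a x) * inverse (b' x)) \<longlongrightarrow> 0 * inverse l) F"
    using \<open>l \<noteq> 0\<close> by (intro tendsto_intros a b)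
  moreover have "((\<lambda>x. inverse (b' x) - inverse (b x)) \<longlongrightarrow> inverse l - inverse l) F"
    using \<open>l \<noteq> 0\<close> by (intro tendsto_intros b)
  then have "((\<lambda>x. (inverse (b' x) - inverse (b x)) * a x) \<longlongrightarrow> 0) F"
    by (intro tendsto_bounded_mult_null[OF _ B]) simp
  ultimately have "((\<lambda>x. (a' x - a x) * inverse (b' x) + (inverse (b' x) - inverse (b x)) * a x)
      \<longlongrightarrow> 0 * inverse l + 0) F"
    by (rule tendsto_add)
  moreover have "(a' x - a x) * inverse (b' x) + (inverse (b' x) - inverse (b x)) * a x
      = a' x / b' x - a x / b x" for x
    by (simp add: divide_inverse algebra_simps)
  ultimately show ?thesis by simp
qed

lemma locally_integrable_measurable:
  fixes f :: "real \<Rightarrow> 'v::euclidean_space"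
  assumes "locally_integrable f"
  shows "set_borel_measurable lebesgue {0..} f"
  unfolding set_borel_measurable_def
proof (rule borel_measurable_LIMSEQ_metric)
  fix n :: nat
  have "f absolutely_integrable_on {0..real n}"
    using assms by (simp add: locally_integrable_def)
  then show "(\<lambda>x. indicator {0..real n} x *\<^sub>R f x) \<in> borel_measurable lebesgue"
    unfolding set_integrable_def by (rule borel_measurable_integrable)
next
  fix x :: real
  show "(\<lambda>n. indicator {0..real n} x *\<^sub>R f x) \<longlonglongrightarrow> indicator {0..} x *\<^sub>R f x"
  proof (rule tendsto_eventually)
    obtain N where "x \<le> real N"
      using real_arch_simple by blast
    then show "\<forall>\<^sub>F n in sequentially. indicator {0..real n} x *\<^sub>R f x = indicator {0..} x *\<^sub>R f x"
      unfolding eventually_sequentially by (intro exI[of _ N]) (auto simp: indicator_def)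
  qed
qed

lemma set_borel_measurable_times:
  fixes f g :: "_ \<Rightarrow> 'v::{real_normed_algebra, second_countable_topology}"
  assumes "set_borel_measurable M A f" "set_borel_measurable M A g"
  shows "set_borel_measurable M A (\<lambda>x. f x * g x)"
proof -
  have "(\<lambda>x. (indicator A x *\<^sub>R f x) * (indicator A x *\<^sub>R g x)) \<in> borel_measurable M"
    using assms unfolding set_borel_measurable_def by (rule borel_measurable_times)
  moreover have "(indicator A x *\<^sub>R f x) * (indicator A x *\<^sub>R g x) = indicator A x *\<^sub>R (f x * g x)" for x
    by (simp add: indicator_def)
  ultimately show ?thesis
    unfolding set_borel_measurable_def by (simp only:)
qed

lemma laplace_of_real: "laplace (\<lambda>x. complex_of_real (f x)) s = of_real (laplace f s)"
  unfolding laplace_def set_lebesgue_integral_def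
  by (simp add: scaleR_conv_of_real of_real_mult[symmetric] del: of_real_mult)

lemma laplace_norm_le:
  fixes F :: "real \<Rightarrow> 'v::{banach, second_countable_topology}"
  assumes F: "set_borel_measurable lebesgue {0..} F" "\<And>x. x \<ge> 0 \<Longrightarrow> norm (F x) \<le> B" and "u > 0"
  shows "norm (u *\<^sub>R laplace F u) \<le> B"
proof -
  have "norm (laplace F u) \<le> (LINT x:{0..}|lebesgue. norm (exp (- u * x) *\<^sub>R F x))"
    unfolding laplace_def by (rule set_integral_norm_bound[OF laplace_integrable[OF assms]])
  also have "\<dots> \<le> (LINT x:{0..}|lebesgue. B * exp (- u * x))"
    using laplace_exp_integrable(1)[OF \<open>u > 0\<close>]
    by (intro set_integral_mono set_integrable_norm[OF laplace_integrable[OF assms]])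
       (auto simp: mult.commute intro!: mult_right_mono F)
  also have "\<dots> = B / u"
    using laplace_exp_integrable(2)[OF \<open>u > 0\<close>] by simp
  finally show ?thesis
    using \<open>u > 0\<close> by (simp add: field_simps)
qed

text \<open>The substitution \<open>s = 2 * (b + u)\<close> as an equality of filters, hence usable
  for limits in both directions.\<close>

lemma at_right_double_shift: "at_right (2 * b) = filtermap (\<lambda>u. 2 * (b + u)) (at_right (0::real))"
proof -
  have "at_right (2 * b) = filtermap (\<lambda>x. x + 2 * b) (filtermap (times 2) (at_right 0))"
    by (subst at_right_to_0) (simp add: filtermap_times_pos_at_right)
  also have "\<dots> = filtermap (\<lambda>u. 2 * (b + u)) (at_right 0)"
    by (simp add: filtermap_filtermap algebra_simps)
  finally show ?thesis .
qed

section \<open>Comparison of the trace quotient with the Laplace quotient\<close>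

context tensor_dirac_bases
begin

text \<open>Supplies \<open>heat_bound\<close> for the theta series. For \<open>x \<ge> X\<close>
  the asymptotics give the constant \<open>B + 1\<close>; for smaller \<open>x\<close> the heat
  trace is monotone and at most its value at \<open>X\<close>.\<close>

lemma heat_bound_exists:
  assumes heat: "\<And>t. t > 0 \<Longrightarrow> trace_class (heat_op D1 t)" "\<And>t. t > 0 \<Longrightarrow> trace_class (heat_op D2 t)"
    and lim: "((\<lambda>x. exp (- \<beta> * x) *\<^sub>R (\<Sum>\<^sub>\<infinity>p\<in>E1 \<times> E2. exp (- exp (- x) * square_eigenvalue p) *\<^sub>R
      tensor_coeff (\<lambda>x. x) (\<lambda>x. x) p) - F x) \<longlongrightarrow> 0) at_top"
    and F: "\<And>x. x \<ge> 0 \<Longrightarrow> norm (F x) \<le> B" and "\<beta> > 0"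
  obtains M where
    "\<And>x. x \<ge> 0 \<Longrightarrow> (\<Sum>\<^sub>\<infinity>p\<in>E1 \<times> E2. exp (- exp (- x) * square_eigenvalue p)) \<le> M * exp (\<beta> * x)"
proof -
  define \<theta> where "\<theta> x = (\<Sum>\<^sub>\<infinity>p\<in>E1 \<times> E2. exp (- exp (- x) * square_eigenvalue p))" for x
  have sm: "(\<lambda>p. exp (- exp (- x) * square_eigenvalue p)) summable_on (E1 \<times> E2)" for x
    by (rule heat_pair_summable[OF heat]) auto
  have "tensor_coeff (\<lambda>x. x) (\<lambda>x. x) p = 1" if "p \<in> E1 \<times> E2" for p
    using that orthonormal_norm[OF E1.orthonormal] orthonormal_norm[OF E2.orthonormal]
    by (auto simp: tensor_coeff_def cinner_self)
  then have "(\<Sum>\<^sub>\<infinity>p\<in>E1 \<times> E2. exp (- exp (- x) * square_eigenvalue p) *\<^sub>R tensor_coeff (\<lambda>x. x) (\<lambda>x. x) p)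
      = (\<Sum>\<^sub>\<infinity>p\<in>E1 \<times> E2. complex_of_real (exp (- exp (- x) * square_eigenvalue p)))" for x
    by (intro infsum_cong) (simp add: scaleR_conv_of_real)
  also have "\<dots> x = of_real (\<theta> x)" for x
    unfolding \<theta>_def by (rule infsumI[OF has_sum_of_real[OF has_sum_infsum[OF sm]]])
  finally have lim': "((\<lambda>x. exp (- \<beta> * x) *\<^sub>R of_real (\<theta> x) - F x) \<longlongrightarrow> 0) at_top"
    using lim by simp
  obtain X where X: "\<And>x. x \<ge> X \<Longrightarrow> norm (exp (- \<beta> * x) *\<^sub>R of_real (\<theta> x) - F x) < 1"
    using tendstoD[OF lim', of 1] by (auto simp: eventually_at_top_linorder)
  have \<theta>_nonneg: "\<theta> x \<ge> 0" for x
    unfolding \<theta>_def by (rule infsum_nonneg) simp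
  have "\<theta> x \<le> max (B + 1) (\<theta> X) * exp (\<beta> * x)" if x: "x \<ge> 0" for x
  proof (cases "x \<ge> X")
    case True
    have "norm (exp (- \<beta> * x) *\<^sub>R complex_of_real (\<theta> x)) \<le> B + 1"
      using X[OF True] F[OF x] norm_triangle_ineq2[of "exp (- \<beta> * x) *\<^sub>R complex_of_real (\<theta> x)" "F x"] by linarith
    then have "exp (- \<beta> * x) * \<theta> x \<le> B + 1"
      using \<theta>_nonneg[of x] by simp
    then have "\<theta> x \<le> (B + 1) * exp (\<beta> * x)"
      by (simp add: exp_minus field_simps)
    also have "\<dots> \<le> max (B + 1) (\<theta> X) * exp (\<beta> * x)"
      by (rule mult_right_mono) auto
    finally show ?thesis .
  next
    case False
    have "\<theta> x \<le> \<theta> X"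
      unfolding \<theta>_def
    proof (rule infsum_mono[OF sm sm])
      fix p assume "p \<in> E1 \<times> E2"
      then have "0 \<le> square_eigenvalue p"
        by (auto simp: square_eigenvalue_def)
      then show "exp (- exp (- x) * square_eigenvalue p) \<le> exp (- exp (- X) * square_eigenvalue p)"
        using False by (simp add: mult_right_mono)
    qed
    also have "\<dots> \<le> \<theta> X * exp (\<beta> * x)"
      using \<theta>_nonneg[of X] x \<open>\<beta> > 0\<close> by (simp add: mult_le_cancel_left1)
    also have "\<dots> \<le> max (B + 1) (\<theta> X) * exp (\<beta> * x)"
      by (rule mult_right_mono) auto
    finally show ?thesis .
  qed
  then show ?thesis
    using that unfolding \<theta>_def by blast
qed

lemma spectral_state_iff:
  fixes f1 f2 F1 F2 :: "real \<Rightarrow> complex" and f :: "real \<Rightarrow> real"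
  assumes heat: "\<And>t. t > 0 \<Longrightarrow> trace_class (heat_op D1 t)" "\<And>t. t > 0 \<Longrightarrow> trace_class (heat_op D2 t)"
    and A: "bounded_op A1" "bounded_op A2" and \<alpha>: "\<alpha>1 < 0" "\<alpha>2 < 0"
    and f: "\<And>x. f1 x * f2 x = of_real (f x)"
    and asym: "asymptotic_at_0 (\<lambda>t. op_trace (heat_op D1 t)) (\<lambda>t. f1 (- ln t) * of_real (t powr \<alpha>1))"
      "asymptotic_at_0 (\<lambda>t. op_trace (heat_op D2 t)) (\<lambda>t. f2 (- ln t) * of_real (t powr \<alpha>2))"
      "asymptotic_at_0 (\<lambda>t. op_trace (heat_op D1 t \<circ> A1)) (\<lambda>t. F1 (- ln t) * of_real (t powr \<alpha>1))"
      "asymptotic_at_0 (\<lambda>t. op_trace (heat_op D2 t \<circ> A2)) (\<lambda>t. F2 (- ln t) * of_real (t powr \<alpha>2))"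
    and bdd: "bounded (f1 ` {0..})" "bounded (f2 ` {0..})" "bounded (F1 ` {0..})" "bounded (F2 ` {0..})"
    and meas: "set_borel_measurable lebesgue {0..} f1" "set_borel_measurable lebesgue {0..} f2"
      "set_borel_measurable lebesgue {0..} F1" "set_borel_measurable lebesgue {0..} F2"
    and l: "((\<lambda>s. s * laplace f s) \<longlongrightarrow> l) (at_right 0)" "l \<noteq> 0"
  shows "has_spectral_state D (tensor_op ten A1 A2) \<tau> \<longleftrightarrow>
    ((\<lambda>s. laplace (\<lambda>x. F1 x * F2 x) s / of_real (laplace f s)) \<longlongrightarrow> \<tau>) (at_right 0)"
proof -
  define \<beta> where "\<beta> = - \<alpha>1 - \<alpha>2"
  have "\<beta> > 0"
    using \<alpha> by (simp add: \<beta>_def)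
  let ?id1 = "\<lambda>x::'h1. x" and ?id2 = "\<lambda>x::'h2. x"
  have bound: "\<exists>B. \<forall>x\<ge>0. norm (h x) \<le> B" if "bounded (h ` {0..})" for h :: "real \<Rightarrow> complex"
    using that by (auto simp: bounded_iff)
  obtain b1 b2 B1 B2 where b: "\<And>x. x \<ge> 0 \<Longrightarrow> norm (f1 x) \<le> b1" "\<And>x. x \<ge> 0 \<Longrightarrow> norm (f2 x) \<le> b2"
    "\<And>x. x \<ge> 0 \<Longrightarrow> norm (F1 x) \<le> B1" "\<And>x. x \<ge> 0 \<Longrightarrow> norm (F2 x) \<le> B2"
    using bound[OF bdd(1)] bound[OF bdd(2)] bound[OF bdd(3)] bound[OF bdd(4)] by metis
  have prod_bound: "norm (g x * h x) \<le> c * d"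
    if "\<And>x. x \<ge> 0 \<Longrightarrow> norm (g x) \<le> c" "\<And>x. x \<ge> 0 \<Longrightarrow> norm (h x) \<le> d" "x \<ge> 0"
    for g h :: "real \<Rightarrow> complex" and c d x
    unfolding norm_mult using that order_trans[OF norm_ge_zero that(1)[OF that(3)]] by (intro mult_mono) auto
  have lim: "((\<lambda>x. exp (- \<beta> * x) *\<^sub>R (\<Sum>\<^sub>\<infinity>p\<in>E1 \<times> E2. exp (- exp (- x) * square_eigenvalue p) *\<^sub>R
      tensor_coeff T1 T2 p) - h1 x * h2 x) \<longlongrightarrow> 0) at_top"
    if T: "bounded_op T1" "bounded_op T2"
      and h: "asymptotic_at_0 (\<lambda>t. op_trace (heat_op D1 t \<circ> T1)) (\<lambda>t. h1 (- ln t) * of_real (t powr \<alpha>1))"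
        "asymptotic_at_0 (\<lambda>t. op_trace (heat_op D2 t \<circ> T2)) (\<lambda>t. h2 (- ln t) * of_real (t powr \<alpha>2))"
      and c: "\<And>x. x \<ge> 0 \<Longrightarrow> norm (h1 x) \<le> c1" "\<And>x. x \<ge> 0 \<Longrightarrow> norm (h2 x) \<le> c2"
    for T1 T2 h1 h2 c1 c2
  proof -
    have "((\<lambda>x. (of_real (exp (\<alpha>1 * x)) * op_trace (heat_op D1 (exp (- x)) \<circ> T1)) *
        (of_real (exp (\<alpha>2 * x)) * op_trace (heat_op D2 (exp (- x)) \<circ> T2)) - h1 x * h2 x) \<longlongrightarrow> 0) at_top"
      using asymptotic_at_0_exp[OF h(1) c(1)] asymptotic_at_0_exp[OF h(2) c(2)]
      by (rule tendsto_product_diff_null[where ?B1.0 = c1 and ?B2.0 = c2])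
         (use c in \<open>auto intro!: eventually_at_top_linorderI[of 0]\<close>)
    moreover have "(of_real (exp (\<alpha>1 * x)) * op_trace (heat_op D1 (exp (- x)) \<circ> T1)) *
        (of_real (exp (\<alpha>2 * x)) * op_trace (heat_op D2 (exp (- x)) \<circ> T2))
      = exp (- \<beta> * x) *\<^sub>R (\<Sum>\<^sub>\<infinity>p\<in>E1 \<times> E2. exp (- exp (- x) * square_eigenvalue p) *\<^sub>R tensor_coeff T1 T2 p)"
      for x
    proof -
      have "exp (- \<beta> * x) = exp (\<alpha>1 * x) * exp (\<alpha>2 * x)"
        by (simp add: \<beta>_def exp_add[symmetric] algebra_simps)
      then show ?thesis
        by (subst heat_trace_product[OF heat _ T]) (auto simp: scaleR_conv_of_real)
    qed
    ultimately show ?thesis by simp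
  qed
  have id: "op_trace (heat_op D1 t \<circ> ?id1) = op_trace (heat_op D1 t)"
    "op_trace (heat_op D2 t \<circ> ?id2) = op_trace (heat_op D2 t)" for t
    by (simp_all add: o_def)
  have lim_f: "((\<lambda>x. exp (- \<beta> * x) *\<^sub>R (\<Sum>\<^sub>\<infinity>p\<in>E1 \<times> E2. exp (- exp (- x) * square_eigenvalue p) *\<^sub>R
      tensor_coeff ?id1 ?id2 p) - f1 x * f2 x) \<longlongrightarrow> 0) at_top"
    by (rule lim[OF bounded_op_id bounded_op_id _ _ b(1,2)]) (simp_all add: id asym)
  have lim_F: "((\<lambda>x. exp (- \<beta> * x) *\<^sub>R (\<Sum>\<^sub>\<infinity>p\<in>E1 \<times> E2. exp (- exp (- x) * square_eigenvalue p) *\<^sub>R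
      tensor_coeff A1 A2 p) - F1 x * F2 x) \<longlongrightarrow> 0) at_top"
    by (rule lim[OF A asym(3,4) b(3,4)])
  obtain M where M: "\<And>x. x \<ge> 0 \<Longrightarrow>
      (\<Sum>\<^sub>\<infinity>p\<in>E1 \<times> E2. exp (- exp (- x) * square_eigenvalue p)) \<le> M * exp (\<beta> * x)"
    using heat_bound_exists[OF heat lim_f prod_bound[where g = f1 and h = f2, OF b(1,2)] \<open>\<beta> > 0\<close>] by blast
  interpret theta_series "E1 \<times> E2" square_eigenvalue "c\<^sup>2" \<beta> M
    using gap_pos square_eigenvalue_ge \<open>\<beta> > 0\<close> heat_pair_summable[OF heat] M
    by unfold_locales auto
  \<comment> \<open>\<open>|D|\<close> has the square roots of \<open>square_eigenvalue\<close> as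
    its spectrum, so the exponent \<open>\<beta> + u\<close> of the theta series becomes
    \<open>2 * (\<beta> + u)\<close> here. The prefactor is the one in
    \<open>zeta_asymptotics\<close>.\<close>
  define P where "P T1 T2 u = (u * Gamma (\<beta> + u)) *\<^sub>R op_trace (abs_power D (2 * (\<beta> + u)) \<circ> tensor_op ten T1 T2)"
    for T1 T2 u
  have bop: "bounded_op (abs_power D (2 * (\<beta> + u)))" if "u > 0" for u
    using \<open>\<beta> > 0\<close> that by (intro bounded_op_abs_power) simp
  have half: "- (2 * (\<beta> + u)) / 2 = - (\<beta> + u)" for u
    by (simp add: field_simps)
  have zs: "(\<lambda>p. square_eigenvalue p powr (- (2 * (\<beta> + u)) / 2)) summable_on E1 \<times> E2" if "u > 0" for u
    using zeta_summable[of "\<beta> + u"] that unfolding half by simp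
  have tr: "op_trace (abs_power D (2 * (\<beta> + u)) \<circ> tensor_op ten T1 T2)
      = (\<Sum>\<^sub>\<infinity>p\<in>E1 \<times> E2. square_eigenvalue p powr (- (\<beta> + u)) *\<^sub>R tensor_coeff T1 T2 p)"
    if "u > 0" "bounded_op T1" "bounded_op T2" for u T1 T2
    using op_trace_abs_power[OF bop[OF that(1)] tensor_op(1)[OF that(2,3)] zs[OF that(1)]]
    unfolding half by (simp add: tensor_coeff_eq[OF that(2,3)] scaleR_conv_of_real)
  have P_lim: "((\<lambda>u. P T1 T2 u - u *\<^sub>R laplace (\<lambda>x. h1 x * h2 x) u) \<longlongrightarrow> 0) (at_right 0)"
    if T: "bounded_op T1" "bounded_op T2"
      and m: "set_borel_measurable lebesgue {0..} h1" "set_borel_measurable lebesgue {0..} h2"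
      and c: "\<And>x. x \<ge> 0 \<Longrightarrow> norm (h1 x) \<le> c1" "\<And>x. x \<ge> 0 \<Longrightarrow> norm (h2 x) \<le> c2"
      and lim: "((\<lambda>x. exp (- \<beta> * x) *\<^sub>R (\<Sum>\<^sub>\<infinity>p\<in>E1 \<times> E2. exp (- exp (- x) * square_eigenvalue p) *\<^sub>R
          tensor_coeff T1 T2 p) - h1 x * h2 x) \<longlongrightarrow> 0) at_top"
    for T1 T2 h1 h2 c1 c2
  proof -
    obtain W where W: "\<And>p. p \<in> E1 \<times> E2 \<Longrightarrow> cmod (tensor_coeff T1 T2 p) \<le> W"
      using tensor_coeff_bound[OF T] by blast
    from zeta_asymptotics[OF W set_borel_measurable_times[OF m] prod_bound[where g = h1 and h = h2, OF c] lim[folded theta_def]]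
    show ?thesis
    proof (rule Lim_transform_eventually)
      show "\<forall>\<^sub>F u in at_right 0.
          (u * Gamma (\<beta> + u)) *\<^sub>R (\<Sum>\<^sub>\<infinity>p\<in>E1 \<times> E2. square_eigenvalue p powr (- (\<beta> + u)) *\<^sub>R tensor_coeff T1 T2 p)
            - u *\<^sub>R laplace (\<lambda>x. h1 x * h2 x) u
          = P T1 T2 u - u *\<^sub>R laplace (\<lambda>x. h1 x * h2 x) u"
        unfolding eventually_at_right_field P_def
        by (intro exI[of _ 1] conjI allI impI) (simp_all only: tr[OF _ T] zero_less_one)
    qed
  qed
  have P_A: "((\<lambda>u. P A1 A2 u - u *\<^sub>R laplace (\<lambda>x. F1 x * F2 x) u) \<longlongrightarrow> 0) (at_right 0)"
    by (rule P_lim[OF A meas(3,4) b(3,4) lim_F])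
  have P_id: "((\<lambda>u. P ?id1 ?id2 u - u *\<^sub>R laplace (\<lambda>x. f1 x * f2 x) u) \<longlongrightarrow> 0) (at_right 0)"
    by (rule P_lim[OF bounded_op_id bounded_op_id meas(1,2) b(1,2) lim_f])
  have laplace_f: "u *\<^sub>R laplace (\<lambda>x. f1 x * f2 x) u = of_real (u * laplace f u)" for u
    by (simp add: f laplace_of_real scaleR_conv_of_real)
  have lap_lim: "((\<lambda>u. complex_of_real (u * laplace f u)) \<longlongrightarrow> of_real l) (at_right 0)"
    by (rule tendsto_of_real[OF l(1)])
  have P_id_lim: "(P ?id1 ?id2 \<longlongrightarrow> of_real l) (at_right 0)"
    using tendsto_add[OF P_id lap_lim] by (simp add: laplace_f)

  have abscissa: "zeta_abscissa D = ereal (2 * \<beta>)"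
  proof (rule antisym)
    show "zeta_abscissa D \<le> ereal (2 * \<beta>)"
    proof (rule ereal_le_epsilon2)
      \<comment> \<open>The bound is approached from above, since trace class is known only strictly
        to the right of \<open>2 * \<beta>\<close>.\<close>
      fix e :: real assume "e > 0"
      then have "e / 2 > 0" by simp
      then have "trace_class (abs_power D (2 * (\<beta> + e / 2)))"
        by (intro trace_class_abs_power_iff[THEN iffD2] bop zs)
      then have "zeta_abscissa D \<le> ereal (2 * (\<beta> + e / 2))"
        unfolding zeta_abscissa_def by (intro Inf_lower) auto
      then show "zeta_abscissa D \<le> ereal (2 * \<beta>) + ereal e"
        by (simp add: distrib_left)
    qed
    show "ereal (2 * \<beta>) \<le> zeta_abscissa D"
      unfolding zeta_abscissa_def
    proof (rule Inf_greatest, clarify)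
      fix s assume tc: "trace_class (abs_power D s)"
      show "ereal (2 * \<beta>) \<le> ereal s"
      proof (rule ccontr)
        assume "\<not> ?thesis"
        then have "s / 2 < \<beta>" by simp
        have "bounded_op (abs_power D s)"
          using tc by (simp add: trace_class_def)
        then have "(\<lambda>p. square_eigenvalue p powr (- (s / 2))) summable_on (E1 \<times> E2)"
          using trace_class_abs_power_iff tc by simp
        from scaled_zeta_null_if_summable_below[OF this \<open>s / 2 < \<beta>\<close>]
        have "((\<lambda>u. complex_of_real (u * Gamma (\<beta> + u) *
            (\<Sum>\<^sub>\<infinity>p\<in>E1 \<times> E2. square_eigenvalue p powr (- (\<beta> + u))))) \<longlongrightarrow> of_real 0) (at_right 0)"
          by (rule tendsto_of_real)
        moreover have "\<forall>\<^sub>F u in at_right 0. complex_of_real (u * Gamma (\<beta> + u) *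
            (\<Sum>\<^sub>\<infinity>p\<in>E1 \<times> E2. square_eigenvalue p powr (- (\<beta> + u)))) = P ?id1 ?id2 u"
          unfolding eventually_at_right_field
        proof (intro exI[of _ 1] conjI allI impI)
          fix u :: real assume "0 < u" "u < 1"
          have "tensor_coeff ?id1 ?id2 p = 1" if "p \<in> E1 \<times> E2" for p
            using that orthonormal_norm[OF E1.orthonormal] orthonormal_norm[OF E2.orthonormal]
            by (auto simp: tensor_coeff_def cinner_self)
          then have "P ?id1 ?id2 u = (u * Gamma (\<beta> + u)) *\<^sub>R
              (\<Sum>\<^sub>\<infinity>p\<in>E1 \<times> E2. complex_of_real (square_eigenvalue p powr (- (\<beta> + u))))"
            unfolding P_def tr[OF \<open>0 < u\<close> bounded_op_id bounded_op_id]
            by (simp add: scaleR_conv_of_real cong: infsum_cong)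
          also have "(\<Sum>\<^sub>\<infinity>p\<in>E1 \<times> E2. complex_of_real (square_eigenvalue p powr (- (\<beta> + u))))
              = of_real (\<Sum>\<^sub>\<infinity>p\<in>E1 \<times> E2. square_eigenvalue p powr (- (\<beta> + u)))"
            using zeta_summable[of "\<beta> + u"] \<open>0 < u\<close> by (intro infsumI has_sum_of_real has_sum_infsum) simp
          finally show "complex_of_real (u * Gamma (\<beta> + u) *
              (\<Sum>\<^sub>\<infinity>p\<in>E1 \<times> E2. square_eigenvalue p powr (- (\<beta> + u)))) = P ?id1 ?id2 u"
            by (simp add: scaleR_conv_of_real)
        qed simp
        ultimately have "(P ?id1 ?id2 \<longlongrightarrow> of_real 0) (at_right 0)"
          by (rule Lim_transform_eventually)
        then have "complex_of_real l = of_real 0"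
          using tendsto_unique[OF _ P_id_lim] by simp
        with l(2) show False by simp
      qed
    qed
  qed

  have FB: "norm (F1 x * F2 x) \<le> B1 * B2" if "x \<ge> 0" for x
    using prod_bound[where g = F1 and h = F2, OF b(3,4) that] .
  have "\<forall>\<^sub>F u in at_right 0. norm (u *\<^sub>R laplace (\<lambda>x. F1 x * F2 x) u) \<le> B1 * B2"
    unfolding eventually_at_right_field
    by (intro exI[of _ 1] conjI allI impI laplace_norm_le set_borel_measurable_times meas FB) simp_all
  from tendsto_quotient_diff_null[OF P_A lap_lim P_id_lim _ this]
  have "((\<lambda>u. P A1 A2 u / P ?id1 ?id2 u - (u *\<^sub>R laplace (\<lambda>x. F1 x * F2 x) u) / of_real (u * laplace f u)) \<longlongrightarrow> 0)
      (at_right 0)"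
    using l(2) by simp
  then have diff: "((\<lambda>u. op_trace (abs_power D (2 * (\<beta> + u)) \<circ> tensor_op ten A1 A2) / op_trace (abs_power D (2 * (\<beta> + u)))
      - laplace (\<lambda>x. F1 x * F2 x) u / of_real (laplace f u)) \<longlongrightarrow> 0) (at_right 0)"
  proof (rule Lim_transform_eventually)
    show "\<forall>\<^sub>F u in at_right 0. P A1 A2 u / P ?id1 ?id2 u
        - (u *\<^sub>R laplace (\<lambda>x. F1 x * F2 x) u) / of_real (u * laplace f u)
      = op_trace (abs_power D (2 * (\<beta> + u)) \<circ> tensor_op ten A1 A2) / op_trace (abs_power D (2 * (\<beta> + u)))
        - laplace (\<lambda>x. F1 x * F2 x) u / of_real (laplace f u)"
      unfolding eventually_at_right_field
    proof (intro exI[of _ 1] conjI allI impI)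
      fix u :: real assume u: "0 < u" "u < 1"
      \<comment> \<open>Lets the factor \<open>u * Gamma (\<beta> + u)\<close> cancel between the
        two traces, as \<open>u\<close> does between the two Laplace transforms.\<close>
      have "Gamma (\<beta> + u) > 0"
        using u \<open>\<beta> > 0\<close> by (intro Gamma_real_pos) simp
      then show "P A1 A2 u / P ?id1 ?id2 u - (u *\<^sub>R laplace (\<lambda>x. F1 x * F2 x) u) / of_real (u * laplace f u)
          = op_trace (abs_power D (2 * (\<beta> + u)) \<circ> tensor_op ten A1 A2) / op_trace (abs_power D (2 * (\<beta> + u)))
            - laplace (\<lambda>x. F1 x * F2 x) u / of_real (laplace f u)"
        using u by (simp add: P_def tensor_op_id o_def scaleR_conv_of_real)
    qed simp
  qed
  have "has_spectral_state D (tensor_op ten A1 A2) \<tau> \<longleftrightarrow>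
      ((\<lambda>s. op_trace (abs_power D s \<circ> tensor_op ten A1 A2) / op_trace (abs_power D s)) \<longlongrightarrow> \<tau>) (at_right (2 * \<beta>))"
    by (simp add: has_spectral_state_def abscissa)
  also have "\<dots> \<longleftrightarrow> ((\<lambda>u. op_trace (abs_power D (2 * (\<beta> + u)) \<circ> tensor_op ten A1 A2)
      / op_trace (abs_power D (2 * (\<beta> + u)))) \<longlongrightarrow> \<tau>) (at_right 0)"
    unfolding at_right_double_shift[of \<beta>] filterlim_filtermap ..
  also have "\<dots> \<longleftrightarrow> ((\<lambda>s. laplace (\<lambda>x. F1 x * F2 x) s / of_real (laplace f s)) \<longlongrightarrow> \<tau>) (at_right 0)"
    by (rule Lim_transform_eq[OF diff])
  finally show ?thesis .
qed

end

theorem lemma2p7: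
  fixes \<pi>1 :: "'a1::complex_star_algebra \<Rightarrow> 'h1::complex_hilbert \<Rightarrow> 'h1"
    and \<pi>2 :: "'a2::complex_star_algebra \<Rightarrow> 'h2::complex_hilbert \<Rightarrow> 'h2"
    and \<pi> :: "'a::complex_star_algebra \<Rightarrow> 'h::complex_hilbert \<Rightarrow> 'h"
    and D1 :: "'h1 graph" and D2 :: "'h2 graph" and D :: "'h graph"
    and \<gamma> :: "'h1 \<Rightarrow> 'h1"
    and ten :: "'h1 \<Rightarrow> 'h2 \<Rightarrow> 'h" and ta :: "'a1 \<Rightarrow> 'a2 \<Rightarrow> 'a"
    and \<alpha>1 \<alpha>2 :: real and f1 f2 :: "real \<Rightarrow> real"
    and A1 :: "'h1 \<Rightarrow> 'h1" and A2 :: "'h2 \<Rightarrow> 'h2" and fA1 fA2 :: "real \<Rightarrow> complex"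
  assumes "even_spectral_triple \<pi>1 D1 \<gamma>"
    and "spectral_triple \<pi>2 D2"
    and "is_tensor_triple ten ta \<pi>1 D1 \<gamma> \<pi>2 D2 \<pi> D"
    and "\<alpha>1 < 0" and "\<alpha>2 < 0"
    and "asymptotic_at_0 (\<lambda>t. op_trace (heat_op D1 t)) (\<lambda>t. of_real (f1 (- ln t) * t powr \<alpha>1))"
    and "asymptotic_at_0 (\<lambda>t. op_trace (heat_op D2 t)) (\<lambda>t. of_real (f2 (- ln t) * t powr \<alpha>2))"
    and "bounded (f1 ` {0..})" and "bounded (f2 ` {0..})"
    and "locally_integrable f1" and "locally_integrable f2"
    and "\<exists>l. l \<noteq> 0 \<and> ((\<lambda>s. s * laplace f1 s) \<longlongrightarrow> l) (at_right 0)"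
    and "\<exists>l. l \<noteq> 0 \<and> ((\<lambda>s. s * laplace f2 s) \<longlongrightarrow> l) (at_right 0)"
    and "\<exists>l. l \<noteq> 0 \<and> ((\<lambda>s. s * laplace (\<lambda>x. f1 x * f2 x) s) \<longlongrightarrow> l) (at_right 0)"
    and "bounded_op A1" and "bounded_op A2"
    and "weakly_regular D1 \<alpha>1 A1 fA1" and "weakly_regular D2 \<alpha>2 A2 fA2"
  shows "\<forall>\<tau>. has_spectral_state D (tensor_op ten A1 A2) \<tau> \<longleftrightarrow>
           ((\<lambda>s. laplace (\<lambda>x. fA1 x * fA2 x) s / of_real (laplace (\<lambda>x. f1 x * f2 x) s))
              \<longlongrightarrow> \<tau>) (at_right 0)"
proof
  fix \<tau>
  note triple1 = assms(1)[unfolded even_spectral_triple_def spectral_triple_def]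
  note triple2 = assms(2)[unfolded spectral_triple_def]
  have D1: "self_adjoint D1" "has_compact_inverse D1" and D2: "self_adjoint D2" "has_compact_inverse D2"
    using triple1 triple2 by blast+
  obtain E1 ev1 c where E1: "eigenbasis D1 E1 ev1" "c > 0" "\<And>e. e \<in> E1 \<Longrightarrow> c \<le> \<bar>ev1 e\<bar>"
    using self_adjoint_compact_inverse_eigenbasis[OF D1] by blast
  obtain E2 ev2 c2 where E2: "eigenbasis D2 E2 ev2" "c2 > 0" "\<And>e. e \<in> E2 \<Longrightarrow> c2 \<le> \<bar>ev2 e\<bar>"
    using self_adjoint_compact_inverse_eigenbasis[OF D2] by blast
  interpret E1: eigenbasis D1 E1 ev1 by (rule E1(1))
  interpret E2: eigenbasis D2 E2 ev2 by (rule E2(1))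
  interpret tensor_dirac_bases ten D1 D2 \<gamma> E1 ev1 E2 ev2 c
    using triple1 assms(3) E1 by unfold_locales (auto simp: is_tensor_triple_def)
  have D: "D = tensor_dirac ten D1 \<gamma> D2"
    using assms(3) by (simp add: is_tensor_triple_def)
  obtain l where l: "l \<noteq> 0" "((\<lambda>s. s * laplace (\<lambda>x. f1 x * f2 x) s) \<longlongrightarrow> l) (at_right 0)"
    using assms(14) by blast
  \<comment> \<open>Traces are complex, so \<open>f1\<close> and \<open>f2\<close> enter the
    comparison as complex functions, on the same footing as \<open>fA1\<close> and
    \<open>fA2\<close>.\<close>
  have real: "bounded ((\<lambda>x. complex_of_real (f x)) ` {0..})"
    "set_borel_measurable lebesgue {0..} (\<lambda>x. complex_of_real (f x))"
    if "bounded (f ` {0..})" "locally_integrable f" for f :: "real \<Rightarrow> real"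
  proof -
    show "bounded ((\<lambda>x. complex_of_real (f x)) ` {0..})"
      using that(1) by (auto simp: bounded_iff)
    have "(\<lambda>x. complex_of_real (indicator {0..} x *\<^sub>R f x)) \<in> borel_measurable lebesgue"
      using locally_integrable_measurable[OF that(2)] unfolding set_borel_measurable_def
      by (rule borel_measurable_continuous_on[rotated]) (intro continuous_intros)
    then show "set_borel_measurable lebesgue {0..} (\<lambda>x. complex_of_real (f x))"
      unfolding set_borel_measurable_def by (simp add: scaleR_conv_of_real)
  qed
  have heat: "\<And>t. t > 0 \<Longrightarrow> trace_class (heat_op D1 t)" "\<And>t. t > 0 \<Longrightarrow> trace_class (heat_op D2 t)"
    using triple1 triple2 by blast+
  have asym: "asymptotic_at_0 (\<lambda>t. op_trace (heat_op D1 t)) (\<lambda>t. of_real (f1 (- ln t)) * of_real (t powr \<alpha>1))"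
    "asymptotic_at_0 (\<lambda>t. op_trace (heat_op D2 t)) (\<lambda>t. of_real (f2 (- ln t)) * of_real (t powr \<alpha>2))"
    using assms(6,7) by (simp_all only: of_real_mult)
  note regular1 = assms(17)[unfolded weakly_regular_def] and regular2 = assms(18)[unfolded weakly_regular_def]
  have regular: "asymptotic_at_0 (\<lambda>t. op_trace (heat_op D1 t \<circ> A1)) (\<lambda>t. fA1 (- ln t) * of_real (t powr \<alpha>1))"
    "asymptotic_at_0 (\<lambda>t. op_trace (heat_op D2 t \<circ> A2)) (\<lambda>t. fA2 (- ln t) * of_real (t powr \<alpha>2))"
    "bounded (fA1 ` {0..})" "bounded (fA2 ` {0..})"
    "set_borel_measurable lebesgue {0..} fA1" "set_borel_measurable lebesgue {0..} fA2"
    using regular1 regular2 locally_integrable_measurable by blast+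
  show "has_spectral_state D (tensor_op ten A1 A2) \<tau> \<longleftrightarrow>
           ((\<lambda>s. laplace (\<lambda>x. fA1 x * fA2 x) s / of_real (laplace (\<lambda>x. f1 x * f2 x) s))
              \<longlongrightarrow> \<tau>) (at_right 0)"
    unfolding D
    by (rule spectral_state_iff[where ?f1.0 = "\<lambda>x. of_real (f1 x)" and ?f2.0 = "\<lambda>x. of_real (f2 x)"
          and f = "\<lambda>x. f1 x * f2 x", OF heat assms(15,16,4,5) of_real_mult[symmetric] asym regular(1,2)
          real(1)[OF assms(8,10)] real(1)[OF assms(9,11)] regular(3,4)
          real(2)[OF assms(8,10)] real(2)[OF assms(9,11)] regular(5,6) l(2,1)])
qed

end
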